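(* Any minimal surface $f_{min}$ in $\mathbb S^3$ with unit normal $N$, metric $2e^{\hat u}\,\mathrm dz\,\mathrm d\bar z$ and Hopf differential $\mathcal Q\,\mathrm dz^2$ gives a minimal Lagrangian surface $f=[f_{min}+iN]\in Q_2$ with holomorphic differential $-i\mathcal Q\,\mathrm dz^2$ and metric $$2e^u\,\mathrm dz\,\mathrm d\bar z=\bigl(e^{\hat u}+|\mathcal Q|^2e^{-\hat u}\bigr)\,\mathrm dz\,\mathrm d\bar z .$$ Conversely, for any minimal Lagrangian surface $f$ in $Q_2$ with holomorphic differential $\hat\alpha\,\mathrm dz^2$ and metric $2e^u\,\mathrm dz\,\mathrm d\bar z$, there exists a unique map $g=(f_{min},N)$ which takes values in the unit tangent bundle $\mathrm U\mathbb S^3=\mathbb S^3\times\mathbb S^2$ and whose metric is $4e^u\,\mathrm dz\,\mathrm d\bar z$. Furthermore, both projections $f_{min}$ and $N$ share the Hopf differential $i\hat\alpha\,\mathrm dz^2$, and the metrics $2e^{\hat u}\,\mathrm dz\,\mathrm d\bar z$ of $f_{min}$ and $2e^{\tilde u}\,\mathrm dz\,\mathrm d\bar z$ of $N$ are given by $$e^{\hat u}=e^u+\sqrt{e^{2u}-|\hat\alpha|^2},\qquad e^{\tilde u}=e^u-\sqrt{e^{2u}-|\hat\alpha|^2}.$$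
   Context: Let $\langle \boldsymbol z,\boldsymbol w\rangle=\sum_{k=1}^4 z_kw_k$ be the complex bilinear form on $\mathbb C^4$. $\mathbb CP^3$ carries the Fubini–Study metric of constant holomorphic sectional curvature $4$, and $Q_2=\{[\boldsymbol z]\in\mathbb CP^3:\langle\boldsymbol z,\boldsymbol z\rangle=0\}$ carries the induced Kähler structure. A surface in $Q_2$ is Lagrangian if the Kähler form pulls back to zero, and minimal if its mean curvature vector in $Q_2$ vanishes. Surfaces are conformally immersed Riemann surfaces, $z=x+iy$ is a local conformal coordinate, $\partial_z=\frac12(\partial_x-i\partial_y)$, $\partial_{\bar z}=\frac12(\partial_x+i\partial_y)$. A local horizontal lift of $f$ is a map $\mathfrak f$ into $\mathbb S^7\subset\mathbb C^4$ with $f=[\mathfrak f]$ and $\langle\mathfrak f_z,\bar{\mathfrak f}\rangle=\langle\mathfrak f_{\bar z},\bar{\mathfrak f}\rangle=0$. For a minimal Lagrangian surface one takes a local horizontal lift $\hat{\mathfrak f}$ for which $\langle\hat{\mathfrak f}_z,\hat{\mathfrak f}_{\bar z}\rangle$ is a non-negative real function; the holomorphic differential of $f$ is then $\hat\alpha\,\mathrm dz^2$ with $\hat\alpha=\langle\hat{\mathfrak f}_z,\hat{\mathfrak f}_z\rangle$. In the first part the lift is $\hat{\mathfrak f}=\frac{\sqrt2}{2}(f_{min}+iN)$. $\mathbb S^3\subset\mathbb R^4$ is the unit sphere. The Hopf differential of $f_{min}$ is the $(2,0)$-part $\mathcal Q\,\mathrm dz^2$ of its second fundamental form, $\mathcal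 Q=\langle(f_{min})_{zz},N\rangle$; the normal $N$ is regarded as the dual minimal surface of $f_{min}$, with Hopf differential $\langle N_{zz},f_{min}\rangle\,\mathrm dz^2$. $\mathrm U\mathbb S^3$ carries the Sasakian metric; for $g=(f_{min},N)$ with $f_{min}$ minimal and $N$ its unit normal, the metric of $g$ is the sum of the metrics of $f_{min}$ and of $N$.
   Formalization: In the converse, g is tied to f=[f_min+iN] and its lift; uniqueness is up to sign given phase and differential (−g also qualifies). If the lift's ⟨f_z,f_z̄⟩≡0, the phase is fixed by ⟨f_z̄,f_z̄⟩=−conj⟨f_z,f_z⟩. N is immersed only off zeros of the differential, where its metric vanishes. *)

theory Defs
  imports "HOL-Complex_Analysis.Complex_Analysis"
begin

section \<open>Riemann surfaces\<close>

type_synonym 'a chart = "'a set \<times> ('a \<Rightarrow> complex)"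

definition riemann_surface :: "'a topology \<Rightarrow> 'a chart set \<Rightarrow> bool" where
  "riemann_surface M A \<longleftrightarrow>
     Hausdorff_space M \<and> connected_space M \<and>
     (\<Union>c\<in>A. fst c) = topspace M \<and>
     (\<forall>(U, \<phi>)\<in>A. openin M U \<and> open (\<phi> ` U) \<and>
        homeomorphic_map (subtopology M U) (top_of_set (\<phi> ` U)) \<phi>) \<and>
     (\<forall>(U, \<phi>)\<in>A. \<forall>(U', \<phi>')\<in>A. (\<phi>' \<circ> inv_into U \<phi>) holomorphic_on \<phi> ` (U \<inter> U'))"

text \<open>The part of \<open>V\<close> seen in the chart \<open>c\<close>, and a map on the surface written in the
  coordinate of \<open>c\<close>. Differentials \<open>q dz\<^sup>2\<close> and metrics \<open>\<rho> |dz|\<^sup>2\<close> on a surface are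
  given by their coefficients, one function of the coordinate for each chart.\<close>

definition cdom :: "'a chart \<Rightarrow> 'a set \<Rightarrow> complex set" where
  "cdom c V = snd c ` (fst c \<inter> V)"

definition loc :: "'a chart \<Rightarrow> ('a \<Rightarrow> 'b) \<Rightarrow> complex \<Rightarrow> 'b" where
  "loc c F = F \<circ> inv_into (fst c) (snd c)"


section \<open>Calculus in a conformal coordinate\<close>

definition pd :: "complex \<Rightarrow> (complex \<Rightarrow> 'b::real_normed_vector) \<Rightarrow> complex \<Rightarrow> 'b" where
  "pd v F z = frechet_derivative F (at z) v"

text \<open>Meaningful on open sets only; \<open>pd 1\<close> and \<open>pd \<i>\<close> are the partial derivatives in
  \<open>x\<close> and \<open>y\<close>.\<close>

primrec Ck_on :: "nat \<Rightarrow> complex set \<Rightarrow> (complex \<Rightarrow> 'b::real_normed_vector) \<Rightarrow> bool" where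
  "Ck_on 0 D F \<longleftrightarrow> continuous_on D F"
| "Ck_on (Suc k) D F \<longleftrightarrow> F differentiable_on D \<and> (\<forall>v. Ck_on k D (pd v F))"

definition smooth_on :: "complex set \<Rightarrow> (complex \<Rightarrow> 'b::real_normed_vector) \<Rightarrow> bool" where
  "smooth_on D F \<longleftrightarrow> (\<forall>k. Ck_on k D F)"

definition dz :: "(complex \<Rightarrow> complex^4) \<Rightarrow> complex \<Rightarrow> complex^4" where
  "dz F z = (1/2) *s (pd 1 F z - \<i> *s pd \<i> F z)"

definition dzb :: "(complex \<Rightarrow> complex^4) \<Rightarrow> complex \<Rightarrow> complex^4" where
  "dzb F z = (1/2) *s (pd 1 F z + \<i> *s pd \<i> F z)"

text \<open>The complex bilinear form. The Hermitian product of \<open>v\<close> and \<open>w\<close> is \<open>cbil v (vcnj w)\<close>;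
  its real part is the library's inner product \<open>v \<bullet> w\<close> on \<open>complex^4\<close>.\<close>

definition cbil :: "complex^4 \<Rightarrow> complex^4 \<Rightarrow> complex" where
  "cbil v w = (\<Sum>k\<in>UNIV. v $ k * w $ k)"

definition vcnj :: "complex^4 \<Rightarrow> complex^4" where
  "vcnj v = (\<chi> k. cnj (v $ k))"

definition cvec :: "real^4 \<Rightarrow> complex^4" where
  "cvec v = (\<chi> k. complex_of_real (v $ k))"

definition orth_proj :: "'b::euclidean_space set \<Rightarrow> 'b \<Rightarrow> 'b" where
  "orth_proj S v = (THE w. w \<in> S \<and> (\<forall>s\<in>S. (v - w) \<bullet> s = 0))"


section \<open>Minimal surfaces in the unit 3-sphere\<close>

text \<open>The pulled-back Euclidean metric is \<open>\<rho> |dz|\<^sup>2\<close>, where \<open>|dz|\<^sup>2 = dx\<^sup>2 + dy\<^sup>2\<close> is the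
  inner product on \<open>complex\<close>. The coefficient \<open>\<rho>\<close> may have zeros (branch points).\<close>

definition euclid_metric :: "complex set \<Rightarrow> (complex \<Rightarrow> real^4) \<Rightarrow> (complex \<Rightarrow> real) \<Rightarrow> bool" where
  "euclid_metric D F \<rho> \<longleftrightarrow> (\<forall>z\<in>D. \<forall>v w. pd v F z \<bullet> pd w F z = \<rho> z * (v \<bullet> w))"

text \<open>The mean curvature vector in the sphere of a conformal immersion \<open>F\<close>: half the trace of
  the second fundamental form, whose value on a pair of coordinate fields is the component of
  the second derivative in the space normal to \<open>F\<close> inside the sphere.\<close>

definition mean_curv_S3 :: "(complex \<Rightarrow> real^4) \<Rightarrow> complex \<Rightarrow> real^4" where
  "mean_curv_S3 F z =
     (1 / (2 * (norm (pd 1 F z))\<^sup>2)) *\<^sub>R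
       orth_proj {n. n \<bullet> F z = 0 \<and> (\<forall>v. n \<bullet> pd v F z = 0)}
         (pd 1 (pd 1 F) z + pd \<i> (pd \<i> F) z)"

definition minimal_in_S3 :: "complex set \<Rightarrow> (complex \<Rightarrow> real^4) \<Rightarrow> (complex \<Rightarrow> real^4) \<Rightarrow> bool" where
  "minimal_in_S3 D F N \<longleftrightarrow>
     smooth_on D F \<and> smooth_on D N \<and>
     (\<forall>z\<in>D. norm (F z) = 1) \<and>
     (\<exists>\<rho>. (\<forall>z\<in>D. 0 < \<rho> z) \<and> euclid_metric D F \<rho>) \<and>
     (\<forall>z\<in>D. norm (N z) = 1 \<and> N z \<bullet> F z = 0 \<and> (\<forall>v. N z \<bullet> pd v F z = 0)) \<and>
     (\<forall>z\<in>D. mean_curv_S3 F z = 0)"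

definition minimal_surface_S3 ::
    "'a chart set \<Rightarrow> 'a set \<Rightarrow> ('a \<Rightarrow> real^4) \<Rightarrow> ('a \<Rightarrow> real^4) \<Rightarrow> bool" where
  "minimal_surface_S3 A V F N \<longleftrightarrow> (\<forall>c\<in>A. minimal_in_S3 (cdom c V) (loc c F) (loc c N))"

definition surface_metric ::
    "'a chart set \<Rightarrow> 'a set \<Rightarrow> ('a \<Rightarrow> real^4) \<Rightarrow> ('a chart \<Rightarrow> complex \<Rightarrow> real) \<Rightarrow> bool" where
  "surface_metric A V F \<rho> \<longleftrightarrow> (\<forall>c\<in>A. euclid_metric (cdom c V) (loc c F) (\<rho> c))"

text \<open>The Hopf differential of \<open>F\<close> with respect to the normal \<open>N\<close> is \<open>Q dz\<^sup>2\<close>.\<close>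

definition hopf_differential ::
    "'a chart set \<Rightarrow> 'a set \<Rightarrow> ('a \<Rightarrow> real^4) \<Rightarrow> ('a \<Rightarrow> real^4) \<Rightarrow>
     ('a chart \<Rightarrow> complex \<Rightarrow> complex) \<Rightarrow> bool" where
  "hopf_differential A V F N Q \<longleftrightarrow>
     (\<forall>c\<in>A. \<forall>z\<in>cdom c V. cbil (dz (dz (loc c (cvec \<circ> F))) z) (cvec (loc c N z)) = Q c z)"


section \<open>The unit tangent bundle of the 3-sphere with the Sasaki metric\<close>

definition US3 :: "((real^4) \<times> (real^4)) set" where
  "US3 = {(p, n). norm p = 1 \<and> norm n = 1 \<and> p \<bullet> n = 0}"

text \<open>A tangent vector \<open>(a, b)\<close> at \<open>(p, n)\<close> has horizontal part \<open>a\<close>; its vertical part is the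
  covariant derivative in the sphere, i.e. the component of \<open>b\<close> orthogonal to \<open>p\<close>.\<close>

definition sasaki ::
    "(real^4) \<times> (real^4) \<Rightarrow> (real^4) \<times> (real^4) \<Rightarrow> (real^4) \<times> (real^4) \<Rightarrow> real" where
  "sasaki q s t =
     (let p = fst q; vert = (\<lambda>b. b - (b \<bullet> p) *\<^sub>R p)
      in fst s \<bullet> fst t + vert (snd s) \<bullet> vert (snd t))"

definition unit_tangent_map :: "'a chart set \<Rightarrow> 'a set \<Rightarrow> ('a \<Rightarrow> (real^4) \<times> (real^4)) \<Rightarrow> bool" where
  "unit_tangent_map A V g \<longleftrightarrow> (\<forall>p\<in>V. g p \<in> US3) \<and> (\<forall>c\<in>A. smooth_on (cdom c V) (loc c g))"

definition sasaki_metric ::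
    "'a chart set \<Rightarrow> 'a set \<Rightarrow> ('a \<Rightarrow> (real^4) \<times> (real^4)) \<Rightarrow>
     ('a chart \<Rightarrow> complex \<Rightarrow> real) \<Rightarrow> bool" where
  "sasaki_metric A V g \<rho> \<longleftrightarrow>
     (\<forall>c\<in>A. \<forall>z\<in>cdom c V. \<forall>v w.
        sasaki (loc c g z) (pd v (loc c g) z) (pd w (loc c g) z) = \<rho> c z * (v \<bullet> w))"


section \<open>The projective space and the complex quadric\<close>

definition cline :: "complex^4 \<Rightarrow> (complex^4) set" where
  "cline v = range (\<lambda>a. a *s v)"

definition CP3 :: "(complex^4) set set" where
  "CP3 = {cline v | v. v \<noteq> 0}"

definition Q2 :: "(complex^4) set set" where
  "Q2 = {L \<in> CP3. \<forall>v\<in>L. cbil v v = 0}"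

text \<open>Lifts through the Hopf fibration of the unit sphere over \<open>CP3\<close>. The fibration is a
  submersion with local sections, so a map into \<open>CP3\<close> is smooth iff it has smooth lifts
  near every point.\<close>

definition lift_on :: "complex set \<Rightarrow> (complex \<Rightarrow> (complex^4) set) \<Rightarrow> (complex \<Rightarrow> complex^4) \<Rightarrow> bool" where
  "lift_on D f F \<longleftrightarrow>
     open D \<and> smooth_on D F \<and> (\<forall>z\<in>D. norm (F z) = 1 \<and> f z = cline (F z))"

text \<open>The Fubini--Study metric of holomorphic sectional curvature 4 is the one for which the
  Hopf fibration of the unit sphere is a Riemannian submersion: tangent vectors of \<open>CP3\<close> are
  represented by vectors at a point \<open>q\<close> of the sphere that are Hermitian-orthogonal to \<open>q\<close>,
  the complex structure is multiplication by \<open>\<i>\<close>, and the metric is the real inner product.\<close>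

definition hor_part :: "complex^4 \<Rightarrow> complex^4 \<Rightarrow> complex^4" where
  "hor_part q v = v - cbil v (vcnj q) *s q"

text \<open>For a lift \<open>F\<close> of \<open>f\<close>, not necessarily horizontal: the vector at \<open>F z\<close> representing
  \<open>df v\<close>.\<close>

definition push :: "(complex \<Rightarrow> complex^4) \<Rightarrow> complex \<Rightarrow> complex \<Rightarrow> complex^4" where
  "push F v z = hor_part (F z) (pd v F z)"

definition kaehler_form :: "complex^4 \<Rightarrow> complex^4 \<Rightarrow> real" where
  "kaehler_form v w = (\<i> *s v) \<bullet> w"

text \<open>The Levi-Civita derivative along \<open>f\<close> of the field represented by \<open>Y\<close>. For a horizontal
  lift this is the horizontal part of the derivative of \<open>Y\<close>; the correction term makes the
  expression equivariant under \<open>F \<mapsto> a F\<close>, \<open>Y \<mapsto> a Y\<close> for functions \<open>a\<close> into the unit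
  circle.\<close>

definition cov :: "(complex \<Rightarrow> complex^4) \<Rightarrow> complex \<Rightarrow> (complex \<Rightarrow> complex^4) \<Rightarrow> complex \<Rightarrow> complex^4" where
  "cov F v Y z = hor_part (F z) (pd v Y z - cbil (pd v F z) (vcnj (F z)) *s Y z)"

text \<open>The space normal to the surface inside the quadric; the tangent space of the quadric at
  \<open>[q]\<close> consists of the \<open>n\<close> with \<open>cbil n (vcnj q) = 0\<close> and \<open>cbil n q = 0\<close>.\<close>

definition normal_space_Q2 :: "(complex \<Rightarrow> complex^4) \<Rightarrow> complex \<Rightarrow> (complex^4) set" where
  "normal_space_Q2 F z =
     {n. cbil n (vcnj (F z)) = 0 \<and> cbil n (F z) = 0 \<and> (\<forall>v. n \<bullet> push F v z = 0)}"

definition mean_curv_Q2 :: "(complex \<Rightarrow> complex^4) \<Rightarrow> complex \<Rightarrow> complex^4" where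
  "mean_curv_Q2 F z =
     (1 / (2 * (norm (push F 1 z))\<^sup>2)) *\<^sub>R
       orth_proj (normal_space_Q2 F z)
         (cov F 1 (push F 1) z + cov F \<i> (push F \<i>) z)"

definition smooth_in_CP3 :: "complex set \<Rightarrow> (complex \<Rightarrow> (complex^4) set) \<Rightarrow> bool" where
  "smooth_in_CP3 D f \<longleftrightarrow> (\<forall>z\<in>D. \<exists>D' F. z \<in> D' \<and> D' \<subseteq> D \<and> lift_on D' f F)"

definition fubini_study_metric ::
    "complex set \<Rightarrow> (complex \<Rightarrow> (complex^4) set) \<Rightarrow> (complex \<Rightarrow> real) \<Rightarrow> bool" where
  "fubini_study_metric D f \<rho> \<longleftrightarrow>
     (\<forall>D' F. D' \<subseteq> D \<and> lift_on D' f F \<longrightarrow>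
        (\<forall>z\<in>D'. \<forall>v w. push F v z \<bullet> push F w z = \<rho> z * (v \<bullet> w)))"

definition lagrangian :: "complex set \<Rightarrow> (complex \<Rightarrow> (complex^4) set) \<Rightarrow> bool" where
  "lagrangian D f \<longleftrightarrow>
     (\<forall>D' F. D' \<subseteq> D \<and> lift_on D' f F \<longrightarrow>
        (\<forall>z\<in>D'. \<forall>v w. kaehler_form (push F v z) (push F w z) = 0))"

definition minimal_in_Q2 :: "complex set \<Rightarrow> (complex \<Rightarrow> (complex^4) set) \<Rightarrow> bool" where
  "minimal_in_Q2 D f \<longleftrightarrow>
     (\<forall>D' F. D' \<subseteq> D \<and> lift_on D' f F \<longrightarrow> (\<forall>z\<in>D'. mean_curv_Q2 F z = 0))"

definition minimal_lagrangian_surface ::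
    "'a chart set \<Rightarrow> 'a set \<Rightarrow> ('a \<Rightarrow> (complex^4) set) \<Rightarrow> bool" where
  "minimal_lagrangian_surface A V f \<longleftrightarrow>
     (\<forall>p\<in>V. f p \<in> Q2) \<and>
     (\<forall>c\<in>A. smooth_in_CP3 (cdom c V) (loc c f) \<and>
        (\<exists>\<rho>. (\<forall>z\<in>cdom c V. 0 < \<rho> z) \<and> fubini_study_metric (cdom c V) (loc c f) \<rho>) \<and>
        lagrangian (cdom c V) (loc c f) \<and>
        minimal_in_Q2 (cdom c V) (loc c f))"

definition surface_metric_Q2 ::
    "'a chart set \<Rightarrow> 'a set \<Rightarrow> ('a \<Rightarrow> (complex^4) set) \<Rightarrow>
     ('a chart \<Rightarrow> complex \<Rightarrow> real) \<Rightarrow> bool" where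
  "surface_metric_Q2 A V f \<rho> \<longleftrightarrow>
     (\<forall>c\<in>A. fubini_study_metric (cdom c V) (loc c f) (\<rho> c))"


section \<open>Horizontal lifts and the holomorphic differential\<close>

definition horizontal_lift ::
    "'a chart set \<Rightarrow> 'a set \<Rightarrow> ('a \<Rightarrow> (complex^4) set) \<Rightarrow> ('a \<Rightarrow> complex^4) \<Rightarrow> bool" where
  "horizontal_lift A V f F \<longleftrightarrow>
     (\<forall>c\<in>A. lift_on (cdom c V) (loc c f) (loc c F) \<and>
        (\<forall>z\<in>cdom c V. cbil (dz (loc c F) z) (vcnj (loc c F z)) = 0 \<and>
                       cbil (dzb (loc c F) z) (vcnj (loc c F z)) = 0))"

text \<open>The choice of phase of a horizontal lift. On a connected surface horizontal lifts differ
  by a constant \<open>a\<close> of modulus 1, and \<open>cbil (dz F z) (dzb F z)\<close> is multiplied by \<open>a\<^sup>2\<close>; requiring it to be a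
  non-negative real function determines \<open>F\<close> up to sign, unless it vanishes identically. In
  that degenerate case (only) the last clause fixes the phase; in the other case the equation
  in it holds for every minimal Lagrangian surface.\<close>

definition phase_normalised :: "'a chart set \<Rightarrow> 'a set \<Rightarrow> ('a \<Rightarrow> complex^4) \<Rightarrow> bool" where
  "phase_normalised A V F \<longleftrightarrow>
     (\<forall>c\<in>A. \<forall>z\<in>cdom c V. cbil (dz (loc c F) z) (dzb (loc c F) z) \<in> \<real>\<^sub>\<ge>\<^sub>0) \<and>
     ((\<forall>c\<in>A. \<forall>z\<in>cdom c V. cbil (dz (loc c F) z) (dzb (loc c F) z) = 0) \<longrightarrow>
      (\<forall>c\<in>A. \<forall>z\<in>cdom c V.
         cbil (dzb (loc c F) z) (dzb (loc c F) z) =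
         - cnj (cbil (dz (loc c F) z) (dz (loc c F) z))))"

definition lift_differential ::
    "'a chart set \<Rightarrow> 'a set \<Rightarrow> ('a \<Rightarrow> complex^4) \<Rightarrow>
     ('a chart \<Rightarrow> complex \<Rightarrow> complex) \<Rightarrow> bool" where
  "lift_differential A V F \<alpha> \<longleftrightarrow>
     (\<forall>c\<in>A. \<forall>z\<in>cdom c V. cbil (dz (loc c F) z) (dz (loc c F) z) = \<alpha> c z)"

definition cpair :: "('a \<Rightarrow> real^4) \<Rightarrow> ('a \<Rightarrow> real^4) \<Rightarrow> 'a \<Rightarrow> complex^4" where
  "cpair F N p = cvec (F p) + \<i> *s cvec (N p)"

definition pair_lift :: "('a \<Rightarrow> real^4) \<Rightarrow> ('a \<Rightarrow> real^4) \<Rightarrow> 'a \<Rightarrow> complex^4" where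
  "pair_lift F N p = complex_of_real (sqrt 2 / 2) *s cpair F N p"

end

theory Submission
  imports Defs
begin

text \<open>Write \<open>P = (F + \<i> N) / \<surd>2\<close>. For \<open>P\<close> horizontal, isotropic and Lagrangian with conformal metric,
  \<open>P\<close>, its conjugate, \<open>P\<^sub>x\<close> and \<open>P\<^sub>y\<close> are Hermitian-orthogonal, so minimality in the quadric means that the
  Laplacian of \<open>P\<close> is a combination of \<open>P\<close> and its conjugate. If \<open>F\<close> is minimal with normal \<open>N\<close>, this is
  the Codazzi equation.

  Conversely let \<open>\<alpha>, \<beta>, \<gamma>\<close> be the products \<open>\<langle>P\<^sub>z, P\<^sub>z\<rangle>\<close>, \<open>\<langle>P\<^sub>z, P\<^bsub>zb\<^esub>\<rangle>\<close>, \<open>\<langle>P\<^bsub>zb\<^esub>, P\<^bsub>zb\<^esub>\<rangle>\<close>. Expanding the conjugate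
  of \<open>P\<^sub>z\<close> in the frame gives \<open>|\<alpha>|\<^sup>2 + |\<beta>|\<^sup>2 = e\<^bsup>2u\<^esup>\<close>, and \<open>\<gamma> = - cnj \<alpha>\<close> wherever the real function \<open>\<beta>\<close> is
  nonzero. The latter equation says that \<open>\<langle>F\<^sub>z, F\<^sub>z\<rangle>\<close> vanishes. Since \<open>\<Delta>F\<close> is a multiple of \<open>F\<close>, the differential
  \<open>\<langle>F\<^sub>z, F\<^sub>z\<rangle> dz\<^sup>2\<close> is holomorphic, so by the identity theorem it vanishes on the whole connected
  surface. For uniqueness, two lifts differ by a unimodular function \<open>a\<close>; the Sasaki metric detects its
  derivative, which must therefore vanish, and the phase condition leaves \<open>a = \<plusminus>1\<close>.\<close>

section \<open>Partial derivatives\<close>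

text \<open>Where the constants come from: a metric 2 e^u dz dzb has coefficient \<rho> = 2 e^u
  against |dz|^2. As \<open>P\<close> carries the factor 1/\<surd>2, the first fundamental forms of
  \<open>F\<close> and \<open>N\<close> add up to 2 \<rho> = 4 e^u, which is the Sasaki metric
  because the derivatives of \<open>N\<close> are orthogonal to \<open>F\<close>. When
  \<open>F\<close> is conformal, \<beta> is a quarter of the difference of the two coefficients, so
  these are \<rho> + 2 \<beta> and \<rho> - 2 \<beta>, and \<beta> is the square root in the
  statement. The obstacle is the zero set of \<beta>: there the relation between \<alpha> and
  \<gamma> is lost, so conformality of \<open>F\<close> is not a pointwise consequence of the frame
  relations. If \<beta> vanishes identically, no point supplies it and the phase of the lift is
  still free; the second clause of \<open>phase_normalised\<close> fixes the phase precisely so that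
  \<open>F\<close> is conformal.\<close>

lemma has_derivative_pd: "F differentiable at z \<Longrightarrow> (F has_derivative (\<lambda>v. pd v F z)) (at z)"
  unfolding pd_def using frechet_derivative_works by blast

lemma pd_eqI: "(F has_derivative F') (at z) \<Longrightarrow> pd v F z = F' v"
  unfolding pd_def using frechet_derivative_at by metis

text \<open>No differentiability is assumed: \<open>F\<close> and \<open>G\<close> have the same
  derivatives at \<open>z\<close>, so the choice operator inside \<open>frechet_derivative\<close>
  returns the same value even where there is none.\<close>

lemma pd_cong_open:
  assumes "open D" "z \<in> D" "\<And>w. w \<in> D \<Longrightarrow> F w = G w"
  shows "pd v F z = pd v G z"
proof -
  have *: "(F has_derivative F') (at z) \<longleftrightarrow> (G has_derivative F') (at z)" for F'
    using assms has_derivative_transform_within_open[of F F' z UNIV D G]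
      has_derivative_transform_within_open[of G F' z UNIV D F] by auto
  show ?thesis unfolding pd_def frechet_derivative_def * ..
qed

lemma pd_linear: "F differentiable at z \<Longrightarrow> linear (\<lambda>v. pd v F z)"
  using has_derivative_pd has_derivative_linear by blast

lemma pd_decomp:
  assumes "F differentiable at z"
  shows "pd v F z = Re v *\<^sub>R pd 1 F z + Im v *\<^sub>R pd \<i> F z"
proof -
  have "v = Re v *\<^sub>R 1 + Im v *\<^sub>R \<i>" by (simp add: complex_eq_iff)
  then have "pd v F z = pd (Re v *\<^sub>R 1 + Im v *\<^sub>R \<i>) F z" by simp
  then show ?thesis
    by (simp only: linear_add[OF pd_linear[OF assms]] linear_scale[OF pd_linear[OF assms]])
qed

lemma pd_bounded_linear:
  assumes "bounded_linear L" "F differentiable at z"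
  shows "pd v (\<lambda>w. L (F w)) z = L (pd v F z)"
  using bounded_linear.has_derivative[OF assms(1) has_derivative_pd[OF assms(2)]] by (rule pd_eqI)

lemma pd_diff:
  assumes "F differentiable at z" "G differentiable at z"
  shows "pd v (\<lambda>w. F w - G w) z = pd v F z - pd v G z"
  by (rule pd_eqI[OF has_derivative_diff[OF assms[THEN has_derivative_pd]]])

lemma pd_Pair:
  assumes "F differentiable at z" "G differentiable at z"
  shows "pd v (\<lambda>w. (F w, G w)) z = (pd v F z, pd v G z)"
  by (rule pd_eqI[OF has_derivative_Pair[OF assms[THEN has_derivative_pd]]])

lemma pd_bilinear:
  assumes "bounded_bilinear B" "F differentiable at z" "G differentiable at z"
  shows "pd v (\<lambda>w. B (F w) (G w)) z = B (F z) (pd v G z) + B (pd v F z) (G z)"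
  by (rule pd_eqI[OF bounded_bilinear.FDERIV[OF assms(1) has_derivative_pd[OF assms(2)] has_derivative_pd[OF assms(3)]]])

lemma differentiable_bilinear:
  fixes z :: complex
  assumes "bounded_bilinear B" "F differentiable at z" "G differentiable at z"
  shows "(\<lambda>w. B (F w) (G w)) differentiable at z"
  using bounded_bilinear.FDERIV[OF assms(1) has_derivative_pd[OF assms(2)] has_derivative_pd[OF assms(3)]]
  unfolding differentiable_def by blast

lemma differentiable_bounded_linear:
  fixes z :: complex
  assumes "bounded_linear L" "F differentiable at z"
  shows "(\<lambda>w. L (F w)) differentiable at z"
  using bounded_linear.has_derivative[OF assms(1) has_derivative_pd[OF assms(2)]]
  unfolding differentiable_def by blast

lemma pd_const [simp]: "pd v (\<lambda>_. c) z = 0"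
  by (rule pd_eqI[of _ "\<lambda>_. 0"]) auto

text \<open>The product rule for a pairing that is constant on an open set. Applied to each
  normalisation and orthogonality relation, it yields the relation of the next order.\<close>

lemma bilinear_const_pd:
  assumes "bounded_bilinear B" "open D" "z \<in> D" "\<And>w. w \<in> D \<Longrightarrow> B (F w) (G w) = c"
    "F differentiable at z" "G differentiable at z"
  shows "B (F z) (pd v G z) + B (pd v F z) (G z) = 0"
proof -
  have "pd v (\<lambda>w. B (F w) (G w)) z = pd v (\<lambda>_. c) z"
    by (rule pd_cong_open[OF assms(2,3)]) (use assms(4) in auto)
  then show ?thesis using pd_bilinear[OF assms(1,5,6), of v] by simp
qed

lemma pd_chain_holomorphic:
  assumes "(\<tau> has_field_derivative t) (at z)" "F differentiable at (\<tau> z)"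
  shows "pd v (\<lambda>w. F (\<tau> w)) z = pd (t * v) F (\<tau> z)"
proof -
  have "((\<lambda>w. F (\<tau> w)) has_derivative (\<lambda>v. pd (t * v) F (\<tau> z))) (at z)"
    using has_derivative_compose[OF assms(1)[unfolded has_field_derivative_def] has_derivative_pd[OF assms(2)]]
    by simp
  then show ?thesis by (rule pd_eqI)
qed

text \<open>The last hypothesis is the Cauchy-Riemann equation; it makes the real-linear derivative
  multiplication by \<open>pd 1 h z\<close>.\<close>

lemma holomorphic_onI_pd:
  assumes "open D" "\<And>z. z \<in> D \<Longrightarrow> h differentiable at z"
    "\<And>z. z \<in> D \<Longrightarrow> pd 1 h z + \<i> * pd \<i> h z = 0"
  shows "h holomorphic_on D"
  unfolding holomorphic_on_open[OF assms(1)]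
proof
  fix z assume z: "z \<in> D"
  have "\<i> * (pd 1 h z + \<i> * pd \<i> h z) = 0"
    by (simp only: assms(3)[OF z]) simp
  then have i: "pd \<i> h z = \<i> * pd 1 h z"
    by (simp add: algebra_simps)
  have lin: "pd v h z = pd 1 h z * v" for v
    by (subst pd_decomp[OF assms(2)[OF z]]) (simp add: i complex_eq_iff)
  have "(h has_field_derivative pd 1 h z) (at z)"
    unfolding has_field_derivative_def
    by (rule has_derivative_eq_rhs[OF has_derivative_pd[OF assms(2)[OF z]]]) (rule ext, rule lin)
  then show "\<exists>f'. (h has_field_derivative f') (at z)" ..
qed

section \<open>Smooth maps\<close>

lemma Ck_on_subset: "Ck_on k D F \<Longrightarrow> D' \<subseteq> D \<Longrightarrow> Ck_on k D' F"
  by (induction k arbitrary: F) (auto intro: continuous_on_subset differentiable_on_subset)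

lemma smooth_on_subset: "smooth_on D F \<Longrightarrow> D' \<subseteq> D \<Longrightarrow> smooth_on D' F"
  unfolding smooth_on_def using Ck_on_subset by blast

text \<open>Formulas for \<open>pd v F\<close> are available on \<open>D\<close> only, so regularity
  has to be transferred along equalities that hold just on \<open>D\<close>.\<close>

lemma Ck_on_cong:
  assumes "open D" "\<And>z. z \<in> D \<Longrightarrow> F z = G z" "Ck_on k D F"
  shows "Ck_on k D G"
  using assms(2,3)
proof (induction k arbitrary: F G)
  case 0
  then show ?case using continuous_on_cong[of D D F G] by simp
next
  case (Suc k)
  have "Ck_on k D (pd v G)" for v
    using Suc.IH[of "pd v F" "pd v G"] pd_cong_open[OF assms(1)] Suc.prems by (metis Ck_on.simps(2))
  then show ?case using Suc.prems differentiable_transform_within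
    by (auto simp: differentiable_on_def intro: differentiable_transform_within[OF _ zero_less_one])
qed

lemma Ck_on_differentiable: "Ck_on (Suc k) D F \<Longrightarrow> open D \<Longrightarrow> z \<in> D \<Longrightarrow> F differentiable at z"
  by (auto simp: differentiable_on_eq_differentiable_at)

lemma Ck_on_bounded_linear:
  assumes "open D" "bounded_linear L" "Ck_on k D F"
  shows "Ck_on k D (\<lambda>z. L (F z))"
  using assms(3)
proof (induction k arbitrary: F)
  case 0
  then show ?case using bounded_linear.continuous_on[OF assms(2)] by simp
next
  case (Suc k)
  note d = Ck_on_differentiable[OF Suc.prems assms(1)]
  have "Ck_on k D (pd v (\<lambda>z. L (F z)))" for v
    by (rule Ck_on_cong[OF assms(1) _ Suc.IH[of "pd v F"]])
      (use pd_bounded_linear[OF assms(2) d] Suc.prems in auto)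
  moreover have "(\<lambda>z. L (F z)) differentiable_on D"
    using d differentiable_bounded_linear[OF assms(2)] by (auto intro: differentiable_at_imp_differentiable_on)
  ultimately show ?case by simp
qed

lemma smooth_on_bounded_linear:
  "open D \<Longrightarrow> bounded_linear L \<Longrightarrow> smooth_on D F \<Longrightarrow> smooth_on D (\<lambda>z. L (F z))"
  unfolding smooth_on_def using Ck_on_bounded_linear by blast

lemma Ck_on_Pair:
  assumes "open D" "Ck_on k D F" "Ck_on k D G"
  shows "Ck_on k D (\<lambda>z. (F z, G z))"
  using assms(2,3)
proof (induction k arbitrary: F G)
  case 0
  then show ?case by (simp add: continuous_on_Pair)
next
  case (Suc k)
  note d = Ck_on_differentiable[OF Suc.prems(1) assms(1)] Ck_on_differentiable[OF Suc.prems(2) assms(1)]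
  have "Ck_on k D (pd v (\<lambda>z. (F z, G z)))" for v
    by (rule Ck_on_cong[OF assms(1) _ Suc.IH[of "pd v F" "pd v G"]])
      (use pd_Pair[OF d] Suc.prems in auto)
  moreover have "(\<lambda>z. (F z, G z)) differentiable_on D"
    using has_derivative_Pair[OF d[THEN has_derivative_pd]]
    by (intro differentiable_at_imp_differentiable_on) (auto simp: differentiable_def)
  ultimately show ?case by simp
qed

lemma smooth_on_Pair:
  "open D \<Longrightarrow> smooth_on D F \<Longrightarrow> smooth_on D G \<Longrightarrow> smooth_on D (\<lambda>z. (F z, G z))"
  unfolding smooth_on_def using Ck_on_Pair by blast

lemma smooth_on_pd: "smooth_on D F \<Longrightarrow> smooth_on D (pd v F)"
  unfolding smooth_on_def using Ck_on.simps(2) by blast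

lemma smooth_on_differentiable: "smooth_on D F \<Longrightarrow> open D \<Longrightarrow> z \<in> D \<Longrightarrow> F differentiable at z"
  unfolding smooth_on_def using Ck_on_differentiable by blast

lemma smooth_on_continuous: "smooth_on D F \<Longrightarrow> continuous_on D F"
  unfolding smooth_on_def using Ck_on.simps(1) by blast

section \<open>Symmetry of second derivatives\<close>

lemma second_difference_MVT:
  fixes g :: "complex \<Rightarrow> real"
  assumes h: "0 < h" and d: "\<And>s t. 0 \<le> s \<Longrightarrow> s \<le> h \<Longrightarrow> 0 \<le> t \<Longrightarrow> t \<le> h \<Longrightarrow>
      g differentiable at (z + s *\<^sub>R v + t *\<^sub>R w) \<and> pd v g differentiable at (z + s *\<^sub>R v + t *\<^sub>R w)"
  shows "\<exists>s t. 0 \<le> s \<and> s \<le> h \<and> 0 \<le> t \<and> t \<le> h \<and>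
    g (z + h *\<^sub>R v + h *\<^sub>R w) - g (z + h *\<^sub>R v) - g (z + h *\<^sub>R w) + g z
      = h * h * pd w (pd v g) (z + s *\<^sub>R v + t *\<^sub>R w)"
proof -
  have dv: "((\<lambda>s. g (z + s *\<^sub>R v + t *\<^sub>R w)) has_field_derivative pd v g (z + s *\<^sub>R v + t *\<^sub>R w)) (at s)"
    if "0 \<le> s" "s \<le> h" "0 \<le> t" "t \<le> h" for s t
  proof -
    have "((\<lambda>s. z + s *\<^sub>R v + t *\<^sub>R w) has_derivative (\<lambda>r. r *\<^sub>R v)) (at s)"
      by (auto intro!: derivative_eq_intros)
    from has_derivative_compose[OF this has_derivative_pd] d[OF that]
    have "((\<lambda>s. g (z + s *\<^sub>R v + t *\<^sub>R w)) has_derivative (\<lambda>r. pd (r *\<^sub>R v) g (z + s *\<^sub>R v + t *\<^sub>R w))) (at s)"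
      by blast
    then show ?thesis using d[OF that]
      by (simp add: has_field_derivative_def linear_scale[OF pd_linear] mult.commute[of _ "pd v g _"])
  qed
  have dw: "((\<lambda>t. pd v g (z + s *\<^sub>R v + t *\<^sub>R w)) has_field_derivative pd w (pd v g) (z + s *\<^sub>R v + t *\<^sub>R w)) (at t)"
    if "0 \<le> s" "s \<le> h" "0 \<le> t" "t \<le> h" for s t
  proof -
    have "((\<lambda>t. z + s *\<^sub>R v + t *\<^sub>R w) has_derivative (\<lambda>r. r *\<^sub>R w)) (at t)"
      by (auto intro!: derivative_eq_intros)
    from has_derivative_compose[OF this has_derivative_pd] d[OF that]
    have "((\<lambda>t. pd v g (z + s *\<^sub>R v + t *\<^sub>R w)) has_derivative (\<lambda>r. pd (r *\<^sub>R w) (pd v g) (z + s *\<^sub>R v + t *\<^sub>R w))) (at t)"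
      by blast
    then show ?thesis using d[OF that]
      by (simp add: has_field_derivative_def linear_scale[OF pd_linear] mult.commute[of _ "pd w (pd v g) _"])
  qed
  \<comment> \<open>Two applications of the mean value theorem: in direction \<open>v\<close> to the
    increment of \<open>g\<close> across the parallelogram, then in direction \<open>w\<close> to
    \<open>pd v g\<close>.\<close>
  define \<phi> where "\<phi> s = g (z + s *\<^sub>R v + h *\<^sub>R w) - g (z + s *\<^sub>R v + 0 *\<^sub>R w)" for s
  have "(\<phi> has_field_derivative (pd v g (z + s *\<^sub>R v + h *\<^sub>R w) - pd v g (z + s *\<^sub>R v + 0 *\<^sub>R w))) (at s)"
    if "0 \<le> s" "s \<le> h" for s
    unfolding \<phi>_def using DERIV_diff[OF dv[OF that, of h] dv[OF that, of 0]] h by simp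
  from MVT2[OF h this] obtain s where s: "0 < s" "s < h"
    "\<phi> h - \<phi> 0 = h * (pd v g (z + s *\<^sub>R v + h *\<^sub>R w) - pd v g (z + s *\<^sub>R v + 0 *\<^sub>R w))"
    by auto
  from MVT2[OF h dw[of s]] s obtain t where t: "0 < t" "t < h"
    "pd v g (z + s *\<^sub>R v + h *\<^sub>R w) - pd v g (z + s *\<^sub>R v + 0 *\<^sub>R w) = h * pd w (pd v g) (z + s *\<^sub>R v + t *\<^sub>R w)"
    by auto
  have "g (z + h *\<^sub>R v + h *\<^sub>R w) - g (z + h *\<^sub>R v) - g (z + h *\<^sub>R w) + g z = \<phi> h - \<phi> 0"
    unfolding \<phi>_def by simp
  also have "\<dots> = h * h * pd w (pd v g) (z + s *\<^sub>R v + t *\<^sub>R w)"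
    using s(3) t(3) by simp
  finally show ?thesis using s t by (intro exI[of _ s] exI[of _ t]) auto
qed

text \<open>The second difference is symmetric in \<open>v\<close> and \<open>w\<close>, so the two
  mixed derivatives agree at certain points arbitrarily close to \<open>z\<close>; continuity of
  both forces equality at \<open>z\<close>.\<close>

lemma pd_commute_real:
  fixes g :: "complex \<Rightarrow> real"
  assumes "open D" "z \<in> D" "smooth_on D g"
  shows "pd v (pd w g) z = pd w (pd v g) z"
proof (rule ccontr)
  assume ne: "pd v (pd w g) z \<noteq> pd w (pd v g) z"
  \<comment> \<open>Half the distance: one common value within \<open>e\<close> of each mixed
    derivative is then a contradiction.\<close>
  define e where "e = dist (pd v (pd w g) z) (pd w (pd v g) z) / 2"
  have e: "e > 0" using ne by (simp add: e_def)
  have cont: "\<exists>r>0. \<forall>p. dist p z < r \<longrightarrow> p \<in> D \<and> dist (pd a (pd b g) p) (pd a (pd b g) z) < e" for a b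
  proof -
    have "continuous_on D (pd a (pd b g))"
      by (intro smooth_on_continuous smooth_on_pd assms)
    then obtain r1 where "r1 > 0" "\<forall>p\<in>D. dist p z < r1 \<longrightarrow> dist (pd a (pd b g) p) (pd a (pd b g) z) < e"
      using assms(2) e unfolding continuous_on_iff by blast
    moreover obtain r2 where "r2 > 0" "\<forall>p. dist p z < r2 \<longrightarrow> p \<in> D"
      using assms(1,2) unfolding open_dist by blast
    ultimately show ?thesis by (intro exI[of _ "min r1 r2"]) auto
  qed
  obtain r1 r2 where r: "r1 > 0" "r2 > 0"
    "\<And>p. dist p z < r1 \<Longrightarrow> p \<in> D \<and> dist (pd v (pd w g) p) (pd v (pd w g) z) < e"
    "\<And>p. dist p z < r2 \<Longrightarrow> p \<in> D \<and> dist (pd w (pd v g) p) (pd w (pd v g) z) < e"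
    using cont[of v w] cont[of w v] by metis
  \<comment> \<open>The parallelogram with sides \<open>h *\<^sub>R v\<close> and
    \<open>h *\<^sub>R w\<close> fits in both balls; the summand 1 keeps the denominator positive
    when both vectors are 0.\<close>
  define h where "h = min r1 r2 / (2 * (norm v + norm w + 1))"
  have den: "norm v + norm w + 1 > 0" by (simp add: add_nonneg_pos)
  have h: "h > 0" unfolding h_def using r den by simp
  have small: "dist (z + s *\<^sub>R v + t *\<^sub>R w) z < min r1 r2" if "0 \<le> s" "s \<le> h" "0 \<le> t" "t \<le> h" for s t
  proof -
    have "dist (z + s *\<^sub>R v + t *\<^sub>R w) z \<le> norm (s *\<^sub>R v) + norm (t *\<^sub>R w)"
      by (metis add.assoc add_diff_cancel_left' dist_norm norm_triangle_ineq)
    also have "\<dots> = s * norm v + t * norm w" using that by simp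
    also have "\<dots> \<le> h * norm v + h * norm w"
      using that by (intro add_mono mult_right_mono) auto
    also have "\<dots> < h * (2 * (norm v + norm w + 1))"
      using h by (simp add: algebra_simps add_nonneg_pos)
    also have "\<dots> = min r1 r2" unfolding h_def using den by simp
    finally show ?thesis .
  qed
  have diff: "g differentiable at p \<and> pd a g differentiable at p" if "p \<in> D" for a p
    using assms that smooth_on_pd smooth_on_differentiable by blast
  obtain s t where 1: "0 \<le> s" "s \<le> h" "0 \<le> t" "t \<le> h"
    "g (z + h *\<^sub>R v + h *\<^sub>R w) - g (z + h *\<^sub>R v) - g (z + h *\<^sub>R w) + g z
      = h * h * pd w (pd v g) (z + s *\<^sub>R v + t *\<^sub>R w)"
    using second_difference_MVT[OF h, of g z v w] diff r small by (metis min_less_iff_conj)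
  have small': "dist (z + s *\<^sub>R w + t *\<^sub>R v) z < min r1 r2" if "0 \<le> s" "s \<le> h" "0 \<le> t" "t \<le> h" for s t
    using small[OF that(3,4,1,2)] by (simp add: algebra_simps)
  obtain s' t' where 2: "0 \<le> s'" "s' \<le> h" "0 \<le> t'" "t' \<le> h"
    "g (z + h *\<^sub>R w + h *\<^sub>R v) - g (z + h *\<^sub>R w) - g (z + h *\<^sub>R v) + g z
      = h * h * pd v (pd w g) (z + s' *\<^sub>R w + t' *\<^sub>R v)"
    using second_difference_MVT[OF h, of g z w v] diff r small' by (metis min_less_iff_conj)
  have "h * h * pd v (pd w g) (z + s' *\<^sub>R w + t' *\<^sub>R v) = h * h * pd w (pd v g) (z + s *\<^sub>R v + t *\<^sub>R w)"
    using 1(5) 2(5) by (simp only: add.assoc add.commute[of "h *\<^sub>R w"])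
  then have "pd v (pd w g) (z + s' *\<^sub>R w + t' *\<^sub>R v) = pd w (pd v g) (z + s *\<^sub>R v + t *\<^sub>R w)"
    using h by simp
  moreover have "dist (pd v (pd w g) (z + s' *\<^sub>R w + t' *\<^sub>R v)) (pd v (pd w g) z) < e"
    "dist (pd w (pd v g) (z + s *\<^sub>R v + t *\<^sub>R w)) (pd w (pd v g) z) < e"
    using r small[OF 1(1-4)] small'[OF 2(1-4)] by auto
  ultimately have "dist (pd v (pd w g) z) (pd w (pd v g) z) < 2 * e"
    using dist_triangle_half_r[of _ _ "2 * e"] by simp
  then show False unfolding e_def by simp
qed

lemma pd_commute:
  fixes F :: "complex \<Rightarrow> 'b::euclidean_space"
  assumes "open D" "z \<in> D" "smooth_on D F"
  shows "pd v (pd w F) z = pd w (pd v F) z"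
proof (rule euclidean_eqI)
  fix b :: 'b
  have L: "bounded_linear (\<lambda>x. x \<bullet> b)" by (rule bounded_linear_inner_left)
  have eq: "pd a (pd c (\<lambda>p. F p \<bullet> b)) z = pd a (pd c F) z \<bullet> b" for a c
  proof -
    have "pd a (pd c (\<lambda>p. F p \<bullet> b)) z = pd a (\<lambda>p. pd c F p \<bullet> b) z"
      by (rule pd_cong_open[OF assms(1,2)])
        (rule pd_bounded_linear[OF L smooth_on_differentiable[OF assms(3,1)]])
    then show ?thesis
      using pd_bounded_linear[OF L smooth_on_differentiable[OF smooth_on_pd[OF assms(3)] assms(1,2)]]
      by simp
  qed
  show "pd v (pd w F) z \<bullet> b = pd w (pd v F) z \<bullet> b"
    unfolding eq[symmetric]
    by (rule pd_commute_real[OF assms(1,2) smooth_on_bounded_linear[OF assms(1) L assms(3)]])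
qed

section \<open>The bilinear and the Hermitian form\<close>

abbreviation herm :: "complex^4 \<Rightarrow> complex^4 \<Rightarrow> complex" where
  "herm v w \<equiv> cbil v (vcnj w)"

lemma scaleR_eq_smult: "r *\<^sub>R (v :: complex^4) = complex_of_real r *s v"
  by (simp add: vec_eq_iff complex_eq_iff)

lemma cbil_add_left: "cbil (u + v) w = cbil u w + cbil v w"
  and cbil_add_right: "cbil u (v + w) = cbil u v + cbil u w"
  and cbil_diff_left: "cbil (u - v) w = cbil u w - cbil v w"
  and cbil_diff_right: "cbil u (v - w) = cbil u v - cbil u w"
  and cbil_smult_left: "cbil (a *s v) w = a * cbil v w"
  and cbil_smult_right: "cbil v (a *s w) = a * cbil v w"
  and cbil_minus_left: "cbil (- v) w = - cbil v w"
  and cbil_minus_right: "cbil v (- w) = - cbil v w"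
  and cbil_zero_left: "cbil 0 w = 0"
  and cbil_zero_right: "cbil w 0 = 0"
  by (simp_all add: cbil_def algebra_simps sum.distrib sum_subtractf sum_distrib_left sum_negf)

lemma cbil_commute: "cbil v w = cbil w v"
  by (simp add: cbil_def mult.commute)

lemma vcnj_add: "vcnj (u + v) = vcnj u + vcnj v"
  and vcnj_diff: "vcnj (u - v) = vcnj u - vcnj v"
  and vcnj_smult: "vcnj (a *s v) = cnj a *s vcnj v"
  and vcnj_minus: "vcnj (- v) = - vcnj v"
  and vcnj_vcnj: "vcnj (vcnj v) = v"
  and vcnj_zero: "vcnj 0 = 0"
  by (simp_all add: vcnj_def vec_eq_iff)

lemmas cbil_simps = cbil_add_left cbil_add_right cbil_diff_left cbil_diff_right cbil_smult_left
  cbil_smult_right cbil_minus_left cbil_minus_right vcnj_minus cbil_zero_left cbil_zero_right vcnj_add vcnj_diff vcnj_smult vcnj_vcnj vcnj_zero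

lemma cnj_cbil: "cnj (cbil v w) = cbil (vcnj v) (vcnj w)"
  by (simp add: cbil_def vcnj_def)

lemma cnj_herm: "cnj (herm v w) = herm w v"
  by (simp add: cnj_cbil vcnj_vcnj cbil_commute)

lemma inner_eq_herm: "v \<bullet> w = Re (herm v w)"
  by (simp add: inner_vec_def cbil_def vcnj_def inner_complex_def)

lemma herm_self: "herm v v = complex_of_real (v \<bullet> v)"
  by (metis Reals_cases Reals_cnj_iff cnj_herm inner_eq_herm Re_complex_of_real)

lemma cvec_add: "cvec (u + v) = cvec u + cvec v"
  and cvec_scaleR: "cvec (r *\<^sub>R v) = complex_of_real r *s cvec v"
  and vcnj_cvec: "vcnj (cvec v) = cvec v"
  and cbil_cvec: "cbil (cvec v) (cvec w) = complex_of_real (v \<bullet> w)"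
  by (simp_all add: cvec_def vcnj_def vec_eq_iff cbil_def inner_vec_def)

lemma bounded_bilinear_cbil: "bounded_bilinear cbil"
  unfolding bilinear_conv_bounded_bilinear[symmetric] bilinear_def
  by (auto intro!: linearI simp: cbil_simps scaleR_eq_smult scaleR_conv_of_real)

lemma bounded_bilinear_herm: "bounded_bilinear herm"
  unfolding bilinear_conv_bounded_bilinear[symmetric] bilinear_def
  by (auto intro!: linearI simp: cbil_simps scaleR_eq_smult scaleR_conv_of_real)

lemma bounded_bilinear_smult: "bounded_bilinear ((*s) :: complex \<Rightarrow> complex^4 \<Rightarrow> complex^4)"
  unfolding bilinear_conv_bounded_bilinear[symmetric] bilinear_def
  by (auto intro!: linearI simp: vec_eq_iff algebra_simps)

lemma bounded_linear_smult: "bounded_linear (\<lambda>v. a *s v :: complex^4)"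
  by (rule bounded_bilinear.bounded_linear_right[OF bounded_bilinear_smult])

lemma bounded_linear_cvec: "bounded_linear cvec"
  unfolding linear_conv_bounded_linear[symmetric]
  by (auto intro!: linearI simp: cvec_add cvec_scaleR scaleR_eq_smult)

text \<open>\<open>B\<close> has the conjugated vectors as rows and \<open>C\<close> the vectors,
  divided by their squared norms, as columns. Orthogonality says \<open>B ** C = mat 1\<close>; for
  square matrices then also \<open>C ** B = mat 1\<close>, so \<open>B *v v = 0\<close> forces
  \<open>v = 0\<close>.\<close>

lemma herm_frame_zero:
  fixes e :: "4 \<Rightarrow> complex^4"
  assumes "\<And>i j. i \<noteq> j \<Longrightarrow> herm (e i) (e j) = 0" "\<And>i. e i \<noteq> 0" "\<And>i. herm v (e i) = 0"
  shows "v = 0"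
proof -
  define B C :: "complex^4^4" where "B = (\<chi> i. vcnj (e i))" and "C = (\<chi> k j. e j $ k / herm (e j) (e j))"
  have "(B ** C) $ i $ j = mat 1 $ i $ j" for i j
  proof -
    have "(B ** C) $ i $ j = herm (e j) (e i) / herm (e j) (e j)"
      by (simp add: matrix_matrix_mult_def B_def C_def cbil_def sum_divide_distrib mult.commute)
    also have "\<dots> = mat 1 $ i $ j"
      using assms(1)[of j i] assms(2)[of i] by (auto simp: mat_def herm_self)
    finally show ?thesis .
  qed
  then have "B ** C = mat 1" by (simp add: vec_eq_iff)
  then have "C ** B = mat 1" by (simp add: matrix_left_right_inverse)
  moreover have "B *v v = 0"
    using assms(3) by (simp add: vec_eq_iff matrix_vector_mult_def B_def cbil_def mult.commute)
  ultimately show ?thesis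
    by (metis matrix_vector_mul_assoc matrix_vector_mul_lid matrix_vector_mult_0_right)
qed

lemma herm_basis_zero:
  assumes "herm a b = 0" "herm a c = 0" "herm a d = 0" "herm b c = 0" "herm b d = 0" "herm c d = 0"
    "a \<noteq> 0" "b \<noteq> 0" "c \<noteq> 0" "d \<noteq> 0"
    "herm v a = 0" "herm v b = 0" "herm v c = 0" "herm v d = 0"
  shows "v = 0"
proof (rule herm_frame_zero)
  define e :: "4 \<Rightarrow> complex^4" where "e i = (if i = 1 then a else if i = 2 then b else if i = 3 then c else d)" for i
  have e: "e 1 = a" "e 2 = b" "e 3 = c" "e 4 = d" by (simp_all add: e_def)
  have comm: "herm x y = 0 \<Longrightarrow> herm y x = 0" for x y using cnj_herm[of x y] by simp
  have "\<forall>i j. i \<noteq> j \<longrightarrow> herm (e i) (e j) = 0"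
    unfolding forall_4 e using assms comm by auto
  then show "herm (e i) (e j) = 0" if "i \<noteq> j" for i j using that by blast
  have "\<forall>i. e i \<noteq> 0 \<and> herm v (e i) = 0" unfolding forall_4 e using assms by auto
  then show "e i \<noteq> 0" "herm v (e i) = 0" for i by auto
qed

lemma real_basis_zero:
  fixes a b c d v :: "real^4"
  assumes "a \<bullet> b = 0" "a \<bullet> c = 0" "a \<bullet> d = 0" "b \<bullet> c = 0" "b \<bullet> d = 0" "c \<bullet> d = 0"
    "a \<noteq> 0" "b \<noteq> 0" "c \<noteq> 0" "d \<noteq> 0" "v \<bullet> a = 0" "v \<bullet> b = 0" "v \<bullet> c = 0" "v \<bullet> d = 0"
  shows "v = 0"
proof -
  have nz: "cvec x = 0 \<longleftrightarrow> x = 0" for x by (simp add: cvec_def vec_eq_iff)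
  have "cvec v = 0"
    by (rule herm_basis_zero[of "cvec a" "cvec b" "cvec c" "cvec d"])
      (use assms in \<open>simp_all add: vcnj_cvec cbil_cvec nz\<close>)
  then show ?thesis by (simp add: nz)
qed

text \<open>Isotropy makes \<open>vcnj f\<close> Hermitian-orthogonal to \<open>f\<close>, so
  \<open>f\<close>, \<open>vcnj f\<close>, \<open>g\<close>, \<open>h\<close> is an orthogonal
  basis. In it \<open>vcnj g\<close> has components along \<open>g\<close> and \<open>h\<close>
  only, with coefficients \<open>cnj \<alpha> / r\<close> and \<open>cnj \<beta> / r\<close>.
  Pairing this expansion bilinearly with \<open>g\<close> gives the first identity, with
  \<open>h\<close> the second.\<close>

lemma cbil_isotropic_frame:
  fixes r :: real
  assumes f: "f \<noteq> 0" "cbil f f = 0" and r: "r > 0"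
    and gh: "herm g f = 0" "cbil g f = 0" "herm h f = 0" "cbil h f = 0"
      "herm g g = r" "herm h h = r" "herm g h = 0"
  shows "(cmod (cbil g g))\<^sup>2 + (cmod (cbil g h))\<^sup>2 = r\<^sup>2"
    and "cnj (cbil g g) * cbil g h + cnj (cbil g h) * cbil h h = 0"
proof -
  have comm: "herm x y = 0 \<Longrightarrow> herm y x = 0" for x y using cnj_herm[of x y] by simp
  define \<alpha> \<beta> where "\<alpha> = cbil g g" and "\<beta> = cbil g h"
  define w where "w = vcnj g - (cnj \<alpha> / r) *s g - (cnj \<beta> / r) *s h"
  have nz: "g \<noteq> 0" "h \<noteq> 0"
    using gh r by (auto simp: cbil_simps)
  have nzc: "vcnj f \<noteq> 0"
    using f vcnj_vcnj[of f] vcnj_zero by metis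
  have cg: "herm (vcnj g) x = cnj (cbil g x)" "cbil (vcnj g) x = cnj (herm g x)" for x
    by (simp_all add: cnj_cbil cbil_simps)
  have "w = 0"
  proof (rule herm_basis_zero[of f "vcnj f" g h])
    show "herm f (vcnj f) = 0" "herm f g = 0" "herm f h = 0" "herm (vcnj f) g = 0" "herm (vcnj f) h = 0"
      using f gh comm by (auto simp: cbil_simps comm cbil_commute cnj_cbil[symmetric])
    show "herm g h = 0" "f \<noteq> 0" "vcnj f \<noteq> 0" "g \<noteq> 0" "h \<noteq> 0" using gh f nz nzc by auto
    show "herm w f = 0" "herm w (vcnj f) = 0"
      using gh by (simp_all add: w_def cbil_simps cnj_cbil[symmetric] cg(2))
    show "herm w g = 0" "herm w h = 0"
      using gh r comm[OF gh(7)]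
      by (simp_all add: w_def cbil_diff_left cbil_smult_left cg(1)) (simp_all add: \<alpha>_def \<beta>_def)
  qed
  then have eq: "vcnj g = (cnj \<alpha> / r) *s g + (cnj \<beta> / r) *s h"
    by (simp add: w_def algebra_simps)
  have "complex_of_real r = cbil (vcnj g) g" using gh by (simp add: cbil_commute)
  also have "\<dots> = cnj \<alpha> / r * \<alpha> + cnj \<beta> / r * \<beta>"
    unfolding eq by (simp add: cbil_simps \<alpha>_def \<beta>_def cbil_commute)
  finally have "complex_of_real (r * r) = \<alpha> * cnj \<alpha> + \<beta> * cnj \<beta>"
    using r by (simp add: field_simps)
  then show "(cmod (cbil g g))\<^sup>2 + (cmod (cbil g h))\<^sup>2 = r\<^sup>2"
    unfolding complex_norm_square[symmetric] of_real_add[symmetric] of_real_eq_iff \<alpha>_def \<beta>_def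
    by (simp add: power2_eq_square)
  have "0 = cbil (vcnj g) h" using comm[OF gh(7)] by (simp add: cbil_commute)
  also have "\<dots> = cnj \<alpha> / r * cbil g h + cnj \<beta> / r * cbil h h"
    unfolding eq by (simp add: cbil_simps)
  finally show "cnj (cbil g g) * cbil g h + cnj (cbil g h) * cbil h h = 0"
    using r by (simp add: \<alpha>_def \<beta>_def field_simps)
qed

text \<open>This turns vanishing mean curvature into orthogonality to the normal space. The definite
  description is resolved because two candidates differ by a vector of \<open>S\<close> that is
  orthogonal to itself.\<close>

lemma orth_proj_eq_0_iff:
  assumes "subspace S"
  shows "orth_proj S v = 0 \<longleftrightarrow> (\<forall>s\<in>S. v \<bullet> s = 0)"
proof
  assume *: "\<forall>s\<in>S. v \<bullet> s = 0"
  show "orth_proj S v = 0"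
    unfolding orth_proj_def
  proof (rule the_equality)
    show "0 \<in> S \<and> (\<forall>s\<in>S. (v - 0) \<bullet> s = 0)" using * assms by (simp add: subspace_0)
    fix w assume w: "w \<in> S \<and> (\<forall>s\<in>S. (v - w) \<bullet> s = 0)"
    then have "w \<bullet> w = 0" using * by (auto simp: inner_diff_left)
    then show "w = 0" by simp
  qed
next
  assume 0: "orth_proj S v = 0"
  obtain y z where yz: "y \<in> span S" "\<And>w. w \<in> span S \<Longrightarrow> orthogonal z w" "v = y + z"
    using orthogonal_subspace_decomp_exists by blast
  have "orth_proj S v = y"
    unfolding orth_proj_def
  proof (rule the_equality)
    show y: "y \<in> S \<and> (\<forall>s\<in>S. (v - y) \<bullet> s = 0)"
      using yz assms by (metis add_diff_cancel_left' orthogonal_def span_eq_iff)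
    fix w assume w: "w \<in> S \<and> (\<forall>s\<in>S. (v - w) \<bullet> s = 0)"
    have "w - y \<in> S" using w y assms by (simp add: subspace_diff)
    then have "(v - w) \<bullet> (w - y) = 0" "(v - y) \<bullet> (w - y) = 0" using w y by auto
    then have "(w - y) \<bullet> (w - y) = 0" by (simp add: inner_diff_left)
    then show "w = y" by simp
  qed
  with 0 yz show "\<forall>s\<in>S. v \<bullet> s = 0"
    using assms by (metis add_0 orthogonal_def span_eq_iff)
qed

section \<open>Conformal maps and horizontal lifts\<close>

text \<open>For a conformal immersion the mean curvature vector is a positive multiple of the normal
  part of this flat Laplacian, so minimality is a condition on it alone.\<close>

definition laplacian :: "(complex \<Rightarrow> 'b::real_normed_vector) \<Rightarrow> complex \<Rightarrow> 'b" where
  "laplacian F z = pd 1 (pd 1 F) z + pd \<i> (pd \<i> F) z"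

text \<open>Conformality says that the two coordinate derivatives have equal length and are
  orthogonal; differentiating both equations in both directions expresses the tangential second
  derivatives through the mixed one. Only these equations are differentiated, never
  \<open>\<rho>\<close> itself.\<close>

lemma conformal_second_derivatives:
  fixes F :: "complex \<Rightarrow> 'b::euclidean_space"
  assumes D: "open D" "z \<in> D" and F: "smooth_on D F"
    and conf: "\<And>z v w. z \<in> D \<Longrightarrow> pd v F z \<bullet> pd w F z = \<rho> z * (v \<bullet> w)"
  shows "pd 1 (pd 1 F) z \<bullet> pd 1 F z = pd 1 (pd \<i> F) z \<bullet> pd \<i> F z"
    and "pd \<i> (pd \<i> F) z \<bullet> pd \<i> F z = pd 1 (pd \<i> F) z \<bullet> pd 1 F z"
    and "pd 1 (pd 1 F) z \<bullet> pd \<i> F z = - (pd 1 (pd \<i> F) z \<bullet> pd 1 F z)"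
    and "pd \<i> (pd \<i> F) z \<bullet> pd 1 F z = - (pd 1 (pd \<i> F) z \<bullet> pd \<i> F z)"
proof -
  note diff = smooth_on_differentiable[OF smooth_on_pd[OF F] D]
  have swap: "pd \<i> (pd 1 F) z = pd 1 (pd \<i> F) z" by (rule pd_commute[OF D F])
  have d: "pd v (\<lambda>w. pd a F w \<bullet> pd b F w) z = pd a F z \<bullet> pd v (pd b F) z + pd v (pd a F) z \<bullet> pd b F z" for v a b
    by (rule pd_bilinear[OF bounded_bilinear_inner diff diff])
  have eq: "pd v (\<lambda>w. pd 1 F w \<bullet> pd 1 F w) z = pd v (\<lambda>w. pd \<i> F w \<bullet> pd \<i> F w) z" for v
    by (rule pd_cong_open[OF D]) (simp add: conf)
  have zero: "pd v (\<lambda>w. pd 1 F w \<bullet> pd \<i> F w) z = pd v (\<lambda>w. 0) z" for v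
    by (rule pd_cong_open[OF D]) (simp add: conf)
  show "pd 1 (pd 1 F) z \<bullet> pd 1 F z = pd 1 (pd \<i> F) z \<bullet> pd \<i> F z"
    "pd \<i> (pd \<i> F) z \<bullet> pd \<i> F z = pd 1 (pd \<i> F) z \<bullet> pd 1 F z"
    "pd 1 (pd 1 F) z \<bullet> pd \<i> F z = - (pd 1 (pd \<i> F) z \<bullet> pd 1 F z)"
    "pd \<i> (pd \<i> F) z \<bullet> pd 1 F z = - (pd 1 (pd \<i> F) z \<bullet> pd \<i> F z)"
    using eq[of 1] eq[of \<i>] zero[of 1] zero[of \<i>]
    unfolding d swap by (simp_all add: inner_commute)
qed

lemma conformal_laplacian_orthogonal:
  fixes F :: "complex \<Rightarrow> 'b::euclidean_space"
  assumes D: "open D" "z \<in> D" and F: "smooth_on D F"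
    and conf: "\<And>z v w. z \<in> D \<Longrightarrow> pd v F z \<bullet> pd w F z = \<rho> z * (v \<bullet> w)"
  shows "laplacian F z \<bullet> pd v F z = 0"
proof -
  note c = conformal_second_derivatives[OF assms]
  have "laplacian F z \<bullet> pd 1 F z = 0" "laplacian F z \<bullet> pd \<i> F z = 0"
    using c by (simp_all add: laplacian_def inner_add_left)
  then show ?thesis
    using pd_decomp[OF smooth_on_differentiable[OF F D], of v] by (simp add: inner_add_right)
qed

section \<open>Holomorphic quadratic differentials\<close>

lemma pd_dz:
  assumes "open D" "z \<in> D" "smooth_on D g"
  shows "dz g differentiable at z"
    and "pd v (dz g) z = (1/2) *s (pd v (pd 1 g) z - \<i> *s pd v (pd \<i> g) z)"
proof -
  note d = smooth_on_differentiable[OF smooth_on_pd[OF assms(3)] assms(1,2)]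
  note di = differentiable_bounded_linear[OF bounded_linear_smult d]
  have eq: "dz g = (\<lambda>z. (1/2) *s (pd 1 g z - \<i> *s pd \<i> g z))" by (rule ext) (simp add: dz_def)
  show "dz g differentiable at z"
    unfolding eq by (intro differentiable_bounded_linear[OF bounded_linear_smult] differentiable_diff d di)
  show "pd v (dz g) z = (1/2) *s (pd v (pd 1 g) z - \<i> *s pd v (pd \<i> g) z)"
    unfolding eq
    by (subst pd_bounded_linear[OF bounded_linear_smult], intro differentiable_diff d di,
        subst pd_diff[OF d di], subst pd_bounded_linear[OF bounded_linear_smult d]) (rule refl)
qed

text \<open>Four times the second derivative in z and zb is the Laplacian, so the zb-derivative of
  \<langle>\<open>dz g\<close>, \<open>dz g\<close>\<rangle> is half of
  \<langle>\<open>laplacian g\<close>, \<open>dz g\<close>\<rangle>. It serves both for the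
  differential of a lift and for the differential that measures conformality of
  \<open>F\<close>.\<close>

lemma holomorphic_cbil_dz:
  assumes D: "open D" and g: "smooth_on D g"
    and lap: "\<And>z v. z \<in> D \<Longrightarrow> cbil (laplacian g z) (pd v g z) = 0"
  shows "(\<lambda>z. cbil (dz g z) (dz g z)) holomorphic_on D"
proof (rule holomorphic_onI_pd[OF D])
  fix z assume z: "z \<in> D"
  note d = pd_dz[OF D z g]
  show "(\<lambda>z. cbil (dz g z) (dz g z)) differentiable at z"
    by (rule differentiable_bilinear[OF bounded_bilinear_cbil d(1) d(1)])
  have e: "pd v (\<lambda>z. cbil (dz g z) (dz g z)) z = 2 * cbil (pd v (dz g) z) (dz g z)" for v
    unfolding pd_bilinear[OF bounded_bilinear_cbil d(1) d(1)] by (simp add: cbil_commute)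
  have swap: "pd \<i> (pd 1 g) z = pd 1 (pd \<i> g) z" by (rule pd_commute[OF D z g])
  have "pd 1 (dz g) z + \<i> *s pd \<i> (dz g) z = (1/2) *s laplacian g z"
    unfolding d(2) swap by (simp add: laplacian_def vec_eq_iff algebra_simps)
  then have "cbil (pd 1 (dz g) z + \<i> *s pd \<i> (dz g) z) (dz g z) = 0"
    using lap[OF z] by (simp add: dz_def cbil_simps)
  then have "2 * (cbil (pd 1 (dz g) z) (dz g z) + \<i> * cbil (pd \<i> (dz g) z) (dz g z)) = 0"
    by (simp add: cbil_simps)
  then show "pd 1 (\<lambda>z. cbil (dz g z) (dz g z)) z + \<i> * pd \<i> (\<lambda>z. cbil (dz g z) (dz g z)) z = 0"
    unfolding e by (simp only: distrib_left mult.left_commute)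
qed

text \<open>Differentiating the orthogonality trades the second derivative in a Hopf differential
  for a first derivative of the normal.\<close>

lemma cbil_dz_dz:
  assumes D: "open D" "z \<in> D" and G: "smooth_on D G" and K: "K differentiable at z"
    and 0: "\<And>z v. z \<in> D \<Longrightarrow> cbil (pd v G z) (K z) = 0"
  shows "cbil (dz (dz G) z) (K z) = - cbil (dz G z) (dz K z)"
proof -
  have e: "cbil (dz G z) (pd v K z) + cbil (pd v (dz G) z) (K z) = 0" for v
    by (rule bilinear_const_pd[OF bounded_bilinear_cbil D _ pd_dz(1)[OF D G] K])
      (simp add: dz_def cbil_simps 0)
  have "cbil (pd v (dz G) z) (K z) = - cbil (dz G z) (pd v K z)" for v
    using e[of v] by (simp add: add_eq_0_iff)
  then show ?thesis
    by (simp add: dz_def[of "dz G"] dz_def[of K] cbil_simps algebra_simps)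
qed

section \<open>Isotropic horizontal Lagrangian lifts in one coordinate\<close>

lemma subspace_normal_space_Q2: "subspace (normal_space_Q2 F z)"
  unfolding normal_space_Q2_def subspace_def
  by (auto simp: cbil_simps scaleR_eq_smult inner_add_left) (simp add: scaleR_eq_smult[symmetric])

text \<open>The assumption \<open>metric\<close> is an equation between complex numbers: the real
  part says that the induced metric is conformal with coefficient \<open>\<rho>\<close>, the
  imaginary part that the Kaehler form pulls back to zero.\<close>

locale lagrangian_lift =
  fixes D :: "complex set" and F :: "complex \<Rightarrow> complex^4" and \<rho> :: "complex \<Rightarrow> real"
  assumes open_D: "open D" and smooth: "smooth_on D F"
    and norm_F: "\<And>z. z \<in> D \<Longrightarrow> norm (F z) = 1"
    and isotropic: "\<And>z. z \<in> D \<Longrightarrow> cbil (F z) (F z) = 0"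
    and horizontal: "\<And>z v. z \<in> D \<Longrightarrow> herm (pd v F z) (F z) = 0"
    and metric: "\<And>z v w. z \<in> D \<Longrightarrow> herm (pd v F z) (pd w F z) = complex_of_real (\<rho> z * (v \<bullet> w))"
    and pos: "\<And>z. z \<in> D \<Longrightarrow> 0 < \<rho> z"
begin

lemma differentiable: "z \<in> D \<Longrightarrow> F differentiable at z"
  and differentiable_pd: "z \<in> D \<Longrightarrow> pd v F differentiable at z"
  using smooth open_D smooth_on_differentiable smooth_on_pd by blast+

lemma herm_F: "z \<in> D \<Longrightarrow> herm (F z) (F z) = 1"
  using norm_F by (simp add: herm_self norm_eq_1)

lemma horizontal': "z \<in> D \<Longrightarrow> herm (F z) (pd v F z) = 0"
  using horizontal cnj_herm by (metis complex_cnj_zero)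

lemma tangent: "z \<in> D \<Longrightarrow> cbil (pd v F z) (F z) = 0"
  using bilinear_const_pd[OF bounded_bilinear_cbil open_D _ isotropic differentiable differentiable, of z v]
  by (simp add: cbil_commute)

lemma second_herm: "z \<in> D \<Longrightarrow> herm (pd v (pd w F) z) (F z) = - complex_of_real (\<rho> z * (w \<bullet> v))"
  using bilinear_const_pd[OF bounded_bilinear_herm open_D _ horizontal differentiable_pd differentiable, of z w v]
  by (simp add: metric add_eq_0_iff)

lemma second_cbil: "z \<in> D \<Longrightarrow> cbil (pd v (pd w F) z) (F z) = - cbil (pd w F z) (pd v F z)"
  using bilinear_const_pd[OF bounded_bilinear_cbil open_D _ tangent differentiable_pd differentiable, of z w v]
  by (simp add: add_eq_0_iff)

lemma inner_pd: "z \<in> D \<Longrightarrow> pd v F z \<bullet> pd w F z = \<rho> z * (v \<bullet> w)"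
  by (simp add: inner_eq_herm metric)

lemma Re_laplacian: "z \<in> D \<Longrightarrow> Re (herm (laplacian F z) (pd v F z)) = 0"
  using conformal_laplacian_orthogonal[OF open_D _ smooth inner_pd] by (simp add: inner_eq_herm)

lemma herm_laplacian: "z \<in> D \<Longrightarrow> herm (laplacian F z) (F z) = - complex_of_real (2 * \<rho> z)"
  by (simp add: laplacian_def cbil_simps second_herm)

lemma cbil_laplacian: "z \<in> D \<Longrightarrow> cbil (laplacian F z) (F z) = - 4 * cbil (dz F z) (dzb F z)"
  by (simp add: laplacian_def cbil_simps second_cbil dz_def dzb_def algebra_simps
      cbil_commute[of "pd \<i> F z" "pd 1 F z"])

lemma frame:
  assumes "z \<in> D"
  shows "herm (dz F z) (F z) = 0" "cbil (dz F z) (F z) = 0" "herm (dzb F z) (F z) = 0" "cbil (dzb F z) (F z) = 0"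
    "herm (dz F z) (dz F z) = complex_of_real (\<rho> z / 2)" "herm (dzb F z) (dzb F z) = complex_of_real (\<rho> z / 2)"
    "herm (dz F z) (dzb F z) = 0"
  using assms by (simp_all add: dz_def dzb_def cbil_simps horizontal tangent metric field_simps)

lemma F_nonzero: "z \<in> D \<Longrightarrow> F z \<noteq> 0"
  using norm_F by force

lemmas frame_relations =
  cbil_isotropic_frame[OF F_nonzero isotropic half_gt_zero[OF pos] frame]

lemma push_eq: "z \<in> D \<Longrightarrow> push F v z = pd v F z"
  by (simp add: push_def hor_part_def horizontal)

text \<open>The coefficients come from differentiating horizontality and tangency to the quadric
  once more. The product with \<open>vcnj (F z)\<close> under \<open>herm\<close> is the product
  with \<open>F z\<close> under \<open>cbil\<close>, which is how \<langle>\<open>dz F\<close>,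
  \<open>dzb F\<close>\<rangle> appears.\<close>

lemma laplacian_eq:
  assumes z: "z \<in> D" and 0: "\<And>v. herm (laplacian F z) (pd v F z) = 0"
  shows "laplacian F z = - ((2 * \<rho> z) *s F z) - (4 * cbil (dz F z) (dzb F z)) *s vcnj (F z)"
proof -
  define w where "w = laplacian F z + complex_of_real (2 * \<rho> z) *s F z + (4 * cbil (dz F z) (dzb F z)) *s vcnj (F z)"
  have c: "herm (vcnj (F z)) x = cnj (cbil (F z) x)" for x by (simp add: cnj_cbil)
  have nz: "vcnj (F z) \<noteq> 0" using F_nonzero[OF z] vcnj_vcnj[of "F z"] vcnj_zero by metis
  have nzp: "pd v F z \<noteq> 0" if "v \<noteq> 0" for v
    using inner_pd[OF z, of v v] pos[OF z] that by auto
  have "w = 0"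
  proof (rule herm_basis_zero[of "F z" "vcnj (F z)" "pd 1 F z" "pd \<i> F z"])
    show "herm (F z) (vcnj (F z)) = 0" "herm (F z) (pd 1 F z) = 0" "herm (F z) (pd \<i> F z) = 0"
      "herm (pd 1 F z) (pd \<i> F z) = 0"
      using z by (simp_all add: vcnj_vcnj isotropic horizontal' metric)
    show "herm (vcnj (F z)) (pd 1 F z) = 0" "herm (vcnj (F z)) (pd \<i> F z) = 0"
      using tangent[OF z] by (simp_all add: c cbil_commute)
    show "F z \<noteq> 0" "vcnj (F z) \<noteq> 0" "pd 1 F z \<noteq> 0" "pd \<i> F z \<noteq> 0"
      using F_nonzero[OF z] nz nzp by auto
    show "herm w (F z) = 0" "herm w (vcnj (F z)) = 0"
      using z herm_laplacian[OF z] cbil_laplacian[OF z] herm_F[OF z] isotropic[OF z]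
      by (simp_all add: w_def cbil_add_left cbil_smult_left vcnj_vcnj c cbil_commute[of "vcnj (F z)" "F z"])
    show "herm w (pd 1 F z) = 0" "herm w (pd \<i> F z) = 0"
      using 0 horizontal'[OF z] tangent[OF z]
      by (simp_all add: w_def cbil_add_left cbil_smult_left c cbil_commute[of "F z" "pd _ F z"])
  qed
  then show ?thesis by (simp add: w_def add_eq_0_iff2 algebra_simps) 
qed

lemma cov_push:
  assumes "z \<in> D"
  shows "cov F v (push F v) z = hor_part (F z) (pd v (pd v F) z)"
proof -
  have "pd v (push F v) z = pd v (pd v F) z"
    by (rule pd_cong_open[OF open_D assms]) (rule push_eq)
  then show ?thesis using assms by (simp add: cov_def horizontal)
qed

text \<open>Conformality already kills the real part. On a Lagrangian surface multiplication by \<i>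
  carries tangent vectors into the normal space, so minimality kills the imaginary part.\<close>

lemma laplacian_orthogonal_of_minimal:
  assumes z: "z \<in> D" and min: "mean_curv_Q2 F z = 0"
  shows "herm (laplacian F z) (pd v F z) = 0"
proof -
  let ?S = "normal_space_Q2 F z"
  have "push F 1 z \<noteq> 0"
    using inner_pd[OF z, of 1 1] pos[OF z] push_eq[OF z] by auto
  then have "orth_proj ?S (hor_part (F z) (laplacian F z)) = 0"
    using min by (simp add: mean_curv_Q2_def cov_push[OF z] laplacian_def hor_part_def cbil_simps algebra_simps vec.scale_left_distrib)
  then have perp: "hor_part (F z) (laplacian F z) \<bullet> n = 0" if "n \<in> ?S" for n
    using orth_proj_eq_0_iff[OF subspace_normal_space_Q2] that by blast
  have "\<i> *s pd v F z \<in> ?S"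
    using z by (simp add: normal_space_Q2_def cbil_simps horizontal tangent push_eq inner_eq_herm metric)
  from perp[OF this] have "Im (herm (laplacian F z) (pd v F z)) = 0"
    using horizontal'[OF z] by (simp add: hor_part_def inner_eq_herm cbil_simps)
  then show ?thesis using Re_laplacian[OF z, of v] by (simp add: complex_eq_iff)
qed

text \<open>All lifts of a map are unimodular multiples of a given one; the phase function drops out of
  every quantity below.\<close>

context
  fixes D' f G
  assumes D': "D' \<subseteq> D" and lift: "lift_on D' f G" and f: "\<And>z. z \<in> D' \<Longrightarrow> f z = cline (F z)"
begin

text \<open>The product with the unit vector \<open>F z\<close> recovers the factor explicitly,
  which makes it differentiable without any choice of argument.\<close>

definition phase :: "complex \<Rightarrow> complex" where "phase z = herm (G z) (F z)"

lemma
  assumes z: "z \<in> D'"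
  shows lift_eq_phase: "G z = phase z *s F z" and phase_cnj: "phase z * cnj (phase z) = 1"
proof -
  have "G z \<in> cline (G z)" unfolding cline_def by (rule range_eqI[of _ _ 1]) simp
  then have "G z \<in> cline (F z)" using lift z f by (simp add: lift_on_def)
  then obtain c where c: "G z = c *s F z" by (auto simp: cline_def)
  then show eq: "G z = phase z *s F z" using z D' herm_F by (auto simp: phase_def cbil_simps)
  have "herm (G z) (G z) = 1" using lift z by (simp add: lift_on_def herm_self norm_eq_1)
  moreover have "herm (F z) (F z) = 1" using herm_F D' z by blast
  ultimately show "phase z * cnj (phase z) = 1"
    unfolding eq by (simp add: cbil_simps mult.commute)
qed

lemma open_D': "open D'" and smooth_G: "smooth_on D' G"
  using lift by (auto simp: lift_on_def)

lemma differentiable_phase: "z \<in> D' \<Longrightarrow> phase differentiable at z"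
proof -
  assume z: "z \<in> D'"
  have "(\<lambda>w. herm (G w) (F w)) differentiable at z"
    by (rule differentiable_bilinear[OF bounded_bilinear_herm smooth_on_differentiable[OF smooth_G open_D' z] differentiable])
      (use z D' in auto)
  then show ?thesis unfolding phase_def[abs_def] .
qed

lemma pd_lift:
  assumes z: "z \<in> D'"
  shows "pd v G z = phase z *s pd v F z + pd v phase z *s F z"
proof -
  have "pd v G z = pd v (\<lambda>w. phase w *s F w) z"
    by (rule pd_cong_open[OF open_D' z lift_eq_phase])
  then show ?thesis
    using pd_bilinear[OF bounded_bilinear_smult differentiable_phase[OF z] differentiable] z D' by auto
qed

lemma push_lift:
  assumes z: "z \<in> D'"
  shows "push G v z = phase z *s pd v F z"
proof -
  have zD: "z \<in> D" using z D' by auto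
  have "herm (pd v G z) (G z) = pd v phase z * cnj (phase z)"
    using horizontal[OF zD] herm_F[OF zD] by (simp add: pd_lift[OF z] lift_eq_phase[OF z] cbil_simps)
  then have "herm (pd v G z) (G z) *s G z = pd v phase z *s F z"
    using phase_cnj[OF z] lift_eq_phase[OF z] by (simp add: mult.assoc mult.commute[of "cnj _"])
  then show ?thesis by (simp add: push_def hor_part_def pd_lift[OF z])
qed

text \<open>The correction term in \<open>cov\<close> cancels the derivative of the phase, and
  \<open>hor_part\<close> commutes with the phase because its modulus is 1.\<close>

lemma cov_lift:
  assumes z: "z \<in> D'"
  shows "cov G w (push G v) z = phase z *s hor_part (F z) (pd w (pd v F) z)"
proof -
  have zD: "z \<in> D" using z D' by auto
  have "pd w (push G v) z = pd w (\<lambda>w. phase w *s pd v F w) z"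
    by (rule pd_cong_open[OF open_D' z push_lift])
  also have "\<dots> = phase z *s pd w (pd v F) z + pd w phase z *s pd v F z"
    by (rule pd_bilinear[OF bounded_bilinear_smult differentiable_phase[OF z] differentiable_pd[OF zD]])
  finally have 1: "pd w (push G v) z = phase z *s pd w (pd v F) z + pd w phase z *s pd v F z" .
  have "herm (pd w G z) (G z) = pd w phase z * cnj (phase z)"
    using horizontal[OF zD] herm_F[OF zD] by (simp add: pd_lift[OF z] lift_eq_phase[OF z] cbil_simps)
  then have "herm (pd w G z) (G z) *s push G v z = pd w phase z *s pd v F z"
    using phase_cnj[OF z] push_lift[OF z] by (simp add: mult.assoc mult.commute[of "cnj _"])
  then have "cov G w (push G v) z = hor_part (G z) (phase z *s pd w (pd v F) z)"
    using 1 by (simp add: cov_def)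
  also have "\<dots> = phase z *s pd w (pd v F) z - (phase z * (phase z * cnj (phase z)) * herm (pd w (pd v F) z) (F z)) *s F z"
    by (simp add: hor_part_def lift_eq_phase[OF z] cbil_simps algebra_simps)
  also have "\<dots> = phase z *s hor_part (F z) (pd w (pd v F) z)"
    unfolding phase_cnj[OF z] by (simp add: hor_part_def vec_eq_iff algebra_simps)
  finally show ?thesis .
qed

lemma herm_push_lift:
  assumes z: "z \<in> D'"
  shows "herm (push G v z) (push G w z) = complex_of_real (\<rho> z * (v \<bullet> w))"
proof -
  have "herm (push G v z) (push G w z) = (phase z * cnj (phase z)) * herm (pd v F z) (pd w F z)"
    by (simp add: push_lift[OF z] cbil_simps)
  then show ?thesis using metric phase_cnj[OF z] z D' by auto
qed

text \<open>By \<open>laplacian_eq\<close> the horizontal part of the Laplacian is a multiple of the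
  conjugate of \<open>F\<close>. That vector is normal to the quadric in \<open>CP3\<close>, hence
  orthogonal to every normal direction inside the quadric.\<close>

lemma mean_curv_lift:
  assumes z: "z \<in> D'" and lap: "\<And>v. herm (laplacian F z) (pd v F z) = 0"
  shows "mean_curv_Q2 G z = 0"
proof -
  have zD: "z \<in> D" using z D' by auto
  have "cov G 1 (push G 1) z + cov G \<i> (push G \<i>) z = phase z *s hor_part (F z) (laplacian F z)"
    by (simp add: cov_lift[OF z] laplacian_def hor_part_def cbil_simps vec_eq_iff algebra_simps)
  also have "\<dots> = (- phase z * (4 * cbil (dz F z) (dzb F z))) *s vcnj (F z)"
    using herm_F[OF zD] cnj_cbil[of "F z" "F z"] isotropic[OF zD]
    unfolding laplacian_eq[OF zD lap] by (simp add: hor_part_def cbil_simps vec_eq_iff algebra_simps)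
  finally have sum: "cov G 1 (push G 1) z + cov G \<i> (push G \<i>) z = (- phase z * (4 * cbil (dz F z) (dzb F z))) *s vcnj (F z)" .
  have "(a *s vcnj (F z)) \<bullet> n = 0" if "n \<in> normal_space_Q2 G z" for n a
  proof -
    have "phase z \<noteq> 0" using phase_cnj[OF z] by auto
    then have "cbil n (F z) = 0"
      using that by (simp add: normal_space_Q2_def lift_eq_phase[OF z] cbil_simps)
    then have "herm (vcnj (F z)) n = 0" by (simp add: cnj_cbil[symmetric] cbil_commute)
    then show ?thesis by (simp add: inner_eq_herm cbil_simps)
  qed
  then show ?thesis
    unfolding mean_curv_Q2_def sum
    using orth_proj_eq_0_iff[OF subspace_normal_space_Q2[of G z]] by simp
qed

end

text \<open>The definitions quantify over all smooth unit lifts of \<open>f\<close>; independence of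
  the phase reduces them to the single lift \<open>F\<close>.\<close>

lemma surface_of_lift:
  assumes f: "\<And>z. z \<in> D \<Longrightarrow> f z = cline (F z)"
    and lap: "\<And>z v. z \<in> D \<Longrightarrow> herm (laplacian F z) (pd v F z) = 0"
  shows "smooth_in_CP3 D f" "fubini_study_metric D f \<rho>" "lagrangian D f" "minimal_in_Q2 D f"
proof -
  have "lift_on D f F" using open_D smooth norm_F f by (simp add: lift_on_def)
  then show "smooth_in_CP3 D f" unfolding smooth_in_CP3_def by blast
  have H: "herm (push G v z) (push G w z) = complex_of_real (\<rho> z * (v \<bullet> w))"
    and M: "mean_curv_Q2 G z = 0"
    if "D' \<subseteq> D" "lift_on D' f G" "z \<in> D'" for D' G v w z
    using that f by (blast intro: herm_push_lift mean_curv_lift lap)+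
  show "fubini_study_metric D f \<rho>"
    unfolding fubini_study_metric_def inner_eq_herm by (auto simp: H)
  show "lagrangian D f"
    unfolding lagrangian_def kaehler_form_def inner_eq_herm by (auto simp: cbil_simps H)
  show "minimal_in_Q2 D f"
    unfolding minimal_in_Q2_def using M by blast
qed

text \<open>The Laplacian is a combination of \<open>F\<close> and its conjugate. The derivatives of
  \<open>F\<close> are bilinearly orthogonal to the former by isotropy and to the latter by
  horizontality.\<close>

lemma holomorphic_differential:
  assumes lap: "\<And>z v. z \<in> D \<Longrightarrow> herm (laplacian F z) (pd v F z) = 0"
  shows "(\<lambda>z. cbil (dz F z) (dz F z)) holomorphic_on D"
proof (rule holomorphic_cbil_dz[OF open_D smooth])
  fix z v assume z: "z \<in> D"
  show "cbil (laplacian F z) (pd v F z) = 0"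
    unfolding laplacian_eq[OF z lap[OF z]] cbil_simps cbil_commute[of "F z"] cbil_commute[of "vcnj _"]
    using tangent[OF z] horizontal[OF z] by simp
qed

end

section \<open>Pairs of maps into the 3-sphere\<close>

text \<open>The pointwise form of \<open>pair_lift\<close>; the factor makes a pair of unit vectors
  into a unit vector.\<close>

definition cpx :: "real^4 \<Rightarrow> real^4 \<Rightarrow> complex^4" where
  "cpx a b = complex_of_real (sqrt 2 / 2) *s (cvec a + \<i> *s cvec b)"

lemma half_sqrt2: "complex_of_real (sqrt 2) * (complex_of_real (sqrt 2) * x) = 2 * x"
  by (simp add: mult.assoc[symmetric] of_real_mult[symmetric] del: of_real_mult)

lemma herm_cpx: "herm (cpx a b) (cpx c d) = Complex ((a \<bullet> c + b \<bullet> d) / 2) ((b \<bullet> c - a \<bullet> d) / 2)"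
  by (simp add: cpx_def cbil_simps vcnj_cvec cbil_cvec half_sqrt2 complex_eq_iff field_simps)

lemma cbil_cpx: "cbil (cpx a b) (cpx c d) = Complex ((a \<bullet> c - b \<bullet> d) / 2) ((b \<bullet> c + a \<bullet> d) / 2)"
  by (simp add: cpx_def cbil_simps vcnj_cvec cbil_cvec half_sqrt2 complex_eq_iff field_simps)

lemma bounded_linear_cpx: "bounded_linear (\<lambda>p. cpx (fst p) (snd p))"
  unfolding linear_conv_bounded_linear[symmetric]
  by (auto intro!: linearI simp: cpx_def cvec_add cvec_scaleR scaleR_eq_smult vec_eq_iff algebra_simps)

lemma cline_smult:
  assumes "c \<noteq> 0"
  shows "cline (c *s v) = cline v"
proof -
  have "a *s (c *s v) \<in> range (\<lambda>a. a *s v)" for a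
    by (rule range_eqI[of _ _ "a * c"]) simp
  moreover have "a *s v \<in> range (\<lambda>a. a *s (c *s v))" for a
    by (rule range_eqI[of _ _ "a / c"]) (use assms in simp)
  ultimately show ?thesis unfolding cline_def by blast
qed

lemma cline_cpx: "cline (cpx a b) = cline (cvec a + \<i> *s cvec b)"
  unfolding cpx_def by (rule cline_smult) simp

lemma pd_cpx:
  assumes "F differentiable at z" "N differentiable at z"
  shows "pd v (\<lambda>z. cpx (F z) (N z)) z = cpx (pd v F z) (pd v N z)"
proof -
  have "(\<lambda>z. (F z, N z)) differentiable at z"
    using has_derivative_Pair[OF assms[THEN has_derivative_pd]] by (auto simp: differentiable_def)
  from pd_bounded_linear[OF bounded_linear_cpx this, of v] show ?thesis by (simp add: pd_Pair[OF assms])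
qed

lemma smooth_on_cpx:
  "open D \<Longrightarrow> smooth_on D F \<Longrightarrow> smooth_on D N \<Longrightarrow> smooth_on D (\<lambda>z. cpx (F z) (N z))"
  using smooth_on_bounded_linear[OF _ bounded_linear_cpx smooth_on_Pair] by simp

lemma laplacian_cpx:
  assumes "open D" "z \<in> D" "smooth_on D F" "smooth_on D N"
  shows "laplacian (\<lambda>z. cpx (F z) (N z)) z = cpx (laplacian F z) (laplacian N z)"
proof -
  have "pd v (pd v (\<lambda>z. cpx (F z) (N z))) z = cpx (pd v (pd v F) z) (pd v (pd v N) z)" for v
  proof -
    have "pd v (pd v (\<lambda>z. cpx (F z) (N z))) z = pd v (\<lambda>z. cpx (pd v F z) (pd v N z)) z"
      by (rule pd_cong_open[OF assms(1,2)])
        (rule pd_cpx[OF smooth_on_differentiable[OF assms(3,1)] smooth_on_differentiable[OF assms(4,1)]])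
    then show ?thesis
      by (simp add: pd_cpx smooth_on_differentiable[OF smooth_on_pd _ assms(2)] assms)
  qed
  then show ?thesis
    by (simp add: laplacian_def cpx_def cvec_add vec_eq_iff algebra_simps)
qed

lemma pd_cvec: "F differentiable at z \<Longrightarrow> pd v (\<lambda>z. cvec (F z)) z = cvec (pd v F z)"
  by (rule pd_bounded_linear[OF bounded_linear_cvec])

lemma smooth_on_cvec: "open D \<Longrightarrow> smooth_on D F \<Longrightarrow> smooth_on D (\<lambda>z. cvec (F z))"
  by (rule smooth_on_bounded_linear[OF _ bounded_linear_cvec])

lemma cbil_dz: "cbil (dz G z) (dz K z) = (cbil (pd 1 G z) (pd 1 K z) - cbil (pd \<i> G z) (pd \<i> K z)
    - \<i> * (cbil (pd 1 G z) (pd \<i> K z) + cbil (pd \<i> G z) (pd 1 K z))) / 4"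
  by (simp add: dz_def cbil_simps algebra_simps)

lemma cbil_dz_cvec:
  assumes "F differentiable at z" "N differentiable at z"
  shows "cbil (dz (\<lambda>z. cvec (F z)) z) (dz (\<lambda>z. cvec (N z)) z)
    = Complex ((pd 1 F z \<bullet> pd 1 N z - pd \<i> F z \<bullet> pd \<i> N z) / 4)
        (- (pd 1 F z \<bullet> pd \<i> N z + pd \<i> F z \<bullet> pd 1 N z) / 4)"
  unfolding cbil_dz by (simp add: pd_cvec assms cbil_cvec complex_eq_iff)

section \<open>Minimal surfaces in the 3-sphere\<close>

lemma subspace_normal_S3: "subspace {n :: real^4. n \<bullet> a = 0 \<and> (\<forall>v. n \<bullet> b v = 0)}"
  unfolding subspace_def by (auto simp: inner_add_left)

locale minimal_S3 =
  fixes D :: "complex set" and F N :: "complex \<Rightarrow> real^4" and \<rho> :: "complex \<Rightarrow> real"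
  assumes open_D: "open D" and minimal: "minimal_in_S3 D F N" and metric: "euclid_metric D F \<rho>"
begin

lemma smooth: "smooth_on D F" "smooth_on D N"
  using minimal by (auto simp: minimal_in_S3_def)

lemma differentiable: "z \<in> D \<Longrightarrow> F differentiable at z" "z \<in> D \<Longrightarrow> N differentiable at z"
  and differentiable_pd: "z \<in> D \<Longrightarrow> pd v F differentiable at z" "z \<in> D \<Longrightarrow> pd v N differentiable at z"
  using smooth open_D smooth_on_differentiable smooth_on_pd by blast+

lemma inner_pd_F: "z \<in> D \<Longrightarrow> pd v F z \<bullet> pd w F z = \<rho> z * (v \<bullet> w)"
  using metric by (auto simp: euclid_metric_def)

text \<open>The positive coefficient hidden in \<open>minimal_in_S3\<close> agrees with
  \<open>\<rho>\<close>, both being the squared length of \<open>pd 1 F z\<close>.\<close>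

lemma pos: "z \<in> D \<Longrightarrow> 0 < \<rho> z"
proof -
  assume z: "z \<in> D"
  obtain \<rho>' where \<rho>': "\<forall>z\<in>D. 0 < \<rho>' z" "euclid_metric D F \<rho>'"
    using minimal by (auto simp: minimal_in_S3_def)
  then have "pd 1 F z \<bullet> pd 1 F z = \<rho>' z * (1 \<bullet> (1::complex))" using z by (auto simp: euclid_metric_def)
  then show ?thesis using \<rho>'(1) z inner_pd_F[OF z, of 1 1] by simp
qed

lemma unit: "z \<in> D \<Longrightarrow> F z \<bullet> F z = 1" "z \<in> D \<Longrightarrow> N z \<bullet> N z = 1" "z \<in> D \<Longrightarrow> N z \<bullet> F z = 0"
  and normal: "z \<in> D \<Longrightarrow> N z \<bullet> pd v F z = 0"
  using minimal by (auto simp: minimal_in_S3_def norm_eq_1)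

lemma pd_F_F: "z \<in> D \<Longrightarrow> pd v F z \<bullet> F z = 0"
  and pd_N_N: "z \<in> D \<Longrightarrow> pd v N z \<bullet> N z = 0"
  and pd_N_F: "z \<in> D \<Longrightarrow> pd v N z \<bullet> F z = 0"
  using bilinear_const_pd[OF bounded_bilinear_inner open_D _ unit(1) differentiable(1) differentiable(1), of z v]
    bilinear_const_pd[OF bounded_bilinear_inner open_D _ unit(2) differentiable(2) differentiable(2), of z v]
    bilinear_const_pd[OF bounded_bilinear_inner open_D _ unit(3) differentiable(2) differentiable(1), of z v]
  by (simp_all add: normal inner_commute)

text \<open>The Weingarten relation. Symmetry of second derivatives then makes the shape operator
  self-adjoint, and minimality makes it trace-free.\<close>

lemma shape: "z \<in> D \<Longrightarrow> pd v N z \<bullet> pd w F z = - (N z \<bullet> pd v (pd w F) z)"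
  using bilinear_const_pd[OF bounded_bilinear_inner open_D _ normal differentiable(2) differentiable_pd(1), of z v w]
  by (simp add: add_eq_0_iff)

lemma shape_commute: "z \<in> D \<Longrightarrow> pd v N z \<bullet> pd w F z = pd v F z \<bullet> pd w N z"
  by (simp add: shape inner_commute[of "pd v F z"] pd_commute[OF open_D _ smooth(1), of z v w])

lemma laplacian_N:
  assumes z: "z \<in> D"
  shows "laplacian F z \<bullet> N z = 0"
proof -
  have "pd 1 F z \<noteq> 0" using inner_pd_F[OF z, of 1 1] pos[OF z] by auto
  moreover have "mean_curv_S3 F z = 0" using minimal z by (simp add: minimal_in_S3_def)
  ultimately have "orth_proj {n. n \<bullet> F z = 0 \<and> (\<forall>v. n \<bullet> pd v F z = 0)} (laplacian F z) = 0"
    by (simp add: mean_curv_S3_def laplacian_def)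
  then show ?thesis
    unfolding orth_proj_eq_0_iff[OF subspace_normal_S3] using unit(3)[OF z] normal[OF z] by blast
qed

lemma trace: "z \<in> D \<Longrightarrow> pd 1 F z \<bullet> pd 1 N z + pd \<i> F z \<bullet> pd \<i> N z = 0"
  using laplacian_N[of z] shape[of z 1 1] shape[of z \<i> \<i>]
  by (simp add: laplacian_def inner_add_left inner_add_right inner_commute)

text \<open>The derivatives of \<open>N\<close> are orthogonal to both \<open>F\<close> and
  \<open>N\<close>, so they are tangent to the surface and expand in its orthogonal coordinate
  frame.\<close>

lemma pd_N_eq:
  assumes z: "z \<in> D"
  shows "\<rho> z *\<^sub>R pd v N z = (pd v N z \<bullet> pd 1 F z) *\<^sub>R pd 1 F z + (pd v N z \<bullet> pd \<i> F z) *\<^sub>R pd \<i> F z"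
proof -
  have nz: "pd v F z \<noteq> 0" if "v \<noteq> 0" for v using inner_pd_F[OF z, of v v] pos[OF z] that by auto
  have F: "F z \<bullet> N z = 0" "F z \<bullet> pd v F z = 0" "pd v F z \<bullet> N z = 0" for v
    using unit(3)[OF z] pd_F_F[OF z] normal[OF z] by (simp_all add: inner_commute)
  have "\<rho> z *\<^sub>R pd v N z - (pd v N z \<bullet> pd 1 F z) *\<^sub>R pd 1 F z - (pd v N z \<bullet> pd \<i> F z) *\<^sub>R pd \<i> F z = 0"
    by (rule real_basis_zero[of "F z" "N z" "pd 1 F z" "pd \<i> F z"])
      (use z nz unit[OF z] in \<open>auto simp: inner_diff_left pd_F_F pd_N_N pd_N_F normal inner_pd_F F\<close>)
  then show ?thesis by (simp add: algebra_simps)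
qed

text \<open>A symmetric trace-free 2 by 2 matrix with first row \<open>p\<close>, \<open>q\<close>
  squares to \<open>p\<^sup>2 + q\<^sup>2\<close> times the identity; hence \<open>N\<close> is
  conformal wherever it is immersed.\<close>

lemma inner_pd_N:
  assumes z: "z \<in> D"
  shows "\<rho> z * (pd v N z \<bullet> pd w N z)
    = ((pd 1 F z \<bullet> pd 1 N z)\<^sup>2 + (pd 1 F z \<bullet> pd \<i> N z)\<^sup>2) * (v \<bullet> w)"
proof -
  have d: "pd v N z = Re v *\<^sub>R pd 1 N z + Im v *\<^sub>R pd \<i> N z" for v
    by (rule pd_decomp[OF differentiable(2)[OF z]])
  define p q where "p = pd 1 F z \<bullet> pd 1 N z" and "q = pd 1 F z \<bullet> pd \<i> N z"
  have pq: "pd 1 N z \<bullet> pd 1 F z = p" "pd \<i> N z \<bullet> pd 1 F z = q" "pd 1 N z \<bullet> pd \<i> F z = q" "pd \<i> N z \<bullet> pd \<i> F z = - p"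
    using trace[OF z] shape_commute[OF z, of 1 \<i>] by (simp_all add: p_def q_def inner_commute)
  have N: "\<rho> z * (pd v N z \<bullet> pd w N z) = (pd v N z \<bullet> pd 1 F z) * (pd w N z \<bullet> pd 1 F z) + (pd v N z \<bullet> pd \<i> F z) * (pd w N z \<bullet> pd \<i> F z)"
  proof -
    have "\<rho> z * (pd v N z \<bullet> pd w N z) = (\<rho> z *\<^sub>R pd v N z) \<bullet> pd w N z" by simp
    then show ?thesis unfolding pd_N_eq[OF z, of v] by (simp add: inner_add_left inner_add_right inner_commute[of _ "pd w N z"])
  qed
  show ?thesis
    unfolding N unfolding d[of v] d[of w] p_def[symmetric] q_def[symmetric]
    by (simp add: inner_add_left pq inner_complex_def power2_eq_square algebra_simps)
qed

text \<open>Differentiating the symmetry and the vanishing trace of the shape operator; the terms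
  with a mixed second derivative of \<open>N\<close> cancel. The difference of the two sides is, up
  to a factor, the imaginary part of the product of the Laplacian of the lift with its
  derivative.\<close>

lemma codazzi:
  assumes z: "z \<in> D"
  shows "laplacian N z \<bullet> pd v F z = laplacian F z \<bullet> pd v N z"
proof -
  define p q where "p = pd 1 F z \<bullet> pd 1 N z" and "q = pd 1 F z \<bullet> pd \<i> N z"
  have pq: "pd 1 N z \<bullet> pd 1 F z = p" "pd \<i> N z \<bullet> pd 1 F z = q" "pd 1 N z \<bullet> pd \<i> F z = q" "pd \<i> N z \<bullet> pd \<i> F z = - p"
    using trace[OF z] shape_commute[OF z, of 1 \<i>] by (simp_all add: p_def q_def inner_commute)
  note dF = differentiable_pd(1)[OF z] and dN = differentiable_pd(2)[OF z]
  have swap: "pd \<i> (pd 1 F) z = pd 1 (pd \<i> F) z" "pd \<i> (pd 1 N) z = pd 1 (pd \<i> N) z"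
    by (rule pd_commute[OF open_D z], fact smooth)+
  note c = conformal_second_derivatives[OF open_D z smooth(1) inner_pd_F]
  have d: "pd a (\<lambda>z. pd b N z \<bullet> pd c F z) z = pd b N z \<bullet> pd a (pd c F) z + pd a (pd b N) z \<bullet> pd c F z" for a b c
    by (rule pd_bilinear[OF bounded_bilinear_inner dN dF])
  have sh: "pd a (\<lambda>z. pd 1 N z \<bullet> pd \<i> F z) z = pd a (\<lambda>z. pd \<i> N z \<bullet> pd 1 F z) z" for a
    by (rule pd_cong_open[OF open_D z]) (metis shape_commute inner_commute)
  have tr: "pd a (\<lambda>z. pd 1 N z \<bullet> pd 1 F z) z = - pd a (\<lambda>z. pd \<i> N z \<bullet> pd \<i> F z) z" for a
  proof -
    have "pd a (\<lambda>z. pd 1 N z \<bullet> pd 1 F z) z = pd a (\<lambda>z. - (pd \<i> N z \<bullet> pd \<i> F z)) z"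
      by (rule pd_cong_open[OF open_D z]) (use trace in \<open>simp add: inner_commute add_eq_0_iff\<close>)
    also have "\<dots> = - pd a (\<lambda>z. pd \<i> N z \<bullet> pd \<i> F z) z"
      by (rule pd_bounded_linear[OF bounded_linear_minus[OF bounded_linear_ident]
            differentiable_bilinear[OF bounded_bilinear_inner dN dF]])
    finally show ?thesis .
  qed
  have N1: "\<rho> z * (pd a N z \<bullet> x) = (pd a N z \<bullet> pd 1 F z) * (pd 1 F z \<bullet> x) + (pd a N z \<bullet> pd \<i> F z) * (pd \<i> F z \<bullet> x)" for a x
  proof -
    have "\<rho> z * (pd a N z \<bullet> x) = (\<rho> z *\<^sub>R pd a N z) \<bullet> x" by simp
    then show ?thesis unfolding pd_N_eq[OF z, of a] by (simp add: inner_add_left)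
  qed
  \<comment> \<open>Expanding the derivatives of \<open>N\<close> in the tangent frame leaves only
    tangential second derivatives of \<open>F\<close>, which cancel by conformality.\<close>
  have z1: "\<rho> z * (pd 1 N z \<bullet> pd 1 (pd 1 F) z + pd \<i> N z \<bullet> pd 1 (pd \<i> F) z) = 0"
    unfolding distrib_left N1 pq using c by (simp add: inner_commute)
  have z2: "\<rho> z * (pd 1 N z \<bullet> pd 1 (pd \<i> F) z + pd \<i> N z \<bullet> pd \<i> (pd \<i> F) z) = 0"
    unfolding distrib_left N1 pq using c by (simp add: inner_commute)
  have z12: "pd 1 N z \<bullet> pd 1 (pd 1 F) z + pd \<i> N z \<bullet> pd 1 (pd \<i> F) z = 0"
    "pd 1 N z \<bullet> pd 1 (pd \<i> F) z + pd \<i> N z \<bullet> pd \<i> (pd \<i> F) z = 0"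
    using z1 z2 pos[OF z] by simp_all
  have "laplacian N z \<bullet> pd 1 F z = laplacian F z \<bullet> pd 1 N z"
    using sh[of \<i>] tr[of 1] z12(1) unfolding d swap laplacian_def inner_add_left
    by (simp add: inner_commute)
  moreover have "laplacian N z \<bullet> pd \<i> F z = laplacian F z \<bullet> pd \<i> N z"
    using sh[of 1] tr[of \<i>] z12(2) unfolding d swap laplacian_def inner_add_left
    by (simp add: inner_commute)
  ultimately show ?thesis
    using pd_decomp[OF differentiable(1)[OF z], of v] pd_decomp[OF differentiable(2)[OF z], of v]
    by (simp add: inner_add_right)
qed

definition hopf :: "complex \<Rightarrow> complex" where
  "hopf z = cbil (dz (dz (\<lambda>z. cvec (F z))) z) (cvec (N z))"

definition lift :: "complex \<Rightarrow> complex^4" where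
  "lift z = cpx (F z) (N z)"

lemma hopf_eq:
  assumes z: "z \<in> D"
  shows "hopf z = Complex (- (pd 1 F z \<bullet> pd 1 N z) / 2) ((pd 1 F z \<bullet> pd \<i> N z) / 2)"
proof -
  have "hopf z = - cbil (dz (\<lambda>z. cvec (F z)) z) (dz (\<lambda>z. cvec (N z)) z)"
    unfolding hopf_def
    by (rule cbil_dz_dz[OF open_D z smooth_on_cvec[OF open_D smooth(1)]
          differentiable_bounded_linear[OF bounded_linear_cvec differentiable(2)[OF z]]])
      (use normal in \<open>simp add: pd_cvec differentiable cbil_cvec inner_commute\<close>)
  then show ?thesis
    using trace[OF z] shape_commute[OF z, of 1 \<i>]
    by (simp add: cbil_dz_cvec differentiable z complex_eq_iff inner_commute)
qed

text \<open>In the notation of \<open>codazzi\<close>, \<open>(cmod (hopf z))\<^sup>2\<close> is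
  \<open>(p\<^sup>2 + q\<^sup>2) / 4\<close>, whence the factor 4.\<close>

lemma inner_pd_N_hopf:
  assumes z: "z \<in> D"
  shows "pd v N z \<bullet> pd w N z = 4 * (cmod (hopf z))\<^sup>2 / \<rho> z * (v \<bullet> w)"
  using inner_pd_N[OF z, of v w] pos[OF z]
  by (simp add: hopf_eq[OF z] cmod_power2 power_divide field_simps)

lemma pd_lift: "z \<in> D \<Longrightarrow> pd v lift z = cpx (pd v F z) (pd v N z)"
  unfolding lift_def[abs_def] by (rule pd_cpx[OF differentiable])

text \<open>The coefficient is the mean of those of \<open>F\<close> and \<open>N\<close>, because
  the squared factor of the lift is 1/2. The Lagrangian condition is the self-adjointness of the
  shape operator.\<close>

lemma lagrangian_lift: "lagrangian_lift D lift (\<lambda>z. (\<rho> z + 4 * (cmod (hopf z))\<^sup>2 / \<rho> z) / 2)"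
proof
  show "open D" by (rule open_D)
  show "smooth_on D lift" unfolding lift_def[abs_def] by (rule smooth_on_cpx[OF open_D smooth])
  fix z assume z: "z \<in> D"
  have "herm (lift z) (lift z) = 1"
    using z by (simp add: lift_def herm_cpx unit inner_commute complex_eq_iff)
  then show "norm (lift z) = 1" by (simp add: herm_self norm_eq_1)
  show "cbil (lift z) (lift z) = 0"
    using unit[OF z] by (simp add: lift_def cbil_cpx inner_commute complex_eq_iff)
  show "0 < (\<rho> z + 4 * (cmod (hopf z))\<^sup>2 / \<rho> z) / 2"
    using pos[OF z] by (simp add: add_pos_nonneg)
  fix v
  show "herm (pd v lift z) (lift z) = 0"
    using z normal[OF z] by (simp add: pd_lift lift_def herm_cpx pd_F_F pd_N_N pd_N_F
        inner_commute[of "pd v F z" "N z"] complex_eq_iff)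
  fix w
  show "herm (pd v lift z) (pd w lift z) = complex_of_real ((\<rho> z + 4 * (cmod (hopf z))\<^sup>2 / \<rho> z) / 2 * (v \<bullet> w))"
    using z by (simp add: pd_lift herm_cpx inner_pd_F inner_pd_N_hopf shape_commute complex_eq_iff algebra_simps)
qed

lemma laplacian_lift:
  assumes z: "z \<in> D"
  shows "herm (laplacian lift z) (pd v lift z) = 0"
proof -
  interpret L: lagrangian_lift D lift "\<lambda>z. (\<rho> z + 4 * (cmod (hopf z))\<^sup>2 / \<rho> z) / 2"
    by (rule lagrangian_lift)
  have "laplacian lift z = cpx (laplacian F z) (laplacian N z)"
    unfolding lift_def[abs_def] by (rule laplacian_cpx[OF open_D z smooth])
  then have "Im (herm (laplacian lift z) (pd v lift z)) = 0"
    using codazzi[OF z, of v] by (simp add: pd_lift[OF z] herm_cpx)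
  then show ?thesis using L.Re_laplacian[OF z, of v] by (simp add: complex_eq_iff)
qed

text \<open>Since \<open>F\<close> and \<open>N\<close> are both conformal, only the mixed term \<i>
  \<langle>\<open>dz F\<close>, \<open>dz N\<close>\<rangle> survives, and the Hopf coefficient is
  minus that product.\<close>

lemma differential_lift: "z \<in> D \<Longrightarrow> cbil (dz lift z) (dz lift z) = - \<i> * hopf z"
  using trace[of z] shape_commute[of z 1 \<i>]
  by (simp add: cbil_dz pd_lift cbil_cpx inner_pd_F inner_pd_N_hopf hopf_eq complex_eq_iff inner_commute field_simps)

lemma holomorphic_hopf: "(\<lambda>z. - \<i> * hopf z) holomorphic_on D"
proof -
  interpret L: lagrangian_lift D lift "\<lambda>z. (\<rho> z + 4 * (cmod (hopf z))\<^sup>2 / \<rho> z) / 2"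
    by (rule lagrangian_lift)
  show ?thesis
    by (rule holomorphic_transform[OF L.holomorphic_differential[OF laplacian_lift]])
      (simp_all only: differential_lift)
qed

end

section \<open>Minimal Lagrangian lifts\<close>

lemma vcnj_cpx: "vcnj (cpx a b) = cpx a (- b)"
  by (simp add: cpx_def vcnj_def cvec_def vec_eq_iff)

lemma cpx_eq_iff: "cpx a b = cpx c d \<longleftrightarrow> a = c \<and> b = d"
  by (auto simp: cpx_def cvec_def vec_eq_iff complex_eq_iff)

lemma cpx_lincomb:
  "complex_of_real r *s cpx a b = cpx (r *\<^sub>R a) (r *\<^sub>R b)" "cpx a b + cpx c d = cpx (a + c) (b + d)"
  "cpx a b - cpx c d = cpx (a - c) (b - d)" "- cpx a b = cpx (- a) (- b)"
  by (simp_all add: cpx_def cvec_def vec_eq_iff algebra_simps add_divide_distrib diff_divide_distrib)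

text \<open>The normal space is taken inside the sphere, so it is orthogonal to the position
  vector.\<close>

lemma mean_curv_S3_eq_0:
  assumes "laplacian F z = r *\<^sub>R F z"
  shows "mean_curv_S3 F z = 0"
proof -
  have "orth_proj {n. n \<bullet> F z = 0 \<and> (\<forall>v. n \<bullet> pd v F z = 0)} (laplacian F z) = 0"
    unfolding orth_proj_eq_0_iff[OF subspace_normal_S3] assms by (auto simp: inner_commute[of "F z"])
  then show ?thesis by (simp add: mean_curv_S3_def laplacian_def)
qed

lemma euclid_metricI:
  assumes "\<And>z. z \<in> D \<Longrightarrow> F differentiable at z"
    "\<And>z. z \<in> D \<Longrightarrow> pd 1 F z \<bullet> pd 1 F z = \<rho> z" "\<And>z. z \<in> D \<Longrightarrow> pd \<i> F z \<bullet> pd \<i> F z = \<rho> z"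
    "\<And>z. z \<in> D \<Longrightarrow> pd 1 F z \<bullet> pd \<i> F z = 0"
  shows "euclid_metric D F \<rho>"
  unfolding euclid_metric_def
proof (intro ballI allI)
  fix z v w assume z: "z \<in> D"
  note d = pd_decomp[OF assms(1)[OF z]]
  show "pd v F z \<bullet> pd w F z = \<rho> z * (v \<bullet> w)"
    unfolding d[of v] d[of w] using assms(2-)[OF z]
    by (simp add: inner_add_left inner_add_right inner_commute[of "pd \<i> F z" "pd 1 F z"] inner_complex_def algebra_simps)
qed

text \<open>One chart of the converse. The degenerate clause of the phase condition concerns all
  charts at once; it enters later, through the vanishing of \<open>Theta\<close>.\<close>

locale minimal_lift = lagrangian_lift D "\<lambda>z. cpx (F z) (N z)" \<rho>
  for D :: "complex set" and F N :: "complex \<Rightarrow> real^4" and \<rho> :: "complex \<Rightarrow> real" +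
  assumes smooth_F: "smooth_on D F" and smooth_N: "smooth_on D N"
    and laplacian_perp: "\<And>z v. z \<in> D \<Longrightarrow>
      herm (laplacian (\<lambda>z. cpx (F z) (N z)) z) (pd v (\<lambda>z. cpx (F z) (N z)) z) = 0"
    and real_nonneg: "\<And>z. z \<in> D \<Longrightarrow>
      cbil (dz (\<lambda>z. cpx (F z) (N z)) z) (dzb (\<lambda>z. cpx (F z) (N z)) z) \<in> \<real>\<^sub>\<ge>\<^sub>0"
begin

abbreviation "P \<equiv> \<lambda>z. cpx (F z) (N z)"

text \<open>\<open>a11\<close>, \<open>a12\<close>, \<open>a22\<close> are the \<alpha>, \<beta>,
  \<gamma> of the overview, and \<open>Theta\<close> is the obstruction to conformality of
  \<open>F\<close>.\<close>

definition a11 :: "complex \<Rightarrow> complex" where "a11 z = cbil (dz P z) (dz P z)"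
definition a12 :: "complex \<Rightarrow> complex" where "a12 z = cbil (dz P z) (dzb P z)"
definition a22 :: "complex \<Rightarrow> complex" where "a22 z = cbil (dzb P z) (dzb P z)"
definition Theta :: "complex \<Rightarrow> complex" where
  "Theta z = cbil (dz (\<lambda>z. cvec (F z)) z) (dz (\<lambda>z. cvec (F z)) z)"

lemma a12_real: "z \<in> D \<Longrightarrow> a12 z = complex_of_real (Re (a12 z))" "z \<in> D \<Longrightarrow> 0 \<le> Re (a12 z)"
  using real_nonneg[of z] unfolding a12_def[symmetric]
  by (auto simp: complex_nonneg_Reals_iff complex_eq_iff)

lemma norm_relation: "z \<in> D \<Longrightarrow> (cmod (a11 z))\<^sup>2 + (Re (a12 z))\<^sup>2 = (\<rho> z / 2)\<^sup>2"
proof -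
  assume z: "z \<in> D"
  have "cmod (a12 z) = Re (a12 z)" using a12_real[OF z] by (metis norm_of_real abs_of_nonneg)
  then show ?thesis using frame_relations(1)[OF z z z z z z z z z z] by (simp add: a11_def a12_def)
qed

text \<open>Nonnegativity selects the positive root; this is how the phase decides that
  \<open>F\<close> gets the larger metric and \<open>N\<close> the smaller one.\<close>

lemma a12_eq: "z \<in> D \<Longrightarrow> Re (a12 z) = sqrt ((\<rho> z / 2)\<^sup>2 - (cmod (a11 z))\<^sup>2)"
  using norm_relation[of z] a12_real(2)[of z] by (metis add_diff_cancel_left' real_sqrt_unique)

lemma a11_le: "z \<in> D \<Longrightarrow> cmod (a11 z) \<le> \<rho> z / 2"
proof -
  assume z: "z \<in> D"
  have le: "(cmod (a11 z))\<^sup>2 \<le> (\<rho> z / 2)\<^sup>2"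
    using norm_relation[OF z] zero_le_power2[of "Re (a12 z)"] by linarith
  show ?thesis by (rule power2_le_imp_le[OF le]) (use pos[OF z] in simp)
qed

lemma diff_F: "z \<in> D \<Longrightarrow> F differentiable at z" and diff_N: "z \<in> D \<Longrightarrow> N differentiable at z"
  by (rule smooth_on_differentiable[OF smooth_F open_D], assumption)
    (rule smooth_on_differentiable[OF smooth_N open_D])

lemma pd_P: "z \<in> D \<Longrightarrow> pd v P z = cpx (pd v F z) (pd v N z)"
  by (rule pd_cpx[OF diff_F diff_N])

lemma orthonormal:
  assumes z: "z \<in> D"
  shows "F z \<bullet> F z = 1" "N z \<bullet> N z = 1" "F z \<bullet> N z = 0" "norm (F z) = 1" "norm (N z) = 1"
  using herm_F[OF z] isotropic[OF z]
  by (simp_all add: herm_cpx cbil_cpx complex_eq_iff inner_commute norm_eq_1)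

lemma normal:
  assumes z: "z \<in> D"
  shows "pd v F z \<bullet> F z = 0" "pd v F z \<bullet> N z = 0" "pd v N z \<bullet> F z = 0" "pd v N z \<bullet> N z = 0"
    "F z \<bullet> pd v F z = 0" "N z \<bullet> pd v F z = 0" "F z \<bullet> pd v N z = 0" "N z \<bullet> pd v N z = 0"
  using horizontal[OF z, of v] tangent[OF z, of v]
  by (simp_all add: pd_P[OF z] herm_cpx cbil_cpx complex_eq_iff inner_commute)

lemma first_forms:
  assumes z: "z \<in> D"
  shows "pd v F z \<bullet> pd w F z + pd v N z \<bullet> pd w N z = 2 * \<rho> z * (v \<bullet> w)"
    "pd v N z \<bullet> pd w F z = pd v F z \<bullet> pd w N z"
  using metric[OF z, of v w] by (simp_all add: pd_P[OF z] herm_cpx complex_eq_iff)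

text \<open>Because \<beta> is real, the equation for \<open>P\<close> decouples: conjugation
  changes only the sign of \<open>N\<close>, so \<beta> enters the two multipliers with opposite
  signs.\<close>

lemma laplacian_F_N:
  assumes z: "z \<in> D"
  shows "laplacian F z = (- 2 * \<rho> z - 4 * Re (a12 z)) *\<^sub>R F z"
    and "laplacian N z = (- 2 * \<rho> z + 4 * Re (a12 z)) *\<^sub>R N z"
proof -
  have "cpx (laplacian F z) (laplacian N z) = laplacian P z"
    by (rule laplacian_cpx[OF open_D z smooth_F smooth_N, symmetric])
  also have "\<dots> = - (complex_of_real (2 * \<rho> z) *s P z) - complex_of_real (4 * Re (a12 z)) *s vcnj (P z)"
    using laplacian_eq[OF z laplacian_perp[OF z]] a12_real(1)[OF z] unfolding a12_def[symmetric] by simp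
  finally show "laplacian F z = (- 2 * \<rho> z - 4 * Re (a12 z)) *\<^sub>R F z"
    "laplacian N z = (- 2 * \<rho> z + 4 * Re (a12 z)) *\<^sub>R N z"
    unfolding vcnj_cpx cpx_lincomb cpx_eq_iff by (simp_all add: algebra_simps)
qed

lemma holomorphic_Theta: "Theta holomorphic_on D"
  unfolding Theta_def[abs_def]
proof (rule holomorphic_cbil_dz[OF open_D smooth_on_cvec[OF open_D smooth_F]])
  fix z v assume z: "z \<in> D"
  have "pd v (pd v (\<lambda>z. cvec (F z))) z = cvec (pd v (pd v F) z)" for v
  proof -
    have "pd v (pd v (\<lambda>z. cvec (F z))) z = pd v (\<lambda>z. cvec (pd v F z)) z"
      by (rule pd_cong_open[OF open_D z pd_cvec[OF diff_F]])
    then show ?thesis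
      using pd_cvec[OF smooth_on_differentiable[OF smooth_on_pd[OF smooth_F] open_D z]] by simp
  qed
  then have "laplacian (\<lambda>z. cvec (F z)) z = cvec (laplacian F z)"
    by (simp add: laplacian_def cvec_add)
  then show "cbil (laplacian (\<lambda>z. cvec (F z)) z) (pd v (\<lambda>z. cvec (F z)) z) = 0"
    by (simp add: pd_cvec diff_F z cbil_cvec laplacian_F_N normal)
qed

lemma Theta_eq:
  assumes z: "z \<in> D"
  shows "Theta z = Complex ((pd 1 F z \<bullet> pd 1 F z - pd \<i> F z \<bullet> pd \<i> F z) / 4) (- (pd 1 F z \<bullet> pd \<i> F z) / 2)"
  unfolding Theta_def by (simp add: cbil_dz_cvec diff_F z complex_eq_iff inner_commute)

text \<open>\<open>F\<close> is \<surd>2 times the real part of \<open>P\<close>, so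
  \<open>Theta\<close> is half the sum of \<alpha> and the conjugate of \<gamma>; the cross term
  vanishes because \<open>dz P\<close> and \<open>dzb P\<close> are Hermitian-orthogonal.\<close>

lemma a22_eq_cnj: "z \<in> D \<Longrightarrow> a22 z = - cnj (a11 z) \<longleftrightarrow> Theta z = 0"
proof -
  assume z: "z \<in> D"
  have N: "pd v N z \<bullet> pd w N z = 2 * \<rho> z * (v \<bullet> w) - pd v F z \<bullet> pd w F z" for v w
    using first_forms(1)[OF z, of v w] by simp
  have "a22 z + cnj (a11 z) = 2 * cnj (Theta z)"
    using first_forms(2)[OF z, of 1 \<i>]
    by (simp add: a22_def a11_def dz_def dzb_def cbil_simps pd_P[OF z] cbil_cpx Theta_eq[OF z] N
        complex_eq_iff inner_commute field_simps)
  then show ?thesis by (auto simp: add_eq_0_iff2[symmetric])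
qed

lemma Theta_eq_0: "z \<in> D \<Longrightarrow> a12 z \<noteq> 0 \<Longrightarrow> Theta z = 0"
proof -
  assume z: "z \<in> D" and nz: "a12 z \<noteq> 0"
  have "cnj (a12 z) = a12 z" using a12_real(1)[OF z] by (metis complex_cnj_complex_of_real)
  then have "a12 z * (cnj (a11 z) + a22 z) = 0"
    using frame_relations(2)[OF z z z z z z z z z z]
    unfolding a11_def[symmetric] a12_def[symmetric] a22_def[symmetric] by (simp add: algebra_simps)
  then show ?thesis using nz a22_eq_cnj[OF z] by (simp add: add_eq_0_iff)
qed

text \<open>The derivatives of \<open>N\<close> are orthogonal to \<open>F\<close>, so the vertical
  projection changes nothing and the first fundamental forms simply add.\<close>

lemma sasaki_eq: "z \<in> D \<Longrightarrow> sasaki (F z, N z) (pd v F z, pd v N z) (pd w F z, pd w N z) = 2 * \<rho> z * (v \<bullet> w)"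
  using first_forms(1)[of z v w] by (simp add: sasaki_def Let_def normal)

text \<open>The vanishing of \<open>Theta\<close> says that \<open>F\<close>, and therefore \<open>N\<close>, is conformal.\<close>

context
  assumes Theta: "\<And>z. z \<in> D \<Longrightarrow> Theta z = 0"
begin

lemma conformal_F:
  assumes z: "z \<in> D"
  shows "pd 1 F z \<bullet> pd 1 F z = \<rho> z + 2 * Re (a12 z)" "pd \<i> F z \<bullet> pd \<i> F z = \<rho> z + 2 * Re (a12 z)"
    "pd 1 F z \<bullet> pd \<i> F z = 0"
proof -
  have N: "pd v N z \<bullet> pd w N z = 2 * \<rho> z * (v \<bullet> w) - pd v F z \<bullet> pd w F z" for v w
    using first_forms(1)[OF z, of v w] by simp
  have c: "pd 1 F z \<bullet> pd 1 F z = pd \<i> F z \<bullet> pd \<i> F z" "pd 1 F z \<bullet> pd \<i> F z = 0"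
    using Theta[OF z] by (simp_all add: Theta_eq[OF z] complex_eq_iff)
  have "4 * Re (a12 z) = 2 * (pd 1 F z \<bullet> pd 1 F z) - 2 * \<rho> z"
    by (simp add: a12_def dz_def dzb_def cbil_simps pd_P[OF z] cbil_cpx N c complex_eq_iff inner_commute field_simps)
  then show "pd 1 F z \<bullet> pd 1 F z = \<rho> z + 2 * Re (a12 z)" "pd \<i> F z \<bullet> pd \<i> F z = \<rho> z + 2 * Re (a12 z)"
    "pd 1 F z \<bullet> pd \<i> F z = 0" using c by auto
qed

lemma metric_F: "euclid_metric D F (\<lambda>z. \<rho> z + 2 * Re (a12 z))"
  by (rule euclid_metricI[OF diff_F conformal_F])

lemma metric_N: "euclid_metric D N (\<lambda>z. \<rho> z - 2 * Re (a12 z))"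
proof (rule euclid_metricI[OF diff_N])
  fix z assume z: "z \<in> D"
  show "pd 1 N z \<bullet> pd 1 N z = \<rho> z - 2 * Re (a12 z)" "pd \<i> N z \<bullet> pd \<i> N z = \<rho> z - 2 * Re (a12 z)"
    "pd 1 N z \<bullet> pd \<i> N z = 0"
    using conformal_F[OF z] first_forms(1)[OF z, of 1 1] first_forms(1)[OF z, of \<i> \<i>] first_forms(1)[OF z, of 1 \<i>]
    by (simp_all add: inner_complex_def)
qed

lemma minimal_F: "minimal_in_S3 D F N"
  unfolding minimal_in_S3_def
proof (intro conjI ballI allI exI[of _ "\<lambda>z. \<rho> z + 2 * Re (a12 z)"])
  fix z assume z: "z \<in> D"
  show "0 < \<rho> z + 2 * Re (a12 z)" using pos[OF z] a12_real(2)[OF z] by simp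
  show "mean_curv_S3 F z = 0" by (rule mean_curv_S3_eq_0[OF laplacian_F_N(1)[OF z]])
qed (use smooth_F smooth_N orthonormal normal metric_F in \<open>simp_all add: inner_commute\<close>)

text \<open>At a zero of \<open>a11\<close> the norm relation gives \<beta> = \<rho> / 2, and the
  coefficient \<rho> - 2 \<beta> of \<open>N\<close> vanishes: these are the branch points of
  \<open>N\<close>.\<close>

lemma minimal_N:
  assumes D': "D' \<subseteq> D" and nz: "\<And>z. z \<in> D' \<Longrightarrow> a11 z \<noteq> 0"
  shows "minimal_in_S3 D' N F"
  unfolding minimal_in_S3_def
proof (intro conjI ballI allI exI[of _ "\<lambda>z. \<rho> z - 2 * Re (a12 z)"])
  show "smooth_on D' N" "smooth_on D' F" using smooth_on_subset D' smooth_F smooth_N by blast+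
  show "euclid_metric D' N (\<lambda>z. \<rho> z - 2 * Re (a12 z))"
    using metric_N D' by (auto simp: euclid_metric_def)
  fix z assume z': "z \<in> D'"
  then have z: "z \<in> D" using D' by auto
  have "0 < (cmod (a11 z))\<^sup>2" using nz[OF z'] by simp
  then have less: "(Re (a12 z))\<^sup>2 < (\<rho> z / 2)\<^sup>2" using norm_relation[OF z] by linarith
  have "Re (a12 z) < \<rho> z / 2" by (rule power2_less_imp_less[OF less]) (use pos[OF z] in simp)
  then show "0 < \<rho> z - 2 * Re (a12 z)" by simp
  show "mean_curv_S3 N z = 0" by (rule mean_curv_S3_eq_0[OF laplacian_F_N(2)[OF z]])
  show "norm (N z) = 1" "norm (F z) = 1" "F z \<bullet> N z = 0" using orthonormal[OF z] by auto
  show "F z \<bullet> pd v N z = 0" for v using normal[OF z] by auto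
qed

text \<open>Both Hopf coefficients equal minus \<langle>\<open>dz F\<close>,
  \<open>dz N\<close>\<rangle>, which is symmetric in the two maps.\<close>

lemma hopf:
  assumes z: "z \<in> D"
  shows "cbil (dz (dz (\<lambda>z. cvec (F z))) z) (cvec (N z)) = \<i> * a11 z"
    and "cbil (dz (dz (\<lambda>z. cvec (N z))) z) (cvec (F z)) = \<i> * a11 z"
proof -
  have N: "pd v N z \<bullet> pd w N z = 2 * \<rho> z * (v \<bullet> w) - pd v F z \<bullet> pd w F z" for v w
    using first_forms(1)[OF z, of v w] by simp
  have "pd \<i> F z \<bullet> pd 1 F z = 0" using conformal_F(3)[OF z] by (simp add: inner_commute)
  then have "a11 z = Complex ((pd 1 F z \<bullet> pd \<i> N z + pd \<i> F z \<bullet> pd 1 N z) / 4)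
      ((pd 1 F z \<bullet> pd 1 N z - pd \<i> F z \<bullet> pd \<i> N z) / 4)"
    using first_forms(2)[OF z, of 1 \<i>]
    by (simp add: a11_def cbil_dz pd_P[OF z] cbil_cpx N conformal_F[OF z] complex_eq_iff
        inner_commute field_simps)
  then have eq: "- cbil (dz (\<lambda>z. cvec (F z)) z) (dz (\<lambda>z. cvec (N z)) z) = \<i> * a11 z"
    unfolding cbil_dz_cvec[OF diff_F[OF z] diff_N[OF z]] by (simp add: complex_eq_iff field_simps)
  show "cbil (dz (dz (\<lambda>z. cvec (F z))) z) (cvec (N z)) = \<i> * a11 z"
    unfolding eq[symmetric]
    by (rule cbil_dz_dz[OF open_D z smooth_on_cvec[OF open_D smooth_F]
          differentiable_bounded_linear[OF bounded_linear_cvec diff_N[OF z]]])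
      (simp add: pd_cvec diff_F cbil_cvec normal)
  show "cbil (dz (dz (\<lambda>z. cvec (N z))) z) (cvec (F z)) = \<i> * a11 z"
    unfolding eq[symmetric] cbil_commute[of "dz (\<lambda>z. cvec (F z)) z"]
    by (rule cbil_dz_dz[OF open_D z smooth_on_cvec[OF open_D smooth_N]
          differentiable_bounded_linear[OF bounded_linear_cvec diff_F[OF z]]])
      (simp add: pd_cvec diff_N cbil_cvec normal)
qed

end

lemma phase_sign:
  fixes F' N' :: "complex \<Rightarrow> real^4"
  defines "G \<equiv> \<lambda>z. cpx (F' z) (N' z)"
  assumes F': "smooth_on D F'" and N': "smooth_on D N'"
    and on: "\<And>z. z \<in> D \<Longrightarrow> (F' z, N' z) \<in> US3"
    and lift: "lift_on D f G" and f: "\<And>z. z \<in> D \<Longrightarrow> f z = cline (P z)"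
    and sas: "\<And>z v. z \<in> D \<Longrightarrow> sasaki (F' z, N' z) (pd v F' z, pd v N' z) (pd v F' z, pd v N' z) = 2 * \<rho> z * (v \<bullet> v)"
    and nonneg: "\<And>z. z \<in> D \<Longrightarrow> cbil (dz G z) (dzb G z) \<in> \<real>\<^sub>\<ge>\<^sub>0"
    and same: "\<And>z. z \<in> D \<Longrightarrow> cbil (dz G z) (dz G z) = a11 z"
    and z: "z \<in> D"
  shows "herm (G z) (P z) = 1 \<or> herm (G z) (P z) = - 1"
    "G z = herm (G z) (P z) *s P z" "(\<lambda>z. herm (G z) (P z)) differentiable at z"
proof -
  note ctx = order_refl lift f
  define a where "a = phase G"
  have a_eq: "a z = herm (G z) (P z)" for z by (simp add: a_def phase_def[OF ctx])
  have Geq: "G z = a z *s P z" unfolding a_def by (rule lift_eq_phase[OF ctx z])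
  have a1: "a z * cnj (a z) = 1" unfolding a_def by (rule phase_cnj[OF ctx z])
  have "a differentiable at z" unfolding a_def by (rule differentiable_phase[OF ctx z])
  then show "(\<lambda>z. herm (G z) (P z)) differentiable at z" by (simp add: a_eq[abs_def])
  show "G z = herm (G z) (P z) *s P z" using Geq by (simp add: a_eq)
  have dF': "F' differentiable at z" and dN': "N' differentiable at z"
    using F' N' open_D z smooth_on_differentiable by blast+
  have pdG: "pd v G z = cpx (pd v F' z) (pd v N' z)" for v
    unfolding G_def by (rule pd_cpx[OF dF' dN'])
  have pdG': "pd v G z = a z *s pd v P z + pd v a z *s P z" for v
    unfolding a_def by (rule pd_lift[OF ctx z])
  have unit: "F' w \<bullet> F' w = 1" "N' w \<bullet> N' w = 1" "N' w \<bullet> F' w = 0" if "w \<in> D" for w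
    using on[OF that] by (auto simp: US3_def norm_eq_1 inner_commute)
  have "complex_of_real ((cmod (a z))\<^sup>2) = complex_of_real 1"
    unfolding complex_norm_square a1 by simp
  then have norm_a: "cmod (a z) = 1"
    unfolding of_real_eq_iff power2_eq_1_iff using norm_ge_zero[of "a z"] by linarith
  \<comment> \<open>With \<theta> the component of the derivative of \<open>N'\<close> along
    \<open>F'\<close>, the derivative of \<open>a\<close> has modulus \<bar>\<theta>\<bar> and
    raises the sum of the first forms by \<open>2 * \<theta>\<^sup>2\<close>. The vertical
    projection removes only one \<open>\<theta>\<^sup>2\<close>, so the prescribed Sasaki metric
    forces \<theta> = 0.\<close>
  have a0: "pd v a z = 0" for v
  proof -
    define \<theta> where "\<theta> = pd v N' z \<bullet> F' z"
    have o: "pd v F' z \<bullet> F' z = 0" "pd v N' z \<bullet> N' z = 0" "pd v F' z \<bullet> N' z = - \<theta>"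
      using bilinear_const_pd[OF bounded_bilinear_inner open_D z unit(1) dF' dF', of v]
        bilinear_const_pd[OF bounded_bilinear_inner open_D z unit(2) dN' dN', of v]
        bilinear_const_pd[OF bounded_bilinear_inner open_D z unit(3) dN' dF', of v]
      by (simp_all add: inner_commute \<theta>_def add_eq_0_iff)
    have "pd v a z * cnj (a z) = herm (pd v G z) (G z)"
      using horizontal[OF z] herm_F[OF z] unfolding pdG' Geq by (simp add: cbil_simps)
    also have "\<dots> = \<i> * \<theta>" unfolding pdG by (simp add: G_def herm_cpx o \<theta>_def complex_eq_iff)
    finally have th: "pd v a z * cnj (a z) = \<i> * \<theta>" .
    have "cmod (pd v a z) = \<bar>\<theta>\<bar>" using arg_cong[OF th, of cmod] norm_a by (simp add: norm_mult)
    then have sq: "pd v a z * cnj (pd v a z) = complex_of_real (\<theta>\<^sup>2)"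
      by (simp add: complex_norm_square[symmetric])
    have "herm (pd v G z) (pd v G z) = (a z * cnj (a z)) * herm (pd v P z) (pd v P z) + pd v a z * cnj (pd v a z)"
      using horizontal[OF z] horizontal'[OF z] herm_F[OF z] unfolding pdG' by (simp add: cbil_simps)
    also have "\<dots> = complex_of_real (\<rho> z * (v \<bullet> v) + \<theta>\<^sup>2)" unfolding a1 sq using metric[OF z] by simp
    finally have "pd v F' z \<bullet> pd v F' z + pd v N' z \<bullet> pd v N' z = 2 * (\<rho> z * (v \<bullet> v) + \<theta>\<^sup>2)"
      unfolding pdG herm_cpx by (simp add: complex_eq_iff)
    moreover have "pd v F' z \<bullet> pd v F' z + pd v N' z \<bullet> pd v N' z - \<theta>\<^sup>2 = 2 * \<rho> z * (v \<bullet> v)"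
      using sas[OF z, of v] unit(1)[OF z]
      by (simp add: sasaki_def Let_def inner_diff_left inner_diff_right \<theta>_def power2_eq_square inner_commute)
    ultimately have "\<theta>\<^sup>2 = 0" by (simp add: algebra_simps)
    then show ?thesis using \<open>cmod (pd v a z) = \<bar>\<theta>\<bar>\<close> by simp
  qed
  have pdG: "pd v G z = a z *s pd v P z" for v using pdG'[of v] a0[of v] by simp
  have dG: "dz G z = a z *s dz P z" "dzb G z = a z *s dzb P z"
    unfolding dz_def dzb_def pdG by (simp_all add: vec_eq_iff algebra_simps)
  \<comment> \<open>Where \<open>a11\<close> is nonzero the prescribed differential fixes the square
    of \<open>a\<close>; where it is zero, \<beta> is positive and the phase condition does.\<close>
  have sq: "(a z)\<^sup>2 = 1"
  proof (cases "a11 z = 0")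
    case False
    then show ?thesis using same[OF z] unfolding dG
      by (simp add: cbil_simps a11_def[symmetric] power2_eq_square)
  next
    case True
    then have "(Re (a12 z))\<^sup>2 = (\<rho> z / 2)\<^sup>2" using norm_relation[OF z] by simp
    then have b: "Re (a12 z) > 0" using pos[OF z] a12_real(2)[OF z] by (cases "Re (a12 z) = 0") auto
    have "(a z)\<^sup>2 * a12 z \<in> \<real>\<^sub>\<ge>\<^sub>0"
      using nonneg[OF z] unfolding dG by (simp add: cbil_simps a12_def power2_eq_square mult.assoc)
    then have "(a z)\<^sup>2 * complex_of_real (Re (a12 z)) \<in> \<real>\<^sub>\<ge>\<^sub>0" using a12_real(1)[OF z] by simp
    then have "Re ((a z)\<^sup>2) \<ge> 0" "Im ((a z)\<^sup>2) = 0"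
      using b by (auto simp: complex_nonneg_Reals_iff zero_le_mult_iff)
    moreover have "cmod ((a z)\<^sup>2) = 1"
      using norm_a by (simp add: norm_power)
    ultimately show ?thesis by (simp add: cmod_def complex_eq_iff)
  qed
  then show "herm (G z) (P z) = 1 \<or> herm (G z) (P z) = - 1"
    unfolding a_eq[symmetric] by (simp add: power2_eq_1_iff)
qed

end

section \<open>Charts\<close>

lemma chart_facts:
  assumes "riemann_surface M A" "c \<in> A"
  shows "openin M (fst c)" "open (snd c ` fst c)" "inj_on (snd c) (fst c)"
    "homeomorphic_map (subtopology M (fst c)) (top_of_set (snd c ` fst c)) (snd c)"
proof -
  obtain U \<phi> where c: "c = (U, \<phi>)" by (cases c)
  have *: "openin M U \<and> open (\<phi> ` U) \<and> homeomorphic_map (subtopology M U) (top_of_set (\<phi> ` U)) \<phi>"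
    using assms unfolding riemann_surface_def c by blast
  then show "openin M (fst c)" "open (snd c ` fst c)"
    and h: "homeomorphic_map (subtopology M (fst c)) (top_of_set (snd c ` fst c)) (snd c)" by (auto simp: c)
  have "topspace (subtopology M (fst c)) = fst c"
    using * openin_subset[of M U] by (auto simp: c)
  then show "inj_on (snd c) (fst c)"
    using homeomorphic_imp_injective_map[OF h] by simp
qed

lemma loc_chart:
  assumes "riemann_surface M A" "c \<in> A" "p \<in> fst c"
  shows "loc c F (snd c p) = F p"
  using chart_facts(3)[OF assms(1,2)] assms(3) by (simp add: loc_def)

lemma open_cdom:
  assumes "riemann_surface M A" "c \<in> A" "openin M V"
  shows "open (cdom c V)"
proof -
  have "openin (subtopology M (fst c)) (fst c \<inter> V)"
    using assms(3) by (auto simp: openin_subtopology)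
  then have "openin (top_of_set (snd c ` fst c)) (snd c ` (fst c \<inter> V))"
    using homeomorphic_imp_open_map[OF chart_facts(4)[OF assms(1,2)]] by (auto simp: open_map_def)
  then show ?thesis
    unfolding cdom_def using chart_facts(2)[OF assms(1,2)] openin_open_trans by blast
qed

lemma openin_chart_preimage:
  assumes "riemann_surface M A" "c \<in> A" "open B"
  shows "openin M {q \<in> fst c. snd c q \<in> B}"
proof -
  note c = chart_facts[OF assms(1,2)]
  have "continuous_map (subtopology M (fst c)) (top_of_set (snd c ` fst c)) (snd c)"
    by (rule homeomorphic_imp_continuous_map[OF c(4)])
  then have "continuous_map (subtopology M (fst c)) euclidean (snd c)"
    using continuous_map_in_subtopology by blast
  then have "openin (subtopology M (fst c)) {q \<in> topspace (subtopology M (fst c)). snd c q \<in> B}"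
    using assms(3) by (simp add: continuous_map)
  moreover have "topspace (subtopology M (fst c)) = fst c" using openin_subset[OF c(1)] by auto
  ultimately show ?thesis using openin_trans_full c(1) by fastforce
qed

lemma mem_cdom:
  assumes "riemann_surface M A" "c \<in> A" "p \<in> fst c"
  shows "snd c p \<in> cdom c V \<longleftrightarrow> p \<in> V"
  using chart_facts(3)[OF assms(1,2)] assms(3) by (auto simp: cdom_def inj_on_def)

lemma cdomE:
  assumes "z \<in> cdom c V"
  obtains p where "p \<in> fst c" "p \<in> V" "z = snd c p"
  using assms by (auto simp: cdom_def)

lemma chart_at:
  assumes "riemann_surface M A" "p \<in> topspace M"
  obtains c where "c \<in> A" "p \<in> fst c"
  using assms unfolding riemann_surface_def by blast

lemma transition_derivative:
  assumes M: "riemann_surface M A" "c \<in> A" "c' \<in> A" "openin M V" and p: "p \<in> fst c" "p \<in> fst c'" "p \<in> V"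
  obtains \<tau> t W where "(\<tau> has_field_derivative t) (at (snd c p))" "\<tau> (snd c p) = snd c' p"
    "open W" "snd c p \<in> W" "\<And>F :: 'a \<Rightarrow> 'b. \<And>z. z \<in> W \<Longrightarrow> loc c F z = loc c' F (\<tau> z)"
proof -
  let ?\<tau> = "snd c' \<circ> inv_into (fst c) (snd c)"
  let ?W = "cdom c (fst c')"
  have op: "open ?W" by (rule open_cdom[OF M(1,2) chart_facts(1)[OF M(1,3)]])
  have hol: "?\<tau> holomorphic_on ?W"
  proof -
    obtain U \<phi> where c: "c = (U, \<phi>)" by (cases c)
    obtain U' \<phi>' where c': "c' = (U', \<phi>')" by (cases c')
    have "(\<phi>' \<circ> inv_into U \<phi>) holomorphic_on \<phi> ` (U \<inter> U')"
      using M(1-3) unfolding riemann_surface_def c c' by blast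
    then show ?thesis by (simp add: c c' cdom_def)
  qed
  have inv: "inv_into (fst c) (snd c) (snd c q) = q" if "q \<in> fst c" for q
    using chart_facts(3)[OF M(1,2)] that by simp
  have pW: "snd c p \<in> ?W" using p by (auto simp: cdom_def)
  obtain t where t: "(?\<tau> has_field_derivative t) (at (snd c p))"
    using hol op pW by (auto simp: holomorphic_on_open)
  have eq: "loc c F z = loc c' F (?\<tau> z)" if zW: "z \<in> ?W" for F :: "'a \<Rightarrow> 'b" and z
  proof -
    obtain q where q: "q \<in> fst c" "q \<in> fst c'" "z = snd c q" using cdomE[OF zW] by blast
    then show ?thesis using loc_chart[OF M(1,2) q(1), of F] loc_chart[OF M(1,3) q(2), of F] inv by simp
  qed
  show ?thesis by (rule that[OF t _ op pW eq]) (simp add: inv p)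
qed

text \<open>Holomorphy of \<open>\<tau>\<close> excludes a term with \<open>dzb G\<close>, so the
  derivative is only rescaled.\<close>

lemma dz_chain:
  assumes "(\<tau> has_field_derivative t) (at z)" "G differentiable at (\<tau> z)"
  shows "dz (\<lambda>w. G (\<tau> w)) z = t *s dz G (\<tau> z)"
  unfolding dz_def pd_chain_holomorphic[OF assms] pd_decomp[OF assms(2), of "t * _"]
  by (simp add: scaleR_eq_smult vec_eq_iff complex_eq_iff field_simps)

lemma dz_cong_open:
  assumes "open D" "z \<in> D" "\<And>w. w \<in> D \<Longrightarrow> F w = G w"
  shows "dz F z = dz G z"
  using pd_cong_open[OF assms] by (simp add: dz_def)

section \<open>The identity theorem on a connected surface\<close>

lemma connectedin_clopen:
  assumes "connectedin M V" "openin M S" "openin M (V - S)" "S \<subseteq> V" "S \<noteq> {}"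
  shows "S = V"
proof (rule ccontr)
  assume "S \<noteq> V"
  then have "S \<inter> V \<noteq> {}" "(V - S) \<inter> V \<noteq> {}" "V \<subseteq> S \<union> (V - S)" "S \<inter> (V - S) \<inter> V = {}"
    using assms(4,5) by auto
  then show False using assms(1-3) unfolding connectedin by blast
qed

text \<open>\<open>compat\<close> asks only that zeros correspond across charts, which any quadratic
  differential satisfies. The interior \<open>S\<close> of the common zero set is open and nonempty,
  and its complement in \<open>V\<close> is shown to be open as well.\<close>

lemma surface_identity:
  assumes M: "riemann_surface M A" and V: "openin M V" "connectedin M V"
    and hol: "\<And>c. c \<in> A \<Longrightarrow> T c holomorphic_on cdom c V"
    and compat: "\<And>c c' p. c \<in> A \<Longrightarrow> c' \<in> A \<Longrightarrow> p \<in> fst c \<Longrightarrow> p \<in> fst c' \<Longrightarrow> p \<in> V \<Longrightarrow>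
      T c (snd c p) = 0 \<Longrightarrow> T c' (snd c' p) = (0 :: complex)"
    and b: "b \<in> A" and B: "open B" "B \<subseteq> cdom b V" "B \<noteq> {}" "\<And>z. z \<in> B \<Longrightarrow> T b z = 0"
    and c: "c \<in> A" and z: "z \<in> cdom c V"
  shows "T c z = 0"
proof -
  define Z where "Z = {p \<in> V. \<forall>c\<in>A. p \<in> fst c \<longrightarrow> T c (snd c p) = 0}"
  define S where "S = M interior_of Z"
  have S: "openin M S" "S \<subseteq> Z" by (simp_all add: S_def interior_of_subset)
  have "openin M (V - S)"
  proof (subst openin_subopen, intro ballI)
    fix p assume p: "p \<in> V - S"
    then obtain c where c: "c \<in> A" "p \<in> fst c"
      using chart_at[OF M, of p] openin_subset[OF V(1)] by auto
    have "snd c p \<in> cdom c V" using p c mem_cdom[OF M] by blast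
    then obtain e where e: "e > 0" "ball (snd c p) e \<subseteq> cdom c V"
      using open_cdom[OF M c(1) V(1)] open_contains_ball by blast
    let ?O = "{q \<in> fst c. snd c q \<in> ball (snd c p) e}"
    have O: "openin M ?O" by (rule openin_chart_preimage[OF M c(1) open_ball])
    have OV: "?O \<subseteq> V" using e(2) mem_cdom[OF M c(1)] by blast
    \<comment> \<open>If the disc around \<open>p\<close> met \<open>S\<close>, then
      \<open>T c\<close> would vanish on an open part of it, hence on all of it, and
      \<open>p\<close> would lie in \<open>S\<close>.\<close>
    have "?O \<inter> S = {}"
    proof (rule ccontr)
      assume "?O \<inter> S \<noteq> {}"
      then obtain q where q: "q \<in> ?O" "q \<in> S" by blast
      have q': "q \<in> fst c" using q by simp
      have op: "open (cdom c (?O \<inter> S))" by (rule open_cdom[OF M c(1) openin_Int[OF O S(1)]])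
      have qc: "snd c q \<in> cdom c (?O \<inter> S)" using mem_cdom[OF M c(1) q'] q by blast
      have sub: "cdom c (?O \<inter> S) \<subseteq> ball (snd c p) e" by (auto simp: cdom_def)
      have zero: "T c w = 0" if "w \<in> cdom c (?O \<inter> S)" for w
        using that S(2) c(1) by (auto simp: cdom_def Z_def)
      have "T c w = 0" if "w \<in> ball (snd c p) e" for w
      proof (rule analytic_continuation_open[of "cdom c (?O \<inter> S)" "ball (snd c p) e" "T c" "\<lambda>_. 0"])
        show "T c holomorphic_on ball (snd c p) e" by (rule holomorphic_on_subset[OF hol[OF c(1)] e(2)])
      qed (use op qc sub zero that in auto)
      then have "?O \<subseteq> Z"
        using OV compat[OF c(1)] by (auto simp: Z_def)
      then have "?O \<subseteq> S" using O by (simp add: S_def interior_of_maximal)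
      moreover have "p \<in> ?O" using c e by simp
      ultimately show False using p by blast
    qed
    moreover have "p \<in> ?O" using c e by simp
    ultimately show "\<exists>T. openin M T \<and> p \<in> T \<and> T \<subseteq> V - S" using O OV by blast
  qed
  moreover have "S \<noteq> {}"
  proof -
    let ?O = "{q \<in> fst b. snd b q \<in> B}"
    have "?O \<subseteq> Z"
      using B mem_cdom[OF M b] compat[OF b] by (auto simp: Z_def)
    then have "?O \<subseteq> S" using openin_chart_preimage[OF M b B(1)] by (simp add: S_def interior_of_maximal)
    moreover obtain x where "x \<in> B" using B(3) by blast
    moreover obtain p where "p \<in> fst b" "x = snd b p" using B(2) \<open>x \<in> B\<close> by (auto simp: cdom_def)
    ultimately show ?thesis using \<open>x \<in> B\<close> by blast
  qed
  moreover have "S \<subseteq> V" using S(2) by (auto simp: Z_def)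
  ultimately have "S = V" using connectedin_clopen[OF V(2) S(1)] by blast
  then show ?thesis using S(2) z c by (auto simp: Z_def cdom_def)
qed

lemma loc_cvec: "loc c (cvec \<circ> F) = (\<lambda>z. cvec (loc c F z))"
  by (simp add: loc_def comp_def)

lemma loc_pair_lift: "loc c (pair_lift F N) = (\<lambda>z. cpx (loc c F z) (loc c N z))"
  by (simp add: loc_def comp_def pair_lift_def cpair_def cpx_def)

lemma loc_cpair: "loc c (\<lambda>p. cline (cpair F N p)) = (\<lambda>z. cline (cpx (loc c F z) (loc c N z)))"
  by (simp add: loc_def comp_def cpair_def cline_cpx)

lemma loc_Pair: "loc c (\<lambda>p. (F p, N p)) = (\<lambda>z. (loc c F z, loc c N z))"
  by (simp add: loc_def comp_def)

lemma fubini_study_metric_cong: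
  "fubini_study_metric D f \<rho> \<Longrightarrow> (\<And>z. z \<in> D \<Longrightarrow> \<rho> z = \<rho>' z) \<Longrightarrow> fubini_study_metric D f \<rho>'"
  unfolding fubini_study_metric_def by (metis subsetD)

lemma euclid_metric_cong:
  "euclid_metric D F \<rho> \<Longrightarrow> (\<And>z. z \<in> D \<Longrightarrow> \<rho> z = \<rho>' z) \<Longrightarrow> euclid_metric D F \<rho>'"
  unfolding euclid_metric_def by metis

section \<open>From minimal surfaces to minimal Lagrangian surfaces\<close>

lemma minimal_lagrangian_of_minimal_S3:
  fixes fmin N :: "'a \<Rightarrow> real^4" and uhat :: "'a chart \<Rightarrow> complex \<Rightarrow> real"
  assumes M: "riemann_surface M A"
    and min: "minimal_surface_S3 A (topspace M) fmin N"
    and met: "surface_metric A (topspace M) fmin (\<lambda>c z. 2 * exp (uhat c z))"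
    and Q: "hopf_differential A (topspace M) fmin N Q"
  defines "f \<equiv> \<lambda>p. cline (cpair fmin N p)"
  shows "minimal_lagrangian_surface A (topspace M) f"
    "horizontal_lift A (topspace M) f (pair_lift fmin N)"
    "lift_differential A (topspace M) (pair_lift fmin N) (\<lambda>c z. - \<i> * Q c z)"
    "\<forall>c\<in>A. (\<lambda>z. - \<i> * Q c z) holomorphic_on cdom c (topspace M)"
    "surface_metric_Q2 A (topspace M) f (\<lambda>c z. exp (uhat c z) + (cmod (Q c z))\<^sup>2 * exp (- uhat c z))"
proof -
  let ?\<rho> = "\<lambda>c z. exp (uhat c z) + (cmod (Q c z))\<^sup>2 * exp (- uhat c z)"
  have local: "minimal_S3 (cdom c (topspace M)) (loc c fmin) (loc c N) (\<lambda>z. 2 * exp (uhat c z))" if c: "c \<in> A" for c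
    using min met c open_cdom[OF M c openin_topspace]
    by unfold_locales (auto simp: minimal_surface_S3_def surface_metric_def)
  have chart: "smooth_in_CP3 (cdom c (topspace M)) (loc c f) \<and>
      fubini_study_metric (cdom c (topspace M)) (loc c f) (?\<rho> c) \<and>
      lagrangian (cdom c (topspace M)) (loc c f) \<and> minimal_in_Q2 (cdom c (topspace M)) (loc c f) \<and>
      lift_on (cdom c (topspace M)) (loc c f) (loc c (pair_lift fmin N)) \<and>
      (\<forall>z\<in>cdom c (topspace M).
         herm (dz (loc c (pair_lift fmin N)) z) (loc c (pair_lift fmin N) z) = 0 \<and>
         herm (dzb (loc c (pair_lift fmin N)) z) (loc c (pair_lift fmin N) z) = 0 \<and>
         cbil (loc c (pair_lift fmin N) z) (loc c (pair_lift fmin N) z) = 0 \<and>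
         cbil (dz (loc c (pair_lift fmin N)) z) (dz (loc c (pair_lift fmin N)) z) = - \<i> * Q c z) \<and>
      (\<lambda>z. - \<i> * Q c z) holomorphic_on cdom c (topspace M)" if c: "c \<in> A" for c
  proof -
    let ?D = "cdom c (topspace M)"
    interpret m: minimal_S3 ?D "loc c fmin" "loc c N" "\<lambda>z. 2 * exp (uhat c z)" by (rule local[OF c])
    interpret L: lagrangian_lift ?D m.lift "\<lambda>z. (2 * exp (uhat c z) + 4 * (cmod (m.hopf z))\<^sup>2 / (2 * exp (uhat c z))) / 2"
      by (rule m.lagrangian_lift)
    have hopf: "m.hopf z = Q c z" if "z \<in> ?D" for z
      using Q c that by (auto simp: hopf_differential_def m.hopf_def loc_cvec)
    have lift: "loc c (pair_lift fmin N) = m.lift"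
      by (simp add: loc_pair_lift m.lift_def[abs_def])
    have f: "loc c f = (\<lambda>z. cline (m.lift z))"
      by (simp add: f_def loc_cpair m.lift_def[abs_def])
    have fz: "loc c f z = cline (m.lift z)" for z by (simp add: f)
    note s = L.surface_of_lift[of "loc c f", OF fz m.laplacian_lift]
    have "(2 * exp (uhat c z) + 4 * (cmod (m.hopf z))\<^sup>2 / (2 * exp (uhat c z))) / 2 = ?\<rho> c z" if "z \<in> ?D" for z
      unfolding hopf[OF that] by (simp add: exp_minus field_simps)
    note fs = fubini_study_metric_cong[OF s(2) this]
    have lo: "lift_on ?D (loc c f) m.lift"
      using L.open_D L.smooth L.norm_F fz by (simp add: lift_on_def)
    have hol: "(\<lambda>z. - \<i> * Q c z) holomorphic_on ?D"
      by (rule holomorphic_transform[OF m.holomorphic_hopf]) (simp add: hopf)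
    show ?thesis
      unfolding lift using s(1,3,4) fs lo hol L.frame(1,3) L.isotropic m.differential_lift hopf by simp
  qed
  show "horizontal_lift A (topspace M) f (pair_lift fmin N)"
    unfolding horizontal_lift_def using chart by blast
  show "lift_differential A (topspace M) (pair_lift fmin N) (\<lambda>c z. - \<i> * Q c z)"
    unfolding lift_differential_def using chart by blast
  show "\<forall>c\<in>A. (\<lambda>z. - \<i> * Q c z) holomorphic_on cdom c (topspace M)" using chart by blast
  show "surface_metric_Q2 A (topspace M) f ?\<rho>"
    unfolding surface_metric_Q2_def using chart by blast
  have "f p \<in> Q2" if p: "p \<in> topspace M" for p
  proof -
    obtain c where c: "c \<in> A" "p \<in> fst c" using chart_at[OF M p] .
    have z: "snd c p \<in> cdom c (topspace M)" using mem_cdom[OF M c] p by blast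
    let ?v = "loc c (pair_lift fmin N) (snd c p)"
    have v: "cbil ?v ?v = 0" "norm ?v = 1" "loc c f (snd c p) = cline ?v"
      using chart[OF c(1)] z by (auto simp: lift_on_def)
    then have "f p = cline ?v" using loc_chart[OF M c, of f] by simp
    moreover have "?v \<noteq> 0" using v(2) by force
    ultimately show ?thesis using v(1) by (auto simp: Q2_def CP3_def cline_def cbil_simps)
  qed
  moreover have "0 < ?\<rho> c z" for c z by (simp add: add_pos_nonneg)
  ultimately show "minimal_lagrangian_surface A (topspace M) f"
    unfolding minimal_lagrangian_surface_def
    by (intro conjI ballI exI[of _ "?\<rho> _"]) (use chart in blast)+
qed

section \<open>From minimal Lagrangian surfaces to minimal surfaces\<close>

text \<open>The factor \<surd>2 undoes the normalisation in \<open>cpx\<close>, so that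
  \<open>sRe\<close> and \<open>sIm\<close> invert it.\<close>

definition sRe :: "complex^4 \<Rightarrow> real^4" where "sRe v = (\<chi> k. sqrt 2 * Re (v $ k))"
definition sIm :: "complex^4 \<Rightarrow> real^4" where "sIm v = (\<chi> k. sqrt 2 * Im (v $ k))"

lemma cpx_sRe_sIm: "cpx (sRe v) (sIm v) = v"
  by (simp add: cpx_def sRe_def sIm_def cvec_def vec_eq_iff complex_eq_iff)

lemma bounded_linear_sRe: "bounded_linear sRe" and bounded_linear_sIm: "bounded_linear sIm"
  unfolding linear_conv_bounded_linear[symmetric]
  by (auto intro!: linearI simp: sRe_def sIm_def vec_eq_iff algebra_simps)

lemma loc_comp: "loc c (\<lambda>p. h (F p)) = (\<lambda>z. h (loc c F z))"
  by (simp add: loc_def comp_def)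

lemma herm_pd_eq_0:
  assumes "herm (dz F z) w = 0" "herm (dzb F z) w = 0" "F differentiable at z"
  shows "herm (pd v F z) w = 0"
proof -
  have "pd 1 F z = dz F z + dzb F z" "pd \<i> F z = \<i> *s (dz F z - dzb F z)"
    by (simp_all add: dz_def dzb_def vec_eq_iff field_simps)
  then have "herm (pd 1 F z) w = 0" "herm (pd \<i> F z) w = 0" using assms(1,2) by (simp_all add: cbil_simps)
  then show ?thesis by (subst pd_decomp[OF assms(3)]) (simp add: cbil_simps scaleR_eq_smult)
qed

text \<open>Connectedness of \<open>V\<close> serves twice: it spreads the vanishing of
  \<open>Th\<close> from an open set, and it makes the sign in \<open>unique\<close>
  constant.\<close>

locale minimal_lagrangian_lift =
  fixes M :: "'a topology" and A :: "'a chart set" and f :: "'a \<Rightarrow> (complex^4) set"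
    and u :: "'a chart \<Rightarrow> complex \<Rightarrow> real" and V :: "'a set" and fhat :: "'a \<Rightarrow> complex^4"
    and \<alpha> :: "'a chart \<Rightarrow> complex \<Rightarrow> complex"
  assumes M: "riemann_surface M A"
    and surface: "minimal_lagrangian_surface A (topspace M) f"
    and met: "surface_metric_Q2 A (topspace M) f (\<lambda>c z. 2 * exp (u c z))"
    and V: "openin M V" "connectedin M V"
    and hor: "horizontal_lift A V f fhat"
    and phase: "phase_normalised A V fhat"
    and diff: "lift_differential A V fhat \<alpha>"
begin

definition fmin :: "'a \<Rightarrow> real^4" where "fmin p = sRe (fhat p)"
definition N :: "'a \<Rightarrow> real^4" where "N p = sIm (fhat p)"

lemma fhat_eq: "fhat p = cpx (fmin p) (N p)" by (simp add: fmin_def N_def cpx_sRe_sIm)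

lemma loc_fhat: "loc c fhat = (\<lambda>z. cpx (loc c fmin z) (loc c N z))"
  by (simp add: loc_def comp_def fhat_eq)

lemma cdom_subset: "cdom c V \<subseteq> cdom c (topspace M)"
  using openin_subset[OF V(1)] by (auto simp: cdom_def)

lemma lift: "c \<in> A \<Longrightarrow> lift_on (cdom c V) (loc c f) (loc c fhat)"
  using hor by (auto simp: horizontal_lift_def)

lemma f_eq:
  assumes "p \<in> V"
  shows "f p = cline (fhat p)"
proof -
  obtain c where c: "c \<in> A" "p \<in> fst c" using chart_at[OF M] assms openin_subset[OF V(1)] by blast
  then have "snd c p \<in> cdom c V" using mem_cdom[OF M c] assms by blast
  then show ?thesis using lift[OF c(1)] loc_chart[OF M c] by (metis lift_on_def)
qed

lemma lagrangian_lift: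
  assumes c: "c \<in> A"
  shows "lagrangian_lift (cdom c V) (loc c fhat) (\<lambda>z. 2 * exp (u c z))"
proof
  let ?F = "loc c fhat"
  show op: "open (cdom c V)" by (rule open_cdom[OF M c V(1)])
  show sm: "smooth_on (cdom c V) ?F" using lift[OF c] by (simp add: lift_on_def)
  fix z assume z: "z \<in> cdom c V"
  show "norm (?F z) = 1" using lift[OF c] z by (simp add: lift_on_def)
  show "0 < 2 * exp (u c z)" by simp
  obtain p where p: "p \<in> fst c" "p \<in> V" "z = snd c p" using cdomE[OF z] .
  have "f p \<in> Q2" using surface p(2) openin_subset[OF V(1)] by (auto simp: minimal_lagrangian_surface_def)
  moreover have "fhat p \<in> f p" unfolding f_eq[OF p(2)] cline_def by (rule range_eqI[of _ _ 1]) simp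
  ultimately show "cbil (?F z) (?F z) = 0" using loc_chart[OF M c p(1), of fhat] p(3) by (simp add: Q2_def)
  have h: "herm (pd v ?F z) (?F z) = 0" for v
    using hor c z by (intro herm_pd_eq_0 smooth_on_differentiable[OF sm op z]) (auto simp: horizontal_lift_def)
  have p': "push ?F v z = pd v ?F z" for v by (simp add: push_def hor_part_def h)
  fix v
  show "herm (pd v ?F z) (?F z) = 0" by (rule h)
  fix w
  have "push ?F v z \<bullet> push ?F w z = 2 * exp (u c z) * (v \<bullet> w)"
    using met c lift[OF c] z cdom_subset unfolding surface_metric_Q2_def fubini_study_metric_def by blast
  moreover have "kaehler_form (push ?F v z) (push ?F w z) = 0"
    using surface c lift[OF c] z cdom_subset unfolding minimal_lagrangian_surface_def lagrangian_def by blast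
  ultimately show "herm (pd v ?F z) (pd w ?F z) = complex_of_real (2 * exp (u c z) * (v \<bullet> w))"
    by (simp add: p' kaehler_form_def inner_eq_herm cbil_simps complex_eq_iff)
qed

lemma minimal_lift:
  assumes c: "c \<in> A"
  shows "minimal_lift (cdom c V) (loc c fmin) (loc c N) (\<lambda>z. 2 * exp (u c z))"
proof -
  interpret L: lagrangian_lift "cdom c V" "loc c fhat" "\<lambda>z. 2 * exp (u c z)" by (rule lagrangian_lift[OF c])
  show ?thesis
  proof (intro minimal_lift.intro minimal_lift_axioms.intro)
    show "lagrangian_lift (cdom c V) (\<lambda>z. cpx (loc c fmin z) (loc c N z)) (\<lambda>z. 2 * exp (u c z))"
      using lagrangian_lift[OF c] by (simp only: loc_fhat)
    show "smooth_on (cdom c V) (loc c fmin)" "smooth_on (cdom c V) (loc c N)"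
      unfolding fmin_def[abs_def] N_def[abs_def] loc_comp[of c _ fhat]
      by (rule smooth_on_bounded_linear[OF L.open_D _ L.smooth], rule bounded_linear_sRe bounded_linear_sIm)+
    fix z v assume z: "z \<in> cdom c V"
    have "mean_curv_Q2 (loc c fhat) z = 0"
      using surface c lift[OF c] z cdom_subset unfolding minimal_lagrangian_surface_def minimal_in_Q2_def by blast
    from L.laplacian_orthogonal_of_minimal[OF z this]
    show "herm (laplacian (\<lambda>z. cpx (loc c fmin z) (loc c N z)) z) (pd v (\<lambda>z. cpx (loc c fmin z) (loc c N z)) z) = 0"
      unfolding loc_fhat .
    show "cbil (dz (\<lambda>z. cpx (loc c fmin z) (loc c N z)) z) (dzb (\<lambda>z. cpx (loc c fmin z) (loc c N z)) z) \<in> \<real>\<^sub>\<ge>\<^sub>0"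
      using phase c z unfolding phase_normalised_def loc_fhat by blast
  qed
qed

text \<open>\<open>Theta\<close> depends only on the first map of the pair, so these are the
  coefficients of one quadratic differential in all charts.\<close>

abbreviation Th :: "'a chart \<Rightarrow> complex \<Rightarrow> complex" where
  "Th c \<equiv> minimal_lift.Theta (loc c fmin)"

lemma Th_def:
  assumes "c \<in> A"
  shows "Th c z = cbil (dz (\<lambda>z. cvec (loc c fmin z)) z) (dz (\<lambda>z. cvec (loc c fmin z)) z)"
  by (rule minimal_lift.Theta_def[OF minimal_lift[OF assms]])

text \<open>A change of coordinate multiplies the coefficient by the square of the derivative of the
  transition map.\<close>

lemma Th_compat:
  assumes c: "c \<in> A" "c' \<in> A" "p \<in> fst c" "p \<in> fst c'" "p \<in> V" and 0: "Th c' (snd c' p) = 0"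
  shows "Th c (snd c p) = 0"
proof -
  interpret m: minimal_lift "cdom c' V" "loc c' fmin" "loc c' N" "\<lambda>z. 2 * exp (u c' z)" by (rule minimal_lift[OF c(2)])
  obtain \<tau> t W where \<tau>: "(\<tau> has_field_derivative t) (at (snd c p))" "\<tau> (snd c p) = snd c' p"
    "open W" "snd c p \<in> W" "\<And>F :: 'a \<Rightarrow> real^4. \<And>z. z \<in> W \<Longrightarrow> loc c F z = loc c' F (\<tau> z)"
    using transition_derivative[OF M c(1,2) V(1) c(3-5), where 'b = "real^4"] by metis
  have z': "snd c' p \<in> cdom c' V" using mem_cdom[OF M c(2,4)] c(5) by blast
  let ?G = "\<lambda>z. cvec (loc c' fmin z)"
  have "?G differentiable at (\<tau> (snd c p))"
    unfolding \<tau>(2) by (rule differentiable_bounded_linear[OF bounded_linear_cvec m.diff_F[OF z']])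
  then have "dz (\<lambda>w. ?G (\<tau> w)) (snd c p) = t *s dz ?G (snd c' p)"
    using dz_chain[OF \<tau>(1)] \<tau>(2) by simp
  moreover have "dz (\<lambda>z. cvec (loc c fmin z)) (snd c p) = dz (\<lambda>w. ?G (\<tau> w)) (snd c p)"
    by (rule dz_cong_open[OF \<tau>(3,4)]) (simp add: \<tau>(5))
  ultimately show ?thesis using 0 unfolding Th_def[OF c(1)] Th_def[OF c(2)] by (simp add: cbil_simps)
qed

text \<open>If \<open>\<langle>fhat\<^sub>z, fhat\<^bsub>zb\<^esub>\<rangle>\<close> is nonzero somewhere then the holomorphic differential \<open>Th\<close> vanishes on an open
  set; otherwise the last clause of the phase condition applies.\<close>

lemma Th_zero:
  assumes c: "c \<in> A" and z: "z \<in> cdom c V"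
  shows "Th c z = 0"
proof (cases "\<forall>c\<in>A. \<forall>z\<in>cdom c V. cbil (dz (loc c fhat) z) (dzb (loc c fhat) z) = 0")
  case True
  interpret m: minimal_lift "cdom c V" "loc c fmin" "loc c N" "\<lambda>z. 2 * exp (u c z)" by (rule minimal_lift[OF c])
  have "m.a22 z = - cnj (m.a11 z)"
    using True phase c z unfolding phase_normalised_def m.a22_def m.a11_def loc_fhat[symmetric] by blast
  then show ?thesis using m.a22_eq_cnj[OF z] by blast
next
  case False
  then obtain c0 z0 where c0: "c0 \<in> A" "z0 \<in> cdom c0 V"
    "cbil (dz (loc c0 fhat) z0) (dzb (loc c0 fhat) z0) \<noteq> 0" by blast
  interpret m: minimal_lift "cdom c0 V" "loc c0 fmin" "loc c0 N" "\<lambda>z. 2 * exp (u c0 z)" by (rule minimal_lift[OF c0(1)])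
  let ?D = "cdom c0 V"
  let ?B = "{z \<in> ?D. m.a12 z \<noteq> 0}"
  have "continuous_on ?D (\<lambda>z. pd v (loc c0 fhat) z)" for v
    unfolding loc_fhat by (intro smooth_on_continuous smooth_on_pd m.smooth)
  moreover have "continuous_on ?D (\<lambda>z. a *s g z)" if "continuous_on ?D g" for a :: complex and g :: "complex \<Rightarrow> complex^4"
    using bounded_linear.continuous_on[OF bounded_linear_smult that] .
  ultimately have "continuous_on ?D (dz (loc c0 fhat))" "continuous_on ?D (dzb (loc c0 fhat))"
    unfolding dz_def[abs_def] dzb_def[abs_def] by (auto intro!: continuous_intros)
  then have "continuous_on ?D m.a12"
    unfolding m.a12_def[abs_def] loc_fhat[symmetric]
    by (rule bounded_bilinear.continuous_on[OF bounded_bilinear_cbil])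
  then have "open (?D \<inter> m.a12 -` (- {0}))"
    by (rule continuous_open_preimage[OF _ m.open_D]) (rule open_Compl[OF closed_singleton])
  moreover have "?D \<inter> m.a12 -` (- {0}) = ?B" by auto
  ultimately have op: "open ?B" by simp
  have z0: "z0 \<in> ?B" using c0 unfolding m.a12_def loc_fhat[symmetric] by blast
  show ?thesis
  proof (rule surface_identity[OF M V, where T = Th and b = c0 and B = ?B])
    show "Th c holomorphic_on cdom c V" if "c \<in> A" for c
      by (rule minimal_lift.holomorphic_Theta[OF minimal_lift[OF that]])
    show "Th c' (snd c' p) = 0"
      if "c \<in> A" "c' \<in> A" "p \<in> fst c" "p \<in> fst c'" "p \<in> V" "Th c (snd c p) = 0" for c c' p
      by (rule Th_compat[OF that(2,1,4,3,5,6)])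
    show "Th c0 z = 0" if "z \<in> ?B" for z using m.Theta_eq_0 that by blast
  qed (use c0 z0 op c z in auto)
qed

text \<open>The chartwise results with \<rho> = 2 e^u, where \<open>Th_zero\<close> supplies the
  vanishing of \<open>Theta\<close> on which conformality rests.\<close>

lemma surface_facts:
  shows "unit_tangent_map A V (\<lambda>p. (fmin p, N p))"
    "\<forall>p\<in>V. f p = cline (cpair fmin N p)"
    "\<forall>p\<in>V. fhat p = pair_lift fmin N p"
    "sasaki_metric A V (\<lambda>p. (fmin p, N p)) (\<lambda>c z. 4 * exp (u c z))"
    "minimal_surface_S3 A V fmin N"
    "minimal_surface_S3 A {p\<in>V. \<forall>c\<in>A. p \<in> fst c \<longrightarrow> \<alpha> c (snd c p) \<noteq> 0} N fmin"
    "hopf_differential A V fmin N (\<lambda>c z. \<i> * \<alpha> c z)"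
    "hopf_differential A V N fmin (\<lambda>c z. \<i> * \<alpha> c z)"
    "\<forall>c\<in>A. \<forall>z\<in>cdom c V. cmod (\<alpha> c z) \<le> exp (u c z)"
    "surface_metric A V fmin
       (\<lambda>c z. 2 * (exp (u c z) + sqrt (exp (2 * u c z) - (cmod (\<alpha> c z))\<^sup>2)))"
    "surface_metric A V N
       (\<lambda>c z. 2 * (exp (u c z) - sqrt (exp (2 * u c z) - (cmod (\<alpha> c z))\<^sup>2)))"
proof -
  have fh: "fhat = pair_lift fmin N"
    by (rule ext) (simp add: fhat_eq pair_lift_def cpair_def cpx_def)
  then show "\<forall>p\<in>V. fhat p = pair_lift fmin N p" by simp
  show "\<forall>p\<in>V. f p = cline (cpair fmin N p)"
    using f_eq by (simp add: fhat_eq cline_cpx cpair_def)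
  have chart: "smooth_on (cdom c V) (loc c fmin) \<and> smooth_on (cdom c V) (loc c N) \<and>
      minimal_in_S3 (cdom c V) (loc c fmin) (loc c N) \<and>
      (\<forall>D'\<subseteq>cdom c V. (\<forall>z\<in>D'. \<alpha> c z \<noteq> 0) \<longrightarrow> minimal_in_S3 D' (loc c N) (loc c fmin)) \<and>
      euclid_metric (cdom c V) (loc c fmin) (\<lambda>z. 2 * (exp (u c z) + sqrt (exp (2 * u c z) - (cmod (\<alpha> c z))\<^sup>2))) \<and>
      euclid_metric (cdom c V) (loc c N) (\<lambda>z. 2 * (exp (u c z) - sqrt (exp (2 * u c z) - (cmod (\<alpha> c z))\<^sup>2))) \<and>
      (\<forall>z\<in>cdom c V. cmod (\<alpha> c z) \<le> exp (u c z) \<and>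
        cbil (dz (dz (\<lambda>z. cvec (loc c fmin z))) z) (cvec (loc c N z)) = \<i> * \<alpha> c z \<and>
        cbil (dz (dz (\<lambda>z. cvec (loc c N z))) z) (cvec (loc c fmin z)) = \<i> * \<alpha> c z \<and>
        (loc c fmin z, loc c N z) \<in> US3 \<and>
        (\<forall>v w. sasaki (loc c fmin z, loc c N z) (pd v (\<lambda>z. (loc c fmin z, loc c N z)) z)
           (pd w (\<lambda>z. (loc c fmin z, loc c N z)) z) = 4 * exp (u c z) * (v \<bullet> w)))"
    if c: "c \<in> A" for c
  proof -
    interpret m: minimal_lift "cdom c V" "loc c fmin" "loc c N" "\<lambda>z. 2 * exp (u c z)" by (rule minimal_lift[OF c])
    note Th = Th_zero[OF c]
    have \<alpha>: "m.a11 z = \<alpha> c z" if "z \<in> cdom c V" for z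
      using diff c that unfolding lift_differential_def m.a11_def loc_fhat[symmetric] by blast
    have e2: "exp (2 * u c z) = (exp (u c z))\<^sup>2" for z by (simp add: exp_double)
    have b: "Re (m.a12 z) = sqrt (exp (2 * u c z) - (cmod (\<alpha> c z))\<^sup>2)" if "z \<in> cdom c V" for z
      using m.a12_eq[OF that] \<alpha>[OF that] by (simp add: e2)
    have 1: "euclid_metric (cdom c V) (loc c fmin) (\<lambda>z. 2 * (exp (u c z) + sqrt (exp (2 * u c z) - (cmod (\<alpha> c z))\<^sup>2)))"
      by (rule euclid_metric_cong[OF m.metric_F[OF Th]]) (simp_all add: b)
    have 2: "euclid_metric (cdom c V) (loc c N) (\<lambda>z. 2 * (exp (u c z) - sqrt (exp (2 * u c z) - (cmod (\<alpha> c z))\<^sup>2)))"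
      by (rule euclid_metric_cong[OF m.metric_N[OF Th]]) (simp_all add: b)
    have 3: "minimal_in_S3 D' (loc c N) (loc c fmin)" if "D' \<subseteq> cdom c V" "\<forall>z\<in>D'. \<alpha> c z \<noteq> 0" for D'
      by (rule m.minimal_N[OF Th that(1)]) (use \<alpha> that in auto)
    have 4: "cmod (\<alpha> c z) \<le> exp (u c z)"
      "cbil (dz (dz (\<lambda>z. cvec (loc c fmin z))) z) (cvec (loc c N z)) = \<i> * \<alpha> c z"
      "cbil (dz (dz (\<lambda>z. cvec (loc c N z))) z) (cvec (loc c fmin z)) = \<i> * \<alpha> c z"
      "(loc c fmin z, loc c N z) \<in> US3"
      if z: "z \<in> cdom c V" for z
      using m.a11_le[OF z] m.hopf[OF Th z] \<alpha>[OF z] m.orthonormal[OF z] by (simp_all add: US3_def)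
    have 5: "sasaki (loc c fmin z, loc c N z) (pd v (\<lambda>z. (loc c fmin z, loc c N z)) z)
           (pd w (\<lambda>z. (loc c fmin z, loc c N z)) z) = 4 * exp (u c z) * (v \<bullet> w)"
      if z: "z \<in> cdom c V" for z v w
      unfolding pd_Pair[OF m.diff_F[OF z] m.diff_N[OF z]] m.sasaki_eq[OF z] by simp
    show ?thesis
      by (intro conjI ballI allI impI m.smooth_F m.smooth_N m.minimal_F[OF Th] 1 2 3 4 5) blast+
  qed
  show "minimal_surface_S3 A V fmin N" using chart by (simp add: minimal_surface_S3_def)
  show "hopf_differential A V fmin N (\<lambda>c z. \<i> * \<alpha> c z)" "hopf_differential A V N fmin (\<lambda>c z. \<i> * \<alpha> c z)"
    using chart by (simp_all add: hopf_differential_def loc_cvec)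
  show "\<forall>c\<in>A. \<forall>z\<in>cdom c V. cmod (\<alpha> c z) \<le> exp (u c z)" using chart by blast
  show "surface_metric A V fmin (\<lambda>c z. 2 * (exp (u c z) + sqrt (exp (2 * u c z) - (cmod (\<alpha> c z))\<^sup>2)))"
    "surface_metric A V N (\<lambda>c z. 2 * (exp (u c z) - sqrt (exp (2 * u c z) - (cmod (\<alpha> c z))\<^sup>2)))"
    using chart by (simp_all add: surface_metric_def)
  show "sasaki_metric A V (\<lambda>p. (fmin p, N p)) (\<lambda>c z. 4 * exp (u c z))"
    using chart by (simp add: sasaki_metric_def loc_Pair)
  show "minimal_surface_S3 A {p\<in>V. \<forall>c\<in>A. p \<in> fst c \<longrightarrow> \<alpha> c (snd c p) \<noteq> 0} N fmin"
    unfolding minimal_surface_S3_def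
  proof
    fix c assume c: "c \<in> A"
    let ?V = "{p\<in>V. \<forall>c\<in>A. p \<in> fst c \<longrightarrow> \<alpha> c (snd c p) \<noteq> 0}"
    have "cdom c ?V \<subseteq> cdom c V" "\<forall>z\<in>cdom c ?V. \<alpha> c z \<noteq> 0" using c by (auto simp: cdom_def)
    then show "minimal_in_S3 (cdom c ?V) (loc c N) (loc c fmin)" using chart[OF c] by blast
  qed
  have "(fmin p, N p) \<in> US3" if p: "p \<in> V" for p
  proof -
    obtain c where c: "c \<in> A" "p \<in> fst c" using chart_at[OF M] p openin_subset[OF V(1)] by blast
    then have "snd c p \<in> cdom c V" using mem_cdom[OF M c] p by blast
    then show ?thesis using chart[OF c(1)] loc_chart[OF M c, of fmin] loc_chart[OF M c, of N] by auto
  qed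
  moreover have "smooth_on (cdom c V) (loc c (\<lambda>p. (fmin p, N p)))" if c: "c \<in> A" for c
    unfolding loc_Pair using chart[OF c] smooth_on_Pair[OF open_cdom[OF M c V(1)]] by blast
  ultimately show "unit_tangent_map A V (\<lambda>p. (fmin p, N p))" by (simp add: unit_tangent_map_def)
qed

text \<open>The ratio \<open>a\<close> of the two lifts takes only the values 1 and -1 and is
  continuous in every chart, so on the connected set \<open>V\<close> it is constant.\<close>

lemma unique:
  fixes fmin' N' :: "'a \<Rightarrow> real^4"
  assumes ut: "unit_tangent_map A V (\<lambda>p. (fmin' p, N' p))"
    and f': "\<forall>p\<in>V. f p = cline (cpair fmin' N' p)"
    and sas: "sasaki_metric A V (\<lambda>p. (fmin' p, N' p)) (\<lambda>c z. 4 * exp (u c z))"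
    and ph: "phase_normalised A V (pair_lift fmin' N')"
    and di: "lift_differential A V (pair_lift fmin' N') \<alpha>"
  shows "(\<forall>p\<in>V. fmin' p = fmin p \<and> N' p = N p) \<or> (\<forall>p\<in>V. fmin' p = - fmin p \<and> N' p = - N p)"
proof -
  define a where "a p = herm (cpx (fmin' p) (N' p)) (cpx (fmin p) (N p))" for p
  have chart: "(a p = 1 \<or> a p = - 1) \<and> cpx (fmin' p) (N' p) = a p *s cpx (fmin p) (N p) \<and> loc c a differentiable at (snd c p)"
    if c: "c \<in> A" "p \<in> fst c" and p: "p \<in> V" for c p
  proof -
    let ?D = "cdom c V"
    interpret m: minimal_lift ?D "loc c fmin" "loc c N" "\<lambda>z. 2 * exp (u c z)" by (rule minimal_lift[OF c(1)])
    have z: "snd c p \<in> ?D" using mem_cdom[OF M c] p by blast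
    have sm: "smooth_on ?D (\<lambda>z. (loc c fmin' z, loc c N' z))"
      using ut c(1) by (simp add: unit_tangent_map_def loc_Pair)
    have smF: "smooth_on ?D (loc c fmin')" and smN: "smooth_on ?D (loc c N')"
      using smooth_on_bounded_linear[OF m.open_D bounded_linear_fst sm]
        smooth_on_bounded_linear[OF m.open_D bounded_linear_snd sm] by simp_all
    have on: "(loc c fmin' w, loc c N' w) \<in> US3" and fw: "loc c f w = cline (cpx (loc c fmin' w) (loc c N' w))"
      "loc c f w = cline (cpx (loc c fmin w) (loc c N w))" if w: "w \<in> ?D" for w
    proof -
      obtain q where q: "q \<in> fst c" "q \<in> V" "w = snd c q" using cdomE[OF w] .
      note l = loc_chart[OF M c(1) q(1)]
      show "(loc c fmin' w, loc c N' w) \<in> US3" using ut q by (simp add: l unit_tangent_map_def)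
      show "loc c f w = cline (cpx (loc c fmin' w) (loc c N' w))" using f' q by (simp add: l cline_cpx cpair_def)
      show "loc c f w = cline (cpx (loc c fmin w) (loc c N w))" using f_eq[OF q(2)] q by (simp add: l fhat_eq)
    qed
    have nrm: "norm (cpx (loc c fmin' w) (loc c N' w)) = 1" if w: "w \<in> ?D" for w
    proof -
      have "herm (cpx (loc c fmin' w) (loc c N' w)) (cpx (loc c fmin' w) (loc c N' w)) = 1"
        using on[OF w] by (simp add: herm_cpx US3_def norm_eq_1 inner_commute complex_eq_iff)
      then show ?thesis by (simp add: herm_self norm_eq_1)
    qed
    have lift: "lift_on ?D (loc c f) (\<lambda>z. cpx (loc c fmin' z) (loc c N' z))"
      using smooth_on_cpx[OF m.open_D smF smN] m.open_D fw nrm by (simp add: lift_on_def)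
    have d: "loc c fmin' differentiable at w" "loc c N' differentiable at w" if "w \<in> ?D" for w
      using smF smN m.open_D that smooth_on_differentiable by blast+
    have s: "sasaki (loc c fmin' w, loc c N' w) (pd v (loc c fmin') w, pd v (loc c N') w)
        (pd v (loc c fmin') w, pd v (loc c N') w) = 2 * (2 * exp (u c w)) * (v \<bullet> v)" if w: "w \<in> ?D" for w v
    proof -
      have "sasaki (loc c fmin' w, loc c N' w) (pd v (\<lambda>z. (loc c fmin' z, loc c N' z)) w)
          (pd v (\<lambda>z. (loc c fmin' z, loc c N' z)) w) = 4 * exp (u c w) * (v \<bullet> v)"
        using sas c(1) w unfolding sasaki_metric_def loc_Pair by blast
      then show ?thesis by (simp add: pd_Pair[OF d[OF w]])
    qed
    have nn: "cbil (dz (\<lambda>z. cpx (loc c fmin' z) (loc c N' z)) w) (dzb (\<lambda>z. cpx (loc c fmin' z) (loc c N' z)) w) \<in> \<real>\<^sub>\<ge>\<^sub>0"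
      if "w \<in> ?D" for w using ph c(1) that unfolding phase_normalised_def loc_pair_lift by blast
    have sa: "cbil (dz (\<lambda>z. cpx (loc c fmin' z) (loc c N' z)) w) (dz (\<lambda>z. cpx (loc c fmin' z) (loc c N' z)) w) = m.a11 w"
      if w: "w \<in> ?D" for w
    proof -
      have "m.a11 w = \<alpha> c w"
        using diff c(1) w unfolding lift_differential_def m.a11_def loc_fhat[symmetric] by blast
      then show ?thesis using di c(1) w unfolding lift_differential_def loc_pair_lift by simp
    qed
    note ps = m.phase_sign[OF smF smN on lift fw(2) s nn sa z]
    have la: "loc c a = (\<lambda>z. herm (cpx (loc c fmin' z) (loc c N' z)) (cpx (loc c fmin z) (loc c N z)))"
      by (simp add: loc_def comp_def a_def)
    show ?thesis
      using ps unfolding la by (simp add: loc_chart[OF M c] a_def)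
  qed
  have ch: "\<exists>c\<in>A. p \<in> fst c" if "p \<in> V" for p
    using chart_at[OF M, of p] that openin_subset[OF V(1)] by blast
  have pm: "a p = 1 \<or> a p = - 1" "cpx (fmin' p) (N' p) = a p *s cpx (fmin p) (N p)" if "p \<in> V" for p
    using chart ch that by blast+
  \<comment> \<open>For \<open>k\<close> equal to 1 and -1 these sets are complementary in
    \<open>V\<close> and both open.\<close>
  have op: "openin M {p \<in> V. a p \<noteq> k}" for k
  proof (subst openin_subopen, intro ballI)
    fix p assume p: "p \<in> {p \<in> V. a p \<noteq> k}"
    then obtain c where c: "c \<in> A" "p \<in> fst c" using ch by blast
    let ?W = "cdom c V \<inter> loc c a -` (- {k})"
    have "continuous_on (cdom c V) (loc c a)"
    proof (intro continuous_at_imp_continuous_on ballI)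
      fix z assume "z \<in> cdom c V"
      then obtain q where "q \<in> fst c" "q \<in> V" "z = snd c q" by (rule cdomE)
      then show "isCont (loc c a) z" using chart[OF c(1)] differentiable_imp_continuous_within by blast
    qed
    then have W: "open ?W" by (rule continuous_open_preimage[OF _ open_cdom[OF M c(1) V(1)]])
      (rule open_Compl[OF closed_singleton])
    have mem: "q \<in> V \<and> a q \<noteq> k \<longleftrightarrow> snd c q \<in> ?W" if "q \<in> fst c" for q
      using mem_cdom[OF M c(1) that] loc_chart[OF M c(1) that, of a] by auto
    show "\<exists>T. openin M T \<and> p \<in> T \<and> T \<subseteq> {p \<in> V. a p \<noteq> k}"
      by (rule exI[of _ "{q \<in> fst c. snd c q \<in> ?W}"])
        (use openin_chart_preimage[OF M c(1) W] mem c p in blast)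
  qed
  have sign: "fmin' p = fmin p \<and> N' p = N p" if "p \<in> V" "a p = 1" for p
    using pm(2)[OF that(1)] that(2) by (simp add: cpx_eq_iff)
  have sign': "fmin' p = - fmin p \<and> N' p = - N p" if "p \<in> V" "a p = - 1" for p
  proof -
    have "cpx (fmin' p) (N' p) = complex_of_real (- 1) *s cpx (fmin p) (N p)"
      using pm(2)[OF that(1)] that(2) by simp
    then show ?thesis unfolding cpx_lincomb cpx_eq_iff by simp
  qed
  show ?thesis
  proof (cases "{p \<in> V. a p \<noteq> - 1} = {}")
    case True
    then show ?thesis using sign' by blast
  next
    case False
    have "V - {p \<in> V. a p \<noteq> - 1} = {p \<in> V. a p \<noteq> 1}" using pm(1) by auto
    then have "{p \<in> V. a p \<noteq> - 1} = V"
      using connectedin_clopen[OF V(2) op[of "- 1"] _ _ False] op[of 1] by auto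
    then show ?thesis using sign pm(1) by blast
  qed
qed

end

theorem theorem1p9:
  fixes M :: "'a topology" and A :: "'a chart set"
  assumes surface: "riemann_surface M A"
  shows
    "(\<forall>(fmin :: 'a \<Rightarrow> real^4) (N :: 'a \<Rightarrow> real^4)
        (uhat :: 'a chart \<Rightarrow> complex \<Rightarrow> real) (Q :: 'a chart \<Rightarrow> complex \<Rightarrow> complex).
        minimal_surface_S3 A (topspace M) fmin N \<and>
        surface_metric A (topspace M) fmin (\<lambda>c z. 2 * exp (uhat c z)) \<and>
        hopf_differential A (topspace M) fmin N Q \<longrightarrow>
        (let f = (\<lambda>p. cline (cpair fmin N p)) in
           minimal_lagrangian_surface A (topspace M) f \<and>
           horizontal_lift A (topspace M) f (pair_lift fmin N) \<and>
           lift_differential A (topspace M) (pair_lift fmin N) (\<lambda>c z. - \<i> * Q c z) \<and>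
           (\<forall>c\<in>A. (\<lambda>z. - \<i> * Q c z) holomorphic_on cdom c (topspace M)) \<and>
           (\<exists>u :: 'a chart \<Rightarrow> complex \<Rightarrow> real.
              surface_metric_Q2 A (topspace M) f (\<lambda>c z. 2 * exp (u c z)) \<and>
              (\<forall>c\<in>A. \<forall>z\<in>cdom c (topspace M).
                 2 * exp (u c z) =
                 exp (uhat c z) + (cmod (Q c z))\<^sup>2 * exp (- uhat c z)))))
     \<and>
     (\<forall>(f :: 'a \<Rightarrow> (complex^4) set) (u :: 'a chart \<Rightarrow> complex \<Rightarrow> real)
        (V :: 'a set) (fhat :: 'a \<Rightarrow> complex^4) (\<alpha> :: 'a chart \<Rightarrow> complex \<Rightarrow> complex).
        minimal_lagrangian_surface A (topspace M) f \<and>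
        surface_metric_Q2 A (topspace M) f (\<lambda>c z. 2 * exp (u c z)) \<and>
        openin M V \<and> connectedin M V \<and>
        horizontal_lift A V f fhat \<and>
        phase_normalised A V fhat \<and>
        lift_differential A V fhat \<alpha> \<longrightarrow>
        (\<exists>(fmin :: 'a \<Rightarrow> real^4) (N :: 'a \<Rightarrow> real^4).
           unit_tangent_map A V (\<lambda>p. (fmin p, N p)) \<and>
           (\<forall>p\<in>V. f p = cline (cpair fmin N p)) \<and>
           (\<forall>p\<in>V. fhat p = pair_lift fmin N p) \<and>
           sasaki_metric A V (\<lambda>p. (fmin p, N p)) (\<lambda>c z. 4 * exp (u c z)) \<and>
           (\<forall>(fmin' :: 'a \<Rightarrow> real^4) (N' :: 'a \<Rightarrow> real^4).
              unit_tangent_map A V (\<lambda>p. (fmin' p, N' p)) \<and>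
              (\<forall>p\<in>V. f p = cline (cpair fmin' N' p)) \<and>
              sasaki_metric A V (\<lambda>p. (fmin' p, N' p)) (\<lambda>c z. 4 * exp (u c z)) \<and>
              phase_normalised A V (pair_lift fmin' N') \<and>
              lift_differential A V (pair_lift fmin' N') \<alpha> \<longrightarrow>
              (\<forall>p\<in>V. fmin' p = fmin p \<and> N' p = N p) \<or>
              (\<forall>p\<in>V. fmin' p = - fmin p \<and> N' p = - N p)) \<and>
           minimal_surface_S3 A V fmin N \<and>
           minimal_surface_S3 A {p\<in>V. \<forall>c\<in>A. p \<in> fst c \<longrightarrow> \<alpha> c (snd c p) \<noteq> 0} N fmin \<and>
           hopf_differential A V fmin N (\<lambda>c z. \<i> * \<alpha> c z) \<and>
           hopf_differential A V N fmin (\<lambda>c z. \<i> * \<alpha> c z) \<and>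
           (\<forall>c\<in>A. \<forall>z\<in>cdom c V. cmod (\<alpha> c z) \<le> exp (u c z)) \<and>
           surface_metric A V fmin
             (\<lambda>c z. 2 * (exp (u c z) + sqrt (exp (2 * u c z) - (cmod (\<alpha> c z))\<^sup>2))) \<and>
           surface_metric A V N
             (\<lambda>c z. 2 * (exp (u c z) - sqrt (exp (2 * u c z) - (cmod (\<alpha> c z))\<^sup>2)))))"
proof (intro conjI allI impI, goal_cases)
  case (1 fmin N uhat Q)
  let ?\<rho> = "\<lambda>c z. exp (uhat c z) + (cmod (Q c z))\<^sup>2 * exp (- uhat c z)"
  \<comment> \<open>The coefficient is positive, so it is 2 e^u for a real function u.\<close>
  let ?u = "\<lambda>c z. ln (?\<rho> c z / 2)"
  have "0 < ?\<rho> c z" for c z by (simp add: add_pos_nonneg)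
  then have "2 * exp (?u c z) = ?\<rho> c z" for c z by simp
  then show ?case
    unfolding Let_def
    using minimal_lagrangian_of_minimal_S3[OF surface, of fmin N uhat Q] 1
    by (intro conjI exI[of _ ?u]) auto
next
  case (2 f u V fhat \<alpha>)
  then interpret minimal_lagrangian_lift M A f u V fhat \<alpha>
    using surface by unfold_locales auto
  show ?case
    by (rule exI[of _ fmin], rule exI[of _ N], intro conjI allI impI)
      (rule surface_facts unique; blast)+
qed

end
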